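(* Assume the hypotheses [Convexity], [Dynamics], [Running cost], [Terminal cost] and [Inner ball] stated in the context, and that $g$ is locally semiconcave. If the value function $V$ is continuous, then $\mathrm{hypo}(V)$ satisfies an exterior sphere condition and $$N_1^{\dagger}(x)\cup N_0^{\dagger}(x)\neq\varnothing\qquad\text{for all }x\in\mathcal R\setminus\mathcal S.$$ Moreover, for every $x\in\mathcal R\setminus\mathcal S$, $$\partial^{P}V(x)\supseteq \partial^{\infty}V(x)+\mathrm{co}\big[N^{\dagger}_1(x)\big],\qquad \partial^{\infty}V(x)\supseteq\mathrm{co}\big[ N^{\dagger}_0(x)\cup \{0\}\big],$$ where $\mathrm{co}$ denotes the convex hull.
   Context: Setting. $U\subset\mathbb{R}^m$ is nonempty and compact, $\mathcal S\subseteq\mathbb{R}^d$ is nonempty and closed (the target), $\mathcal S^c=\mathbb{R}^d\setminus\mathcal S$, and $f:\mathbb{R}^d\times U\to\mathbb{R}^d$, $r:\mathbb{R}^d\times U\to\mathbb{R}$, $g:\mathbb{R}^d\to\mathbb{R}$ are given. For $x\in\mathbb{R}^d$ and a measurable control $u:[0,\infty)\to U$, $y^{x,u}$ is the Carath\'eodory solution of $y'(s)=f(y(s),u(s))$, $y(0)=x$, and $\tau^{x,u}=\min\{t\ge 0:y^{x,u}(t)\in\mathcal S\}$ ($+\infty$ if $\mathcal S$ is never reached). The value function is $V(x)=\inf_u\big(\int_0^{\tau^{x,u}}r(y^{x,u}(s),u(s))\,ds+g(y^{x,u}(\tau^{x,u}))\big)$, the infimum being over measurable controls with $\tau^{x,u}<\infty$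 ($V(x)=+\infty$ if there are none). $\mathcal R=\{x:\tau^{x,u}<\infty\text{ for some }u\}$. "$V$ is continuous" means continuous on $\mathcal R$. A control $u^*$ is optimal for $x$ if $\tau^{x,u^*}<\infty$ and it attains the infimum; $\mathcal U_x$ is the set of controls optimal for $x$. The Hamiltonian is $H(x,p)=\max_{\omega\in U}\{-p\cdot f(x,\omega)-r(x,\omega)\}$. Hypotheses (with constants $N,L,r_0,\rho_0>0$). [Convexity] For every $x$ the set $\{(v,\lambda)\in\mathbb{R}^d\times\mathbb{R}:\exists\omega\in U,\ v=f(x,\omega),\ \lambda\ge r(x,\omega)\}$ is convex. [Dynamics] $f$ is continuous, $|f|<N$; $D_xf$ exists everywhere and is continuous in $(x,u)$; $|f(y,\omega)-f(x,\omega)|\le L|y-x|$ and $|D_xf(y,\omega)-D_xf(x,\omega)|\le L|y-x|$ for all $x,y\in\mathbb{R}^d$, $\omega\in U$. [Running cost] $r$ is continuous and differentiable in $x$, $D_xr$ is continuous, $|r(y,\omega)-r(x,\omega)|+|D_xr(y,\omega)-D_xr(x,\omega)|\le L|y-x|$ for all $x,y,\omega$, and $r(x,\omega)\ge r_0$ for all $x,\omega$. [Terminal cost] There are a neighborhood $\mathcal N$ of $\partial\mathcal S$ and $0\le G<r_0/N$ with $|g(y)-g(x)|\le G|y-x|$ for $x,y\in\mathcal N$. [Inner ball] For every $x\in\partial\mathcal S$ there is a unit $\xi_x\in N^P_{\overline{\mathcal S^c}}(x)$ with $\xi_x\cdot(y-x)\le\frac1{2\rho_0}|y-x|^2$ for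 all $y\in\overline{\mathcal S^c}$. Nonsmooth notions. For a set $Q$ and $x\in Q$, $v\in N^P_Q(x)$ (proximal normal) iff there is $\sigma\ge0$ with $v\cdot(y-x)\le\sigma|y-x|^2$ for all $y\in Q$; it is realized by a ball of radius $\rho$ if this holds with $\sigma=|v|/(2\rho)$. $\mathrm{hypo}(V)=\{(z,\beta)\in\overline{\mathcal S^c}\times\mathbb{R}:\beta\le V(z)\}$. $\partial^PV(x)=\{v:(-v,1)\in N^P_{\mathrm{hypo}(V)}(x,V(x))\}$, $\partial^\infty V(x)=\{v:(-v,0)\in N^P_{\mathrm{hypo}(V)}(x,V(x))\}$. $\mathrm{hypo}(V)$ satisfies an exterior sphere condition if there is a continuous $\rho:\mathcal R\setminus\mathcal S\to(0,\infty)$ such that for each $x\in\mathcal R\setminus\mathcal S$ some nonzero $v_x\in N^P_{\mathrm{hypo}(V)}(x,V(x))$ is realized by a ball of radius $\rho(x)$. $g$ is locally semiconcave if every point has a ball $B$ and $c>0$ with $(1-\lambda)g(x_0)+\lambda g(x_1)-g((1-\lambda)x_0+\lambda x_1)\le c\lambda(1-\lambda)|x_0-x_1|^2$ for $x_0,x_1\in B$, $\lambda\in[0,1]$. $D^+g(x)=\{p:\limsup_{y\to x}\frac{g(y)-g(x)-p\cdot(y-x)}{|y-x|}\le0\}$. Transported normals. For $x^*\in\partial\mathcal S$: $N_0(x^* )=\{0\ne\xi\in N^P_{\overline{\mathcal S^c}}(x^* ):\max_{\omega\in U}\xi\cdot f(x^*,\omega)=0\}$, $N_1(x^* )=\{\xi\in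 N^P_{\overline{\mathcal S^c}}(x^* ):\max_{\omega\in U}\xi\cdot f(x^*,\omega)>0\}$. For $x\in\mathcal S^c$: $N_0^\dagger(x)$ is the set of $p(0)$ where $p$ solves $p'(t)=-D_x^Tf(y^{x,u^*}(t),u^*(t))p(t)$, $p(\tau^{x,u^*})=-\xi^*$, for some $u^*\in\mathcal U_x$ and $\xi^*\in N_0(y^{x,u^*}(\tau^{x,u^*}))$. $N_1^\dagger(x)$ is the set of $p(0)$ where $p$ solves $p'(t)=-D_x^Tf(y^{x,u^*}(t),u^*(t))p(t)-D_xr(y^{x,u^*}(t),u^*(t))$, $p(\tau^{x,u^*})=q^*-\xi^*$, for some $u^*\in\mathcal U_x$ and, with $x^*=y^{x,u^*}(\tau^{x,u^*})$, some $\xi^*\in N_1(x^* )$, $q^*\in D^+g(x^* )$ satisfying $H(x^*,q^*-\xi^* )=0$. *)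

theory Defs
  imports "HOL-Analysis.Analysis"
begin

section \<open>Nonsmooth notions\<close>

definition prox_normal :: "'a::euclidean_space set \<Rightarrow> 'a \<Rightarrow> 'a set" where
  "prox_normal Q x = {v. x \<in> Q \<and> (\<exists>\<sigma>\<ge>0. \<forall>y\<in>Q. v \<bullet> (y - x) \<le> \<sigma> * (norm (y - x))\<^sup>2)}"

definition realized_by_ball :: "'a::euclidean_space set \<Rightarrow> 'a \<Rightarrow> 'a \<Rightarrow> real \<Rightarrow> bool" where
  "realized_by_ball Q x v \<rho> \<longleftrightarrow>
     (\<forall>y\<in>Q. v \<bullet> (y - x) \<le> norm v / (2 * \<rho>) * (norm (y - x))\<^sup>2)"

text \<open>The value function takes the value \<open>\<infinity>\<close>, so its hypograph (over the closure of the
  complement of the target \<open>S\<close>) contains full vertical lines over the points where it is infinite.\<close>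

definition hypo :: "'a::euclidean_space set \<Rightarrow> ('a \<Rightarrow> ereal) \<Rightarrow> ('a \<times> real) set" where
  "hypo S V = {(z, \<beta>). z \<in> closure (- S) \<and> ereal \<beta> \<le> V z}"

text \<open>The next three notions are only meaningful at points where \<open>V\<close> is finite; there
  \<open>real_of_ereal (V x)\<close> is the value of \<open>V\<close> at \<open>x\<close>.\<close>

definition prox_superdiff :: "'a::euclidean_space set \<Rightarrow> ('a \<Rightarrow> ereal) \<Rightarrow> 'a \<Rightarrow> 'a set" where
  "prox_superdiff S V x = {v. (- v, 1) \<in> prox_normal (hypo S V) (x, real_of_ereal (V x))}"

definition horizon_superdiff :: "'a::euclidean_space set \<Rightarrow> ('a \<Rightarrow> ereal) \<Rightarrow> 'a \<Rightarrow> 'a set" where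
  "horizon_superdiff S V x = {v. (- v, 0) \<in> prox_normal (hypo S V) (x, real_of_ereal (V x))}"

definition exterior_sphere_on ::
    "'a::euclidean_space set \<Rightarrow> 'a set \<Rightarrow> ('a \<Rightarrow> ereal) \<Rightarrow> bool" where
  "exterior_sphere_on D S V \<longleftrightarrow>
     (\<exists>\<rho>::'a \<Rightarrow> real. continuous_on D \<rho> \<and> (\<forall>x\<in>D. \<rho> x > 0) \<and>
        (\<forall>x\<in>D. \<exists>v. v \<noteq> 0 \<and> v \<in> prox_normal (hypo S V) (x, real_of_ereal (V x)) \<and>
           realized_by_ball (hypo S V) (x, real_of_ereal (V x)) v (\<rho> x)))"

definition locally_semiconcave :: "('a::euclidean_space \<Rightarrow> real) \<Rightarrow> bool" where
  "locally_semiconcave g \<longleftrightarrow>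
     (\<forall>x. \<exists>e>0. \<exists>c>0. \<forall>x0\<in>ball x e. \<forall>x1\<in>ball x e. \<forall>l\<in>{0..1}.
        (1 - l) * g x0 + l * g x1 - g ((1 - l) *\<^sub>R x0 + l *\<^sub>R x1)
          \<le> c * l * (1 - l) * (norm (x0 - x1))\<^sup>2)"

definition superdiff :: "('a::euclidean_space \<Rightarrow> real) \<Rightarrow> 'a \<Rightarrow> 'a set" where
  "superdiff g x =
     {p. Limsup (at x) (\<lambda>y. ereal ((g y - g x - p \<bullet> (y - x)) / norm (y - x))) \<le> 0}"

section \<open>The exit time problem\<close>

text \<open>Caratheodory solutions of \<open>y'(s) = F s (y s)\<close> on an interval \<open>I\<close>, in integral form
  with respect to the Lebesgue integral (for \<open>absolutely_integrable_on\<close> integrands the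
  gauge integral is the Lebesgue integral).\<close>

definition caratheodory_solution ::
    "(real \<Rightarrow> 'a::euclidean_space \<Rightarrow> 'a) \<Rightarrow> real set \<Rightarrow> (real \<Rightarrow> 'a) \<Rightarrow> bool" where
  "caratheodory_solution F I y \<longleftrightarrow>
     (\<forall>a\<in>I. \<forall>b\<in>I. a \<le> b \<longrightarrow>
        (\<lambda>s. F s (y s)) absolutely_integrable_on {a..b} \<and>
        y b - y a = integral {a..b} (\<lambda>s. F s (y s)))"

text \<open>Controls are functions on \<open>[0, \<infinity>)\<close>; their values at negative times are irrelevant.\<close>

definition controls :: "(real ^ 'm) set \<Rightarrow> (real \<Rightarrow> real ^ 'm) set" where
  "controls U = {u. u \<in> borel_measurable (lebesgue_on {0..}) \<and> (\<forall>t\<ge>0. u t \<in> U)}"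

text \<open>Under the standing assumptions on the dynamics the solution exists and is unique on
  \<open>[0, \<infinity>)\<close>, the only part of the time axis where \<open>traj\<close> is ever evaluated.\<close>

definition traj ::
    "(real ^ 'd \<Rightarrow> real ^ 'm \<Rightarrow> real ^ 'd) \<Rightarrow> real ^ 'd \<Rightarrow> (real \<Rightarrow> real ^ 'm) \<Rightarrow> real \<Rightarrow> real ^ 'd"
  where
  "traj f x u = (SOME y. y 0 = x \<and> caratheodory_solution (\<lambda>s z. f z (u s)) {0..} y)"

definition hit_time ::
    "(real ^ 'd) set \<Rightarrow> (real ^ 'd \<Rightarrow> real ^ 'm \<Rightarrow> real ^ 'd) \<Rightarrow> real ^ 'd \<Rightarrow> (real \<Rightarrow> real ^ 'm) \<Rightarrow> ereal"
  where
  "hit_time S f x u =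
     (if \<exists>t\<ge>0. traj f x u t \<in> S
      then ereal (LEAST t. 0 \<le> t \<and> traj f x u t \<in> S) else \<infinity>)"

definition admissible ::
    "(real ^ 'm) set \<Rightarrow> (real ^ 'd) set \<Rightarrow> (real ^ 'd \<Rightarrow> real ^ 'm \<Rightarrow> real ^ 'd) \<Rightarrow>
     real ^ 'd \<Rightarrow> (real \<Rightarrow> real ^ 'm) set" where
  "admissible U S f x = {u \<in> controls U. hit_time S f x u < \<infinity>}"

definition reach_set ::
    "(real ^ 'm) set \<Rightarrow> (real ^ 'd) set \<Rightarrow> (real ^ 'd \<Rightarrow> real ^ 'm \<Rightarrow> real ^ 'd) \<Rightarrow> (real ^ 'd) set"
  where
  "reach_set U S f = {x. admissible U S f x \<noteq> {}}"

text \<open>The cost is only used for controls with finite hitting time.\<close>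

definition cost ::
    "(real ^ 'd) set \<Rightarrow> (real ^ 'd \<Rightarrow> real ^ 'm \<Rightarrow> real ^ 'd) \<Rightarrow> (real ^ 'd \<Rightarrow> real ^ 'm \<Rightarrow> real) \<Rightarrow>
     (real ^ 'd \<Rightarrow> real) \<Rightarrow> real ^ 'd \<Rightarrow> (real \<Rightarrow> real ^ 'm) \<Rightarrow> real" where
  "cost S f r g x u =
     (let T = real_of_ereal (hit_time S f x u)
      in integral {0..T} (\<lambda>s. r (traj f x u s) (u s)) + g (traj f x u T))"

definition value_fn ::
    "(real ^ 'm) set \<Rightarrow> (real ^ 'd) set \<Rightarrow> (real ^ 'd \<Rightarrow> real ^ 'm \<Rightarrow> real ^ 'd) \<Rightarrow>
     (real ^ 'd \<Rightarrow> real ^ 'm \<Rightarrow> real) \<Rightarrow> (real ^ 'd \<Rightarrow> real) \<Rightarrow> real ^ 'd \<Rightarrow> ereal" where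
  "value_fn U S f r g x = (INF u\<in>admissible U S f x. ereal (cost S f r g x u))"

definition optimal_controls ::
    "(real ^ 'm) set \<Rightarrow> (real ^ 'd) set \<Rightarrow> (real ^ 'd \<Rightarrow> real ^ 'm \<Rightarrow> real ^ 'd) \<Rightarrow>
     (real ^ 'd \<Rightarrow> real ^ 'm \<Rightarrow> real) \<Rightarrow> (real ^ 'd \<Rightarrow> real) \<Rightarrow> real ^ 'd \<Rightarrow> (real \<Rightarrow> real ^ 'm) set"
  where
  "optimal_controls U S f r g x =
     {u \<in> admissible U S f x. ereal (cost S f r g x u) = value_fn U S f r g x}"

text \<open>Here and below, the suprema over \<open>U\<close> are maxima: \<open>U\<close> is compact and
  nonempty and the functions are continuous.\<close>

definition hamiltonian ::
    "(real ^ 'm) set \<Rightarrow> (real ^ 'd \<Rightarrow> real ^ 'm \<Rightarrow> real ^ 'd) \<Rightarrow> (real ^ 'd \<Rightarrow> real ^ 'm \<Rightarrow> real) \<Rightarrow>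
     real ^ 'd \<Rightarrow> real ^ 'd \<Rightarrow> real" where
  "hamiltonian U f r x p = (SUP \<omega>\<in>U. - (p \<bullet> f x \<omega>) - r x \<omega>)"

section \<open>Transported normals\<close>

definition N0 ::
    "(real ^ 'm) set \<Rightarrow> (real ^ 'd) set \<Rightarrow> (real ^ 'd \<Rightarrow> real ^ 'm \<Rightarrow> real ^ 'd) \<Rightarrow>
     real ^ 'd \<Rightarrow> (real ^ 'd) set" where
  "N0 U S f x = {\<xi>. \<xi> \<noteq> 0 \<and> \<xi> \<in> prox_normal (closure (- S)) x \<and> (SUP \<omega>\<in>U. \<xi> \<bullet> f x \<omega>) = 0}"

definition N1 ::
    "(real ^ 'm) set \<Rightarrow> (real ^ 'd) set \<Rightarrow> (real ^ 'd \<Rightarrow> real ^ 'm \<Rightarrow> real ^ 'd) \<Rightarrow>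
     real ^ 'd \<Rightarrow> (real ^ 'd) set" where
  "N1 U S f x = {\<xi>. \<xi> \<in> prox_normal (closure (- S)) x \<and> (SUP \<omega>\<in>U. \<xi> \<bullet> f x \<omega>) > 0}"

text \<open>\<open>Df x \<omega>\<close> is the Jacobian matrix of \<open>f\<close> and \<open>Dr x \<omega>\<close> the gradient of \<open>r\<close>,
  both in the state variable.\<close>

definition N0_dagger ::
    "(real ^ 'm) set \<Rightarrow> (real ^ 'd) set \<Rightarrow> (real ^ 'd \<Rightarrow> real ^ 'm \<Rightarrow> real ^ 'd) \<Rightarrow>
     (real ^ 'd \<Rightarrow> real ^ 'm \<Rightarrow> real) \<Rightarrow> (real ^ 'd \<Rightarrow> real) \<Rightarrow>
     (real ^ 'd \<Rightarrow> real ^ 'm \<Rightarrow> real ^ 'd ^ 'd) \<Rightarrow> real ^ 'd \<Rightarrow> (real ^ 'd) set" where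
  "N0_dagger U S f r g Df x =
     {p 0 | p u T \<xi>.
        u \<in> optimal_controls U S f r g x \<and> T = real_of_ereal (hit_time S f x u) \<and>
        \<xi> \<in> N0 U S f (traj f x u T) \<and>
        caratheodory_solution (\<lambda>t q. - (transpose (Df (traj f x u t) (u t)) *v q)) {0..T} p \<and>
        p T = - \<xi>}"

definition N1_dagger ::
    "(real ^ 'm) set \<Rightarrow> (real ^ 'd) set \<Rightarrow> (real ^ 'd \<Rightarrow> real ^ 'm \<Rightarrow> real ^ 'd) \<Rightarrow>
     (real ^ 'd \<Rightarrow> real ^ 'm \<Rightarrow> real) \<Rightarrow> (real ^ 'd \<Rightarrow> real) \<Rightarrow>
     (real ^ 'd \<Rightarrow> real ^ 'm \<Rightarrow> real ^ 'd ^ 'd) \<Rightarrow> (real ^ 'd \<Rightarrow> real ^ 'm \<Rightarrow> real ^ 'd) \<Rightarrow>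
     real ^ 'd \<Rightarrow> (real ^ 'd) set" where
  "N1_dagger U S f r g Df Dr x =
     {p 0 | p u T \<xi> q.
        u \<in> optimal_controls U S f r g x \<and> T = real_of_ereal (hit_time S f x u) \<and>
        \<xi> \<in> N1 U S f (traj f x u T) \<and> q \<in> superdiff g (traj f x u T) \<and>
        hamiltonian U f r (traj f x u T) (q - \<xi>) = 0 \<and>
        caratheodory_solution
          (\<lambda>t z. - (transpose (Df (traj f x u t) (u t)) *v z) - Dr (traj f x u t) (u t)) {0..T} p \<and>
        p T = q - \<xi>}"

end

(* The theorem rests on one estimate. Let u be optimal for x with exit time T and exit point X, and let
   p solve the adjoint equation with p(T) = mu q - xi, where mu is 0 or 1, xi is a proximal normal at X,
   q is a supergradient of g at X, and the Hamiltonian of (p(T), mu) vanishes at X. For (y, beta) in the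
   hypograph of V at distance d from (x, V x), steer y by u up to time T and by the maximising constant
   control afterwards. Either this trajectory exits at a time within a multiple of d of T, and duality
   between p and the linearised dynamics yields
     -p(0).(y - x) + mu (beta - V x) <= C (1 + |xi|) d^2,
   or it stays outside S until time T + K d, and then the proximal inequality for xi yields the same
   bound, because xi.f is at least mu times a positive constant in the direction of the control.
   Since C depends only on a bound for T, and T is controlled by V, the normals (-p(0), mu) have locally
   uniform radii when V is continuous.

   Optimal controls exist by Filippov's argument. The inner ball and a supergradient of g provide xi and
   q at their exit points; optimality of arrival excludes max xi.f < 0, and when max xi.f > 0 the
   intermediate value theorem rescales xi so that the Hamiltonian vanishes. *)

theory Submission
  imports Defs "HOL-Complex_Analysis.Great_Picard"
begin

section \<open>Caratheodory differential equations\<close>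

text \<open>A proximal normal to the hypograph amounts to a quadratic upper bound on all of it, and
  test controls give such bounds because V lies below every cost. The obstacle is that the exit time
  does not depend continuously on the start: a perturbed trajectory may pass the exit point and miss
  S, and V may even be infinite there. One constant, \<kappa> = r0 - G * N > 0, handles both
  alternatives. It is the least net price of a unit of time, which keeps exits from being too early;
  and it bounds q.f + r from below, which drives a trajectory still outside S along \<xi>. The
  factor K of the delay is chosen so that in the second alternative all first order terms cancel.
  Locally uniform radii meet another obstacle: where the dynamics is nearly tangential to the
  boundary, the rescaling factor of \<xi> has no uniform bound. The estimates are therefore
  homogeneous in (p, \<mu>, \<xi>), and Gronwall's inequality, run forward in time, bounds the
  terminal data by a multiple of the length of the normal (-p(0), \<mu>).\<close>

lemma bounded_measurable_absolutely_integrable: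
  fixes h :: "real \<Rightarrow> 'a::euclidean_space"
  assumes "h \<in> borel_measurable (lebesgue_on {a..b})" "\<And>s. s \<in> {a..b} \<Longrightarrow> norm (h s) \<le> M"
  shows "h absolutely_integrable_on {a..b}"
  using assms
  by (intro measurable_bounded_by_integrable_imp_absolutely_integrable[where g = "\<lambda>_. M"]) auto

lemma borel_measurable_lebesgue_on_subset:
  assumes "h \<in> borel_measurable (lebesgue_on A)" "B \<subseteq> A" "B \<in> sets lebesgue" "A \<in> sets lebesgue"
  shows "h \<in> borel_measurable (lebesgue_on B)"
  using assms by (metis measurable_restrict_mono)

lemma norm_integral_interval_le:
  fixes h :: "real \<Rightarrow> 'a::euclidean_space"
  assumes "h integrable_on {a..b}" "a \<le> b" "\<And>s. s \<in> {a..b} \<Longrightarrow> norm (h s) \<le> M"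
  shows "norm (integral {a..b} h) \<le> M * (b - a)"
proof -
  have "norm (integral {a..b} h) \<le> integral {a..b} (\<lambda>_. M)"
    using assms by (intro integral_norm_bound_integral) auto
  then show ?thesis using assms by (simp add: mult.commute)
qed

text \<open>The majorant on the right, damped by \<open>exp (- L * t)\<close>, has nonpositive
  derivative by hypothesis, so it never exceeds its initial value \<open>a\<close>. What is
  differentiated is the majorant and not \<open>e\<close>, which is only continuous.\<close>

lemma gronwall:
  fixes e :: "real \<Rightarrow> real"
  assumes cont: "continuous_on {0..T} e" and "L \<ge> 0"
    and le: "\<And>t. t \<in> {0..T} \<Longrightarrow> e t \<le> a + L * integral {0..t} e"
    and t: "t \<in> {0..T}"
  shows "e t \<le> a * exp (L * t)"
proof -
  define \<phi> where "\<phi> = (\<lambda>t. exp (- L * t) * (a + L * integral {0..t} e))"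
  have D: "(\<phi> has_derivative
     (\<lambda>h. h * (exp (- L * x) * (L * e x - L * (a + L * integral {0..x} e))))) (at x within {0..t})"
    if "0 \<le> x" "x \<le> t" for x
  proof -
    have "((\<lambda>u. integral {0..u} e) has_vector_derivative e x) (at x within {0..t})"
      using cont t that by (intro integral_has_vector_derivative continuous_on_subset[OF cont]) auto
    then have I: "((\<lambda>u. integral {0..u} e) has_real_derivative e x) (at x within {0..t})"
      by (simp add: has_real_derivative_iff_has_vector_derivative)
    have "(\<phi> has_real_derivative exp (- L * x) * (L * e x - L * (a + L * integral {0..x} e)))
        (at x within {0..t})"
      unfolding \<phi>_def by (auto intro!: derivative_eq_intros I simp: algebra_simps)
    then show ?thesis
      by (simp add: has_field_derivative_def mult_commute_abs)
  qed
  obtain x where x: "x \<in> {0..t}"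
    "\<phi> t - \<phi> 0 = (t - 0) * (exp (- L * x) * (L * e x - L * (a + L * integral {0..x} e)))"
    using mvt_very_simple[of 0 t \<phi>, OF _ D] t by auto
  have "L * e x - L * (a + L * integral {0..x} e) \<le> 0"
    using le[of x] x t \<open>L \<ge> 0\<close> by (auto intro!: mult_left_mono)
  then have "\<phi> t \<le> \<phi> 0"
    using x t by (smt (verit) atLeastAtMost_iff exp_ge_zero mult_nonneg_nonpos)
  then have "exp (- L * t) * (a + L * integral {0..t} e) \<le> a"
    by (simp add: \<phi>_def)
  then have "exp (L * t) * (exp (- L * t) * (a + L * integral {0..t} e)) \<le> exp (L * t) * a"
    by (intro mult_left_mono) auto
  then have "a + L * integral {0..t} e \<le> exp (L * t) * a"
    by (simp add: mult.assoc[symmetric] exp_minus_inverse exp_minus)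
  then show ?thesis using le[OF t] by (simp add: mult.commute)
qed

lemma caratheodoryD:
  assumes "caratheodory_solution F I y" "a \<in> I" "b \<in> I" "a \<le> b"
  shows "(\<lambda>s. F s (y s)) absolutely_integrable_on {a..b}"
    "(\<lambda>s. F s (y s)) integrable_on {a..b}"
    "y b - y a = integral {a..b} (\<lambda>s. F s (y s))"
  using assms by (auto simp: caratheodory_solution_def set_lebesgue_integral_eq_integral(1))

lemma caratheodory_subset:
  "caratheodory_solution F I y \<Longrightarrow> J \<subseteq> I \<Longrightarrow> caratheodory_solution F J y"
  by (auto simp: caratheodory_solution_def)

text \<open>Agreement is required only along the solution, so a control or a right-hand side may be
  altered wherever the trajectory does not see it.\<close>

lemma caratheodory_cong:
  assumes "caratheodory_solution F I y" "is_interval I"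
    and "\<And>s. s \<in> I \<Longrightarrow> F s (y s) = F' s (y' s)" "\<And>s. s \<in> I \<Longrightarrow> y s = y' s"
  shows "caratheodory_solution F' I y'"
  unfolding caratheodory_solution_def
proof (intro ballI impI)
  fix a b assume ab: "a \<in> I" "b \<in> I" "a \<le> b"
  then have sub: "{a..b} \<subseteq> I"
    using assms(2) by (meson atLeastAtMost_iff mem_is_interval_1_I subsetI)
  have "(\<lambda>s. F' s (y' s)) absolutely_integrable_on {a..b} \<longleftrightarrow>
      (\<lambda>s. F s (y s)) absolutely_integrable_on {a..b}"
    using sub assms(3) by (intro set_integrable_cong) auto
  moreover have "integral {a..b} (\<lambda>s. F' s (y' s)) = integral {a..b} (\<lambda>s. F s (y s))"
    using sub assms(3) by (intro integral_cong) auto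
  ultimately show "(\<lambda>s. F' s (y' s)) absolutely_integrable_on {a..b} \<and>
      y' b - y' a = integral {a..b} (\<lambda>s. F' s (y' s))"
    using caratheodoryD[OF assms(1) ab] assms(4) ab by auto
qed

lemma caratheodory_continuous_on:
  assumes "caratheodory_solution F {0..T} y"
  shows "continuous_on {0..T} y"
proof (cases "0 \<le> T")
  case True
  have "continuous_on {0..T} (\<lambda>t. y 0 + integral {0..t} (\<lambda>s. F s (y s)))"
    using caratheodoryD(2)[OF assms, of 0 T] True
    by (intro continuous_intros indefinite_integral_continuous_1) auto
  moreover have "y 0 + integral {0..t} (\<lambda>s. F s (y s)) = y t" if "t \<in> {0..T}" for t
    using caratheodoryD(3)[OF assms, of 0 t] that by (simp add: algebra_simps)
  ultimately show ?thesis by (metis (no_types, lifting) continuous_on_cong)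
qed simp

lemma continuous_on_atLeast_real:
  fixes y :: "real \<Rightarrow> 'a::topological_space"
  assumes "\<And>T. T \<ge> a \<Longrightarrow> continuous_on {a..T} y"
  shows "continuous_on {a..} y"
proof (unfold continuous_on_eq_continuous_within, intro ballI)
  fix t assume t: "t \<in> {a..}"
  have "continuous (at t within {a..t+1}) y"
    using assms[of "t+1"] t by (simp add: continuous_on_eq_continuous_within)
  moreover have "at t within {a..} = at t within {a..t+1}"
    using t by (intro at_within_nhd[of t "{..<t+1}"]) auto
  ultimately show "continuous (at t within {a..}) y" by simp
qed

lemma caratheodory_continuous_on_atLeast:
  assumes "caratheodory_solution F {0..} y"
  shows "continuous_on {0..} y"
  by (intro continuous_on_atLeast_real caratheodory_continuous_on[of F] caratheodory_subset[OF assms]) auto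

lemma caratheodory_lipschitz:
  assumes "caratheodory_solution F I y" "is_interval I" "a \<in> I" "b \<in> I"
    and "\<And>s. s \<in> I \<Longrightarrow> norm (F s (y s)) \<le> M"
  shows "norm (y b - y a) \<le> M * \<bar>b - a\<bar>"
proof -
  have *: "norm (y b - y a) \<le> M * (b - a)" if ab: "a \<le> b" "a \<in> I" "b \<in> I" for a b
    using caratheodoryD[OF assms(1) ab(2,3,1)] assms(5) ab assms(2)
    by (auto intro!: norm_integral_interval_le) (meson mem_is_interval_1_I)
  show ?thesis
    using *[of a b] *[of b a] assms by (cases "a \<le> b") (auto simp: norm_minus_commute)
qed

text \<open>Gronwall for the distance. With equal initial values this is uniqueness, otherwise
  Lipschitz dependence on the start.\<close>

lemma caratheodory_diff_le:
  assumes y: "caratheodory_solution F {0..T} y" and z: "caratheodory_solution F {0..T} z"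
    and "L \<ge> 0"
    and lip: "\<And>s v w. s \<in> {0..T} \<Longrightarrow> norm (F s v - F s w) \<le> L * norm (v - w)"
    and t: "t \<in> {0..T}"
  shows "norm (y t - z t) \<le> norm (y 0 - z 0) * exp (L * t)"
proof (rule gronwall[of T "\<lambda>t. norm (y t - z t)" L])
  show cont: "continuous_on {0..T} (\<lambda>t. norm (y t - z t))"
    by (intro continuous_intros caratheodory_continuous_on[OF y] caratheodory_continuous_on[OF z])
  fix s assume s: "s \<in> {0..T}"
  have yz: "y s - y 0 = integral {0..s} (\<lambda>u. F u (y u))" "z s - z 0 = integral {0..s} (\<lambda>u. F u (z u))"
    "(\<lambda>u. F u (y u)) integrable_on {0..s}" "(\<lambda>u. F u (z u)) integrable_on {0..s}"
    using caratheodoryD[OF y, of 0 s] caratheodoryD[OF z, of 0 s] s by auto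
  have ci: "(\<lambda>u. norm (y u - z u)) integrable_on {0..s}"
    using cont s by (intro integrable_continuous_real) (auto elim: continuous_on_subset)
  have "y s - z s = (y 0 - z 0) + integral {0..s} (\<lambda>u. F u (y u) - F u (z u))"
    using yz by (simp add: Henstock_Kurzweil_Integration.integral_diff algebra_simps)
  also have "norm \<dots> \<le> norm (y 0 - z 0) + norm (integral {0..s} (\<lambda>u. F u (y u) - F u (z u)))"
    by (rule norm_triangle_ineq)
  also have "norm (integral {0..s} (\<lambda>u. F u (y u) - F u (z u))) \<le> integral {0..s} (\<lambda>u. L * norm (y u - z u))"
    using yz integrable_cmul[OF ci, of L] s lip
    by (intro integral_norm_bound_integral Henstock_Kurzweil_Integration.integrable_diff) auto
  also have "\<dots> = L * integral {0..s} (\<lambda>u. norm (y u - z u))" by simp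
  finally show "norm (y s - z s) \<le> norm (y 0 - z 0) + L * integral {0..s} (\<lambda>u. norm (y u - z u))"
    by simp
qed (use assms in auto)

text \<open>In the weighted unknown \<open>exp (- 2 * L * t) *\<^sub>R y t\<close> the integral operator maps bounded
  continuous functions on the whole half line to themselves and is a contraction.\<close>

lemma caratheodory_exists:
  fixes F :: "real \<Rightarrow> 'a::euclidean_space \<Rightarrow> 'a"
  assumes "L > 0"
    and meas: "\<And>y. continuous_on {0..} y \<Longrightarrow> (\<lambda>s. F s (y s)) \<in> borel_measurable (lebesgue_on {0..})"
    and lip: "\<And>s v w. s \<ge> 0 \<Longrightarrow> norm (F s v - F s w) \<le> L * norm (v - w)"
    and bound: "\<And>s. s \<ge> 0 \<Longrightarrow> norm (F s 0) \<le> M"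
  shows "\<exists>y. y 0 = x0 \<and> caratheodory_solution F {0..} y"
proof -
  have M: "M \<ge> 0" using bound[of 0] norm_ge_zero order_trans by blast
  have Fb: "norm (F s v) \<le> M + L * norm v" if "s \<ge> 0" for s v
    using norm_triangle_sub[of "F s v" "F s 0"] lip[OF that, of v 0] bound[OF that] by simp
  define E where "E = (\<lambda>s::real. exp (2 * L * s))"
  have Epos: "E s > 0" for s by (simp add: E_def)
  have EI: "integral {0..t} E = (E t - 1) / (2 * L)" "E integrable_on {0..t}" if "t \<ge> 0" for t
  proof -
    have "(E has_integral (E t / (2 * L) - E 0 / (2 * L))) {0..t}"
      using that \<open>L > 0\<close> unfolding E_def
      by (intro fundamental_theorem_of_calculus)
        (auto intro!: derivative_eq_intros simp flip: has_real_derivative_iff_has_vector_derivative)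
    then show "integral {0..t} E = (E t - 1) / (2 * L)" "E integrable_on {0..t}"
      by (auto simp: E_def integral_unique diff_divide_distrib)
  qed
  have ai: "(\<lambda>s. F s (y s)) absolutely_integrable_on {a..b}"
    if y: "continuous_on {0..} y" and "0 \<le> a" for a b y
  proof -
    have "compact (y ` {a..b})" using that
      by (intro compact_continuous_image continuous_on_subset[OF y]) auto
    then obtain B where B: "\<And>s. s \<in> {a..b} \<Longrightarrow> norm (y s) \<le> B"
      by (meson bounded_iff compact_imp_bounded imageI)
    have "norm (F s (y s)) \<le> M + L * B" if "s \<in> {a..b}" for s
      using Fb[of s "y s"] B[OF that] \<open>L > 0\<close> that \<open>0 \<le> a\<close>
      by (smt (verit) atLeastAtMost_iff mult_left_mono)
    then show ?thesis using that(2)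
      by (intro bounded_measurable_absolutely_integrable
            borel_measurable_lebesgue_on_subset[OF meas[OF y]]) auto
  qed
  define P where "P = (\<lambda>z t. x0 + integral {0..t} (\<lambda>s. F s (E s *\<^sub>R z s)))"
  \<comment> \<open>Clamping time at 0 makes the image a function on the whole real line, so that
    the operator acts on the complete space of bounded continuous functions.\<close>
  define \<Phi> where "\<Phi> = (\<lambda>z t. inverse (E (max 0 t)) *\<^sub>R P z (max 0 t))"
  have contE: "continuous_on A (\<lambda>s. E s *\<^sub>R apply_bcontfun z s)" for A and z :: "real \<Rightarrow>\<^sub>C 'a"
    unfolding E_def by (intro continuous_intros) auto
  have intF: "(\<lambda>s. F s (E s *\<^sub>R apply_bcontfun z s)) integrable_on {0..t}" for z t
    using ai[OF contE[of "{0..}" z], of 0 t] set_lebesgue_integral_eq_integral(1) by blast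
  have B: "\<Phi> (apply_bcontfun z) \<in> bcontfun" for z
  proof (rule bcontfun_normI)
    have "continuous_on {0..} (P (apply_bcontfun z))"
      unfolding P_def using intF
      by (intro continuous_on_atLeast_real continuous_intros indefinite_integral_continuous_1) auto
    then have "continuous_on UNIV (\<lambda>t. P (apply_bcontfun z) (max 0 t))"
      by (rule continuous_on_compose2) (auto intro!: continuous_intros)
    then show "continuous_on UNIV (\<Phi> (apply_bcontfun z))"
      unfolding \<Phi>_def E_def by (intro continuous_intros) auto
    fix t :: real
    define u where "u = max 0 t"
    have u: "u \<ge> 0" by (simp add: u_def)
    have "norm (integral {0..u} (\<lambda>s. F s (E s *\<^sub>R apply_bcontfun z s)))
        \<le> integral {0..u} (\<lambda>s. (M + L * norm z) * E s)"
    proof (rule integral_norm_bound_integral[OF intF])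
      show "(\<lambda>s. (M + L * norm z) * E s) integrable_on {0..u}"
        using integrable_cmul[OF EI(2)[OF u], of "M + L * norm z"] by simp
      fix s assume s: "s \<in> {0..u}"
      have "norm (F s (E s *\<^sub>R apply_bcontfun z s)) \<le> M + L * (E s * norm (apply_bcontfun z s))"
        using Fb[of s] s Epos[of s] by (metis abs_of_pos atLeastAtMost_iff norm_scaleR)
      also have "\<dots> \<le> M * E s + L * (E s * norm z)"
        using M \<open>L > 0\<close> s Epos[of s]
        by (intro add_mono mult_left_mono norm_bounded) (auto simp: E_def mult_le_cancel_left1)
      finally show "norm (F s (E s *\<^sub>R apply_bcontfun z s)) \<le> (M + L * norm z) * E s"
        by (simp add: algebra_simps)
    qed
    also have "\<dots> = (M + L * norm z) * ((E u - 1) / (2 * L))"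
      using EI[OF u] by simp
    also have "\<dots> \<le> (M + L * norm z) * (E u / (2 * L))"
      using M \<open>L > 0\<close> by (intro mult_left_mono divide_right_mono) auto
    finally have "norm (P (apply_bcontfun z) u) \<le> norm x0 * E u + (M + L * norm z) * (E u / (2 * L))"
      unfolding P_def using u \<open>L > 0\<close>
      by (smt (verit) E_def mult_le_cancel_left1 norm_ge_zero norm_triangle_ineq one_le_exp_iff zero_le_mult_iff)
    then have "inverse (E u) * norm (P (apply_bcontfun z) u)
        \<le> inverse (E u) * (norm x0 * E u + (M + L * norm z) * (E u / (2 * L)))"
      using Epos[of u] by (intro mult_left_mono) auto
    also have "\<dots> = norm x0 + (M + L * norm z) / (2 * L)"
      using Epos[of u] by (simp add: field_simps)
    finally show "norm (\<Phi> (apply_bcontfun z) t) \<le> norm x0 + (M + L * norm z) / (2 * L)"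
      using Epos[of u] by (simp add: \<Phi>_def u_def)
  qed
  define \<Psi> where "\<Psi> = (\<lambda>z. Bcontfun (\<Phi> (apply_bcontfun z)))"
  have ap: "apply_bcontfun (\<Psi> z) = \<Phi> (apply_bcontfun z)" for z
    unfolding \<Psi>_def by (rule Bcontfun_inverse[OF B])
  \<comment> \<open>The integral of the weight \<open>E\<close> over \<open>{0..u}\<close> is below
    \<open>E u / (2 * L)\<close>; this turns the Lipschitz constant \<open>L\<close> into the factor
    1/2.\<close>
  have "dist (\<Psi> z) (\<Psi> w) \<le> 1/2 * dist z w" for z w
  proof (rule dist_bound)
    fix t :: real
    define u where "u = max 0 t"
    have u: "u \<ge> 0" by (simp add: u_def)
    have "norm (P (apply_bcontfun z) u - P (apply_bcontfun w) u)
       = norm (integral {0..u} (\<lambda>s. F s (E s *\<^sub>R apply_bcontfun z s) - F s (E s *\<^sub>R apply_bcontfun w s)))"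
      by (simp add: P_def Henstock_Kurzweil_Integration.integral_diff intF)
    also have "\<dots> \<le> integral {0..u} (\<lambda>s. (L * dist z w) * E s)"
    proof (rule integral_norm_bound_integral)
      show "(\<lambda>s. (L * dist z w) * E s) integrable_on {0..u}"
        using integrable_cmul[OF EI(2)[OF u], of "L * dist z w"] by simp
      fix s assume s: "s \<in> {0..u}"
      have "norm (F s (E s *\<^sub>R apply_bcontfun z s) - F s (E s *\<^sub>R apply_bcontfun w s))
          \<le> L * (E s * dist (apply_bcontfun z s) (apply_bcontfun w s))"
        using lip[of s] s Epos[of s]
        by (metis abs_of_pos atLeastAtMost_iff dist_norm norm_scaleR scaleR_diff_right)
      also have "\<dots> \<le> L * (E s * dist z w)"
        using \<open>L > 0\<close> Epos[of s] by (intro mult_left_mono dist_bounded) auto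
      finally show "norm (F s (E s *\<^sub>R apply_bcontfun z s) - F s (E s *\<^sub>R apply_bcontfun w s)) \<le> L * dist z w * E s"
        by (simp add: algebra_simps)
    qed (intro Henstock_Kurzweil_Integration.integrable_diff intF)
    also have "\<dots> = L * dist z w * ((E u - 1) / (2 * L))"
      using EI[OF u] by simp
    also have "\<dots> \<le> L * dist z w * (E u / (2 * L))"
      using \<open>L > 0\<close> by (intro mult_left_mono divide_right_mono) auto
    also have "\<dots> = E u * (1/2 * dist z w)" using \<open>L > 0\<close> by simp
    finally have *: "norm (P (apply_bcontfun z) u - P (apply_bcontfun w) u) \<le> E u * (1/2 * dist z w)" .
    have "dist (apply_bcontfun (\<Psi> z) t) (apply_bcontfun (\<Psi> w) t)
       = inverse (E u) * norm (P (apply_bcontfun z) u - P (apply_bcontfun w) u)"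
      using Epos[of u]
      by (simp add: ap \<Phi>_def u_def dist_norm flip: scaleR_diff_right)
    also have "\<dots> \<le> inverse (E u) * (E u * (1/2 * dist z w))"
      using Epos[of u] * by (intro mult_left_mono) auto
    also have "\<dots> = 1/2 * dist z w" using Epos[of u] by simp
    finally show "dist (apply_bcontfun (\<Psi> z) t) (apply_bcontfun (\<Psi> w) t) \<le> 1/2 * dist z w" .
  qed
  then obtain z where "\<Psi> z = z"
    using banach_fix_type[of "1/2" \<Psi>] by auto
  then have fp: "apply_bcontfun z t = \<Phi> (apply_bcontfun z) t" for t using ap by metis
  define y where "y = (\<lambda>s. E s *\<^sub>R apply_bcontfun z s)"
  have y: "y t = x0 + integral {0..t} (\<lambda>s. F s (y s))" if "t \<ge> 0" for t
    using fp[of t] that Epos[of t] by (simp add: y_def \<Phi>_def P_def max_def)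
  have "caratheodory_solution F {0..} y"
    unfolding caratheodory_solution_def
  proof (intro ballI impI conjI)
    fix a b :: real assume ab: "a \<in> {0..}" "b \<in> {0..}" "a \<le> b"
    show "(\<lambda>s. F s (y s)) absolutely_integrable_on {a..b}"
      using ai[OF contE[of "{0..}" z], of a b] ab by (simp add: y_def)
    have "integral {0..a} (\<lambda>s. F s (y s)) + integral {a..b} (\<lambda>s. F s (y s)) = integral {0..b} (\<lambda>s. F s (y s))"
      using intF[of z b] ab by (intro Henstock_Kurzweil_Integration.integral_combine) (auto simp: y_def)
    then show "y b - y a = integral {a..b} (\<lambda>s. F s (y s))"
      using y[of a] y[of b] ab by (simp add: algebra_simps)
  qed
  moreover have "y 0 = x0" using y[of 0] by simp
  ultimately show ?thesis by blast
qed

text \<open>A derivative-free form of the fact that a vanishing derivative forces constancy: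
  telescoping over \<open>n\<close> equal pieces leaves an error of at most
  \<open>C * T\<^sup>2 / n\<close>.\<close>

lemma eq_if_quadratic_increments:
  fixes \<psi> :: "real \<Rightarrow> real"
  assumes "\<And>a b. \<lbrakk>0 \<le> a; a \<le> b; b \<le> T\<rbrakk> \<Longrightarrow> \<bar>\<psi> b - \<psi> a\<bar> \<le> C * (b - a)\<^sup>2" "0 \<le> T"
  shows "\<psi> T = \<psi> 0"
proof -
  have bd: "\<bar>\<psi> T - \<psi> 0\<bar> \<le> C * T\<^sup>2 / real n" if "n > 0" for n :: nat
  proof -
    define p where "p = (\<lambda>i. real i * T / real n)"
    have "\<bar>\<psi> (p k) - \<psi> (p 0)\<bar> \<le> real k * (C * (T / real n)\<^sup>2)" if "k \<le> n" for k
      using that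
    proof (induction k)
      case (Suc k)
      have "p (Suc k) - p k = T / real n"
        by (simp add: p_def add_divide_distrib algebra_simps)
      moreover have "0 \<le> p k" "p (Suc k) \<le> T" "p k \<le> p (Suc k)"
        using Suc.prems \<open>n > 0\<close> \<open>0 \<le> T\<close> mult_right_mono[of "real (Suc k)" "real n" T]
        by (auto simp: p_def divide_le_eq mult.commute intro!: divide_right_mono mult_left_mono)
      ultimately have "\<bar>\<psi> (p (Suc k)) - \<psi> (p k)\<bar> \<le> C * (T / real n)\<^sup>2"
        using assms(1)[of "p k" "p (Suc k)"] by simp
      then show ?case using Suc by (simp add: algebra_simps)
    qed simp
    from this[of n] have "\<bar>\<psi> T - \<psi> 0\<bar> \<le> real n * (C * (T / real n)\<^sup>2)"
      using \<open>n > 0\<close> by (simp add: p_def)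
    also have "\<dots> = C * T\<^sup>2 / real n"
      using \<open>n > 0\<close> by (simp add: power2_eq_square field_simps)
    finally show ?thesis .
  qed
  have "(\<lambda>n. C * T\<^sup>2 / real n) \<longlonglongrightarrow> 0"
    by (intro tendsto_divide_0[OF tendsto_const] filterlim_at_top_imp_at_infinity filterlim_real_sequentially)
  then have "\<bar>\<psi> T - \<psi> 0\<bar> \<le> 0"
    using bd by (intro LIMSEQ_le_const) (auto intro!: exI[of _ 1])
  then show ?thesis by simp
qed

text \<open>The factors need not be differentiable at any given point. Over \<open>{a..b}\<close> the increment of
  the product differs from the integral by at most a multiple of \<open>(b - a)\<^sup>2\<close>, and this error
  vanishes after summing over ever finer partitions.\<close>

lemma integral_by_parts_bounded:
  fixes p e p' e' :: "real \<Rightarrow> 'a::euclidean_space"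
  assumes T: "0 \<le> T"
    and p': "p' \<in> borel_measurable (lebesgue_on {0..T})" "\<And>s. s \<in> {0..T} \<Longrightarrow> norm (p' s) \<le> A"
    and e': "e' \<in> borel_measurable (lebesgue_on {0..T})" "\<And>s. s \<in> {0..T} \<Longrightarrow> norm (e' s) \<le> B"
    and p: "\<And>a b. \<lbrakk>0 \<le> a; a \<le> b; b \<le> T\<rbrakk> \<Longrightarrow> p b - p a = integral {a..b} p'"
    and e: "\<And>a b. \<lbrakk>0 \<le> a; a \<le> b; b \<le> T\<rbrakk> \<Longrightarrow> e b - e a = integral {a..b} e'"
  shows "(\<lambda>s. p' s \<bullet> e s + p s \<bullet> e' s) integrable_on {0..T}"
    and "p T \<bullet> e T - p 0 \<bullet> e 0 = integral {0..T} (\<lambda>s. p' s \<bullet> e s + p s \<bullet> e' s)"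
proof -
  have A: "A \<ge> 0" and B: "B \<ge> 0"
    using p'(2)[of 0] e'(2)[of 0] T norm_ge_zero order_trans by (metis atLeastAtMost_iff order_refl)+
  have ip: "p' integrable_on {a..b}" and ie: "e' integrable_on {a..b}" if "0 \<le> a" "b \<le> T" for a b
  proof -
    have "p' absolutely_integrable_on {0..T}" "e' absolutely_integrable_on {0..T}"
      by (rule bounded_measurable_absolutely_integrable[OF p'] bounded_measurable_absolutely_integrable[OF e'], assumption)+
    then have "p' integrable_on {0..T}" "e' integrable_on {0..T}"
      using set_lebesgue_integral_eq_integral(1) by blast+
    then show "p' integrable_on {a..b}" "e' integrable_on {a..b}"
      using that by (auto elim!: integrable_subinterval_real)
  qed
  have lp: "norm (p b - p a) \<le> A * (b - a)" and le: "norm (e b - e a) \<le> B * (b - a)"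
    if "0 \<le> a" "a \<le> b" "b \<le> T" for a b
    using that p[OF that] e[OF that] ip[of a b] ie[of a b] p'(2) e'(2)
    by (auto intro!: norm_integral_interval_le)
  have "A-lipschitz_on {0..T} p"
    using lp A by (intro lipschitz_onI) (auto simp: dist_norm, smt (verit) norm_minus_commute)
  then have cp: "continuous_on {0..T} p" by (rule lipschitz_on_continuous_on)
  have "B-lipschitz_on {0..T} e"
    using le B by (intro lipschitz_onI) (auto simp: dist_norm, smt (verit) norm_minus_commute)
  then have ce: "continuous_on {0..T} e" by (rule lipschitz_on_continuous_on)
  obtain P where P: "\<And>s. s \<in> {0..T} \<Longrightarrow> norm (p s) \<le> P"
    using compact_imp_bounded[OF compact_continuous_image[OF cp compact_Icc]] by (meson bounded_iff imageI)
  obtain Q where Q: "\<And>s. s \<in> {0..T} \<Longrightarrow> norm (e s) \<le> Q"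
    using compact_imp_bounded[OF compact_continuous_image[OF ce compact_Icc]] by (meson bounded_iff imageI)
  define h where "h = (\<lambda>s. p' s \<bullet> e s + p s \<bullet> e' s)"
  have "h \<in> borel_measurable (lebesgue_on {0..T})"
    unfolding h_def
    by (intro borel_measurable_add borel_measurable_inner p'(1) e'(1)
          continuous_imp_measurable_on_sets_lebesgue[OF cp] continuous_imp_measurable_on_sets_lebesgue[OF ce]) auto
  moreover have "norm (h s) \<le> A * Q + P * B" if "s \<in> {0..T}" for s
  proof -
    have "\<bar>p' s \<bullet> e s\<bar> \<le> A * Q"
      using Cauchy_Schwarz_ineq2[of "p' s" "e s"] p'(2)[OF that] Q[OF that] A
      by (smt (verit) mult_mono norm_ge_zero)
    moreover have "\<bar>p s \<bullet> e' s\<bar> \<le> P * B"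
      using Cauchy_Schwarz_ineq2[of "p s" "e' s"] e'(2)[OF that] P[OF that] B
      by (smt (verit) mult_mono norm_ge_zero)
    ultimately show ?thesis by (simp add: h_def)
  qed
  ultimately have "h absolutely_integrable_on {0..T}"
    by (rule bounded_measurable_absolutely_integrable)
  then have ih0: "h integrable_on {0..T}" using set_lebesgue_integral_eq_integral(1) by blast
  then have ih: "h integrable_on {a..b}" if "0 \<le> a" "b \<le> T" for a b
    using that by (auto elim!: integrable_subinterval_real)
  define \<psi> where "\<psi> = (\<lambda>t. p t \<bullet> e t - integral {0..t} h)"
  \<comment> \<open>Freezing \<open>e\<close> and \<open>p\<close> at \<open>a\<close> inside the
    integral costs \<open>2 * A * B * (b - a)\<^sup>2\<close>; the product of the two increments
    costs another \<open>A * B * (b - a)\<^sup>2\<close>.\<close>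
  have "\<bar>\<psi> b - \<psi> a\<bar> \<le> (3 * A * B) * (b - a)\<^sup>2" if ab: "0 \<le> a" "a \<le> b" "b \<le> T" for a b
  proof -
    have "integral {0..a} h + integral {a..b} h = integral {0..b} h"
      using ab ih[of 0 b] by (intro Henstock_Kurzweil_Integration.integral_combine) auto
    moreover have "p b \<bullet> e b - p a \<bullet> e a = (p b - p a) \<bullet> e a + p a \<bullet> (e b - e a) + (p b - p a) \<bullet> (e b - e a)"
      by (simp add: algebra_simps)
    moreover have "(p b - p a) \<bullet> e a + p a \<bullet> (e b - e a) = integral {a..b} (\<lambda>s. p' s \<bullet> e a + p a \<bullet> e' s)"
    proof -
      have i1: "((\<lambda>s. p' s \<bullet> e a) has_integral (p b - p a) \<bullet> e a) {a..b}"
        using has_integral_linear[OF integrable_integral[OF ip[OF ab(1,3)]] bounded_linear_inner_left[of "e a"]] p[OF ab]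
        by (simp add: o_def)
      have i2: "((\<lambda>s. p a \<bullet> e' s) has_integral p a \<bullet> (e b - e a)) {a..b}"
        using has_integral_linear[OF integrable_integral[OF ie[OF ab(1,3)]] bounded_linear_inner_right[of "p a"]] e[OF ab]
        by (simp add: o_def)
      show ?thesis using has_integral_add[OF i1 i2] by (simp add: integral_unique)
    qed
    ultimately have "\<psi> b - \<psi> a = integral {a..b} (\<lambda>s. p' s \<bullet> e a + p a \<bullet> e' s) - integral {a..b} h
        + (p b - p a) \<bullet> (e b - e a)"
      by (simp add: \<psi>_def)
    moreover have "integral {a..b} (\<lambda>s. p' s \<bullet> e a + p a \<bullet> e' s) - integral {a..b} h
       = integral {a..b} (\<lambda>s. (p' s \<bullet> e a + p a \<bullet> e' s) - h s)"
    proof (rule Henstock_Kurzweil_Integration.integral_diff[symmetric])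
      show "(\<lambda>s. p' s \<bullet> e a + p a \<bullet> e' s) integrable_on {a..b}"
        using integrable_linear[OF ip[OF ab(1,3)] bounded_linear_inner_left[of "e a"]]
          integrable_linear[OF ie[OF ab(1,3)] bounded_linear_inner_right[of "p a"]]
        by (intro Henstock_Kurzweil_Integration.integrable_add) (auto simp: o_def)
    qed (use ab ih in auto)
    moreover have "norm (integral {a..b} (\<lambda>s. (p' s \<bullet> e a + p a \<bullet> e' s) - h s)) \<le> (2 * A * B * (b - a)) * (b - a)"
    proof (rule norm_integral_interval_le)
      show "(\<lambda>s. (p' s \<bullet> e a + p a \<bullet> e' s) - h s) integrable_on {a..b}"
        using integrable_linear[OF ip[OF ab(1,3)] bounded_linear_inner_left[of "e a"]]
          integrable_linear[OF ie[OF ab(1,3)] bounded_linear_inner_right[of "p a"]] ih[OF ab(1,3)]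
        by (intro Henstock_Kurzweil_Integration.integrable_diff Henstock_Kurzweil_Integration.integrable_add)
          (auto simp: o_def)
      fix s assume s: "s \<in> {a..b}"
      have "(p' s \<bullet> e a + p a \<bullet> e' s) - h s = - (p' s \<bullet> (e s - e a)) - (p s - p a) \<bullet> e' s"
        by (simp add: h_def algebra_simps)
      moreover have "\<bar>p' s \<bullet> (e s - e a)\<bar> \<le> A * (B * (b - a))"
      proof -
        have "norm (e s - e a) \<le> B * (b - a)"
          using le[of a s] s ab B by (smt (verit) atLeastAtMost_iff mult_left_mono)
        then show ?thesis
          using Cauchy_Schwarz_ineq2[of "p' s" "e s - e a"] p'(2)[of s] s ab A
          by (smt (verit) atLeastAtMost_iff mult_mono norm_ge_zero)
      qed
      moreover have "\<bar>(p s - p a) \<bullet> e' s\<bar> \<le> (A * (b - a)) * B"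
      proof -
        have "norm (p s - p a) \<le> A * (b - a)"
          using lp[of a s] s ab A by (smt (verit) atLeastAtMost_iff mult_left_mono)
        then show ?thesis
          using Cauchy_Schwarz_ineq2[of "p s - p a" "e' s"] e'(2)[of s] s ab B
          by (smt (verit) atLeastAtMost_iff mult_mono norm_ge_zero)
      qed
      ultimately show "norm (p' s \<bullet> e a + p a \<bullet> e' s - h s) \<le> 2 * A * B * (b - a)"
        by (simp add: algebra_simps)
    qed (use ab in auto)
    moreover have "\<bar>(p b - p a) \<bullet> (e b - e a)\<bar> \<le> (A * (b - a)) * (B * (b - a))"
      using Cauchy_Schwarz_ineq2[of "p b - p a" "e b - e a"] lp[OF ab] le[OF ab]
      by (smt (verit) mult_mono norm_ge_zero)
    ultimately show ?thesis by (simp add: power2_eq_square algebra_simps)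
  qed
  then have "\<psi> T = \<psi> 0" by (rule eq_if_quadratic_increments) (use T in auto)
  then show "p T \<bullet> e T - p 0 \<bullet> e 0 = integral {0..T} (\<lambda>s. p' s \<bullet> e s + p s \<bullet> e' s)"
    by (simp add: \<psi>_def h_def)
  show "(\<lambda>s. p' s \<bullet> e s + p s \<bullet> e' s) integrable_on {0..T}"
    using ih0 by (simp add: h_def)
qed

section \<open>Time reversal, terminal value problems and growth\<close>

lemma has_integral_reflect_shift:
  fixes h :: "real \<Rightarrow> 'a::euclidean_space"
  assumes "(h has_integral i) {a..b}"
  shows "((\<lambda>s. h (T - s)) has_integral i) {T - b..T - a}"
proof (cases "a \<le> b")
  case True
  have "(h has_integral i) (cbox a b)" using assms by simp
  from has_integral_affinity[OF this, of "-1" T]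
  have "((\<lambda>s. h (T - s)) has_integral i) ((\<lambda>s. T - s) ` {a..b})" by simp
  moreover have "(\<lambda>s. T - s) ` {a..b} = {T - b..T - a}" by simp
  ultimately show ?thesis by simp
qed (use assms in auto)

text \<open>The adjoint equation has its data at the exit time; reversal turns it into an initial
  value problem.\<close>

lemma caratheodory_reflect:
  assumes "caratheodory_solution F {0..T} p"
  shows "caratheodory_solution (\<lambda>s z. - F (T - s) z) {0..T} (\<lambda>s. p (T - s))"
  unfolding caratheodory_solution_def
proof (intro ballI impI conjI)
  fix a b assume ab: "a \<in> {0..T}" "b \<in> {0..T}" "a \<le> b"
  note * = caratheodoryD[OF assms, of "T - b" "T - a"]
  have 1: "((\<lambda>s. F (T - s) (p (T - s))) has_integral p (T - a) - p (T - b)) {a..b}"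
    using has_integral_reflect_shift[OF integrable_integral[OF *(2)], of T] *(3) ab by simp
  have "(\<lambda>s. norm (F s (p s))) integrable_on {T - b..T - a}"
    using *(1) ab by (simp add: absolutely_integrable_on_def)
  from has_integral_reflect_shift[OF integrable_integral[OF this], of T]
  have "(\<lambda>s. norm (F (T - s) (p (T - s)))) integrable_on {a..b}" by auto
  then show "(\<lambda>s. - F (T - s) (p (T - s))) absolutely_integrable_on {a..b}"
    using has_integral_neg[OF 1] by (auto simp: absolutely_integrable_on_def)
  show "p (T - b) - p (T - a) = integral {a..b} (\<lambda>s. - F (T - s) (p (T - s)))"
    using integral_unique[OF has_integral_neg[OF 1]] by simp
qed

lemma caratheodory_terminal_exists:
  fixes F :: "real \<Rightarrow> 'a::euclidean_space \<Rightarrow> 'a"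
  assumes "L > 0" "0 \<le> T"
    and int: "\<And>y. continuous_on {0..T} y \<Longrightarrow> (\<lambda>s. F s (y s)) integrable_on {0..T}"
    and lip: "\<And>s v w. s \<in> {0..T} \<Longrightarrow> norm (F s v - F s w) \<le> L * norm (v - w)"
    and bound: "\<And>s. s \<in> {0..T} \<Longrightarrow> norm (F s 0) \<le> M"
  obtains p where "p T = pT" "caratheodory_solution F {0..T} p"
proof -
  \<comment> \<open>Reversed in time and continued by 0 beyond \<open>{0..T}\<close>, the right-hand
    side meets the requirements of the existence theorem on the half line. Its measurability there
    is read off from the integrability of an extension by zero.\<close>
  define F' where "F' = (\<lambda>s z. if s \<in> {0..T} then - F (T - s) z else 0)"
  have M: "M \<ge> 0" using bound[of 0] assms(2) norm_ge_zero order_trans by (metis atLeastAtMost_iff order_refl)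
  have "\<exists>y. y 0 = pT \<and> caratheodory_solution F' {0..} y"
  proof (rule caratheodory_exists[OF assms(1)])
    fix y :: "real \<Rightarrow> 'a" assume y: "continuous_on {0..} y"
    have "continuous_on {0..T} (\<lambda>t. y (T - t))"
      by (rule continuous_on_compose2[OF y]) (auto intro!: continuous_intros)
    from has_integral_reflect_shift[OF integrable_integral[OF int[OF this]], of T]
    have "(\<lambda>s. F (T - s) (y s)) integrable_on {0..T}" by auto
    then have "(\<lambda>s. - F (T - s) (y s)) integrable_on {0..T}"
      by (rule integrable_neg)
    then have "(\<lambda>s. F' s (y s)) integrable_on UNIV"
      by (subst (asm) integrable_restrict_UNIV[symmetric]) (simp add: F'_def if_distrib cong: if_cong)
    then have "(\<lambda>s. F' s (y s)) \<in> borel_measurable lebesgue"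
      using integrable_imp_measurable[of _ UNIV] by (simp add: lebesgue_on_UNIV_eq)
    then show "(\<lambda>s. F' s (y s)) \<in> borel_measurable (lebesgue_on {0..})"
      by (simp add: measurable_restrict_space1)
  next
    show "norm (F' s v - F' s w) \<le> L * norm (v - w)" if "s \<ge> 0" for s v w
      using lip[of "T - s" v w] that assms(1) by (auto simp: F'_def norm_minus_commute)
    show "norm (F' s 0) \<le> M" if "s \<ge> 0" for s
      using bound[of "T - s"] that M by (auto simp: F'_def)
  qed
  then obtain y where y: "y 0 = pT" "caratheodory_solution F' {0..} y" by blast
  then have "caratheodory_solution (\<lambda>s z. - F' (T - s) z) {0..T} (\<lambda>s. y (T - s))"
    by (intro caratheodory_reflect caratheodory_subset[OF y(2)]) auto
  then have "caratheodory_solution F {0..T} (\<lambda>s. y (T - s))"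
    by (rule caratheodory_cong) (auto simp: F'_def is_interval_cc)
  then show ?thesis using that[of "\<lambda>s. y (T - s)"] y(1) by simp
qed

text \<open>For the adjoint state both directions of time matter: backward, the whole arc is bounded
  by its terminal value; forward, the terminal value is bounded by the initial one.\<close>

lemma caratheodory_growth:
  assumes y: "caratheodory_solution F {0..T} y" and "L \<ge> 0"
    and le: "\<And>s. s \<in> {0..T} \<Longrightarrow> norm (F s (y s)) \<le> M + L * norm (y s)"
    and t: "t \<in> {0..T}" and "M \<ge> 0"
  shows "norm (y t) \<le> (norm (y 0) + M * T) * exp (L * t)"
proof (rule gronwall[of T "\<lambda>t. norm (y t)" L])
  show cont: "continuous_on {0..T} (\<lambda>t. norm (y t))"
    by (intro continuous_intros caratheodory_continuous_on[OF y])
  fix s assume s: "s \<in> {0..T}"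
  have ys: "y s - y 0 = integral {0..s} (\<lambda>u. F u (y u))" "(\<lambda>u. F u (y u)) integrable_on {0..s}"
    using caratheodoryD[OF y, of 0 s] s by auto
  have "(\<lambda>u. norm (y u)) integrable_on {0..s}"
    using cont s by (intro integrable_continuous_real) (auto elim: continuous_on_subset)
  then have i: "((\<lambda>u. M + L * norm (y u)) has_integral (M * s + L * integral {0..s} (\<lambda>u. norm (y u)))) {0..s}"
    using has_integral_const_real[of M 0 s] s
    by (intro has_integral_add has_integral_mult_right integrable_integral) (auto simp: mult.commute)
  have "norm (y s) \<le> norm (y 0) + norm (y s - y 0)" by (rule norm_triangle_sub)
  also have "norm (y s - y 0) \<le> integral {0..s} (\<lambda>u. M + L * norm (y u))"
    unfolding ys(1) using ys(2) i s le by (intro integral_norm_bound_integral) auto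
  also have "\<dots> = M * s + L * integral {0..s} (\<lambda>u. norm (y u))" using i by (rule integral_unique)
  also have "M * s \<le> M * T" using s \<open>M \<ge> 0\<close> by (intro mult_left_mono) auto
  finally show "norm (y s) \<le> norm (y 0) + M * T + L * integral {0..s} (\<lambda>u. norm (y u))" by simp
qed (use assms in auto)

lemma caratheodory_growth_backward:
  assumes y: "caratheodory_solution F {0..T} y" and "L \<ge> 0"
    and le: "\<And>s. s \<in> {0..T} \<Longrightarrow> norm (F s (y s)) \<le> M + L * norm (y s)"
    and t: "t \<in> {0..T}" and "M \<ge> 0"
  shows "norm (y t) \<le> (norm (y T) + M * T) * exp (L * (T - t))"
  using caratheodory_growth[OF caratheodory_reflect[OF y], of L M "T - t"] assms by auto

section \<open>Semiconcave functions and proximal normals\<close>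

lemma superdiff_bound:
  assumes "q \<in> superdiff g x" "\<delta> > 0"
  obtains d where "d > 0" "\<And>y. norm (y - x) < d \<Longrightarrow> g y - g x - q \<bullet> (y - x) \<le> \<delta> * norm (y - x)"
proof -
  have "Limsup (at x) (\<lambda>y. ereal ((g y - g x - q \<bullet> (y - x)) / norm (y - x))) < ereal \<delta>"
    using assms unfolding superdiff_def
    by (metis (mono_tags, lifting) ereal_less(2) mem_Collect_eq order_le_less_trans)
  then have "eventually (\<lambda>y. ereal ((g y - g x - q \<bullet> (y - x)) / norm (y - x)) < ereal \<delta>) (at x)"
    by (rule Limsup_lessD)
  then obtain d where d: "d > 0"
    "\<And>y. \<lbrakk>y \<noteq> x; dist y x < d\<rbrakk> \<Longrightarrow> (g y - g x - q \<bullet> (y - x)) / norm (y - x) < \<delta>"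
    by (auto simp: eventually_at)
  have "g y - g x - q \<bullet> (y - x) \<le> \<delta> * norm (y - x)" if "norm (y - x) < d" for y
    using d(2)[of y] that by (cases "y = x") (auto simp: dist_norm divide_less_eq)
  with d(1) that show ?thesis by blast
qed

lemma superdiff_if_quadratic:
  fixes g :: "'a::euclidean_space \<Rightarrow> real"
  assumes "e > 0" "\<And>z. z \<in> ball x e \<Longrightarrow> g z \<le> g x + q \<bullet> (z - x) + c * (norm (z - x))\<^sup>2"
  shows "q \<in> superdiff g x"
proof -
  have "Limsup (at x) (\<lambda>y. ereal ((g y - g x - q \<bullet> (y - x)) / norm (y - x)))
      \<le> Limsup (at x) (\<lambda>y. ereal (c * norm (y - x)))"
  proof (rule Limsup_mono)
    have "eventually (\<lambda>y. y \<in> ball x e \<and> y \<noteq> x) (at x)"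
      using assms(1) by (auto simp: eventually_at dist_commute intro!: exI[of _ e])
    then show "\<forall>\<^sub>F y in at x. ereal ((g y - g x - q \<bullet> (y - x)) / norm (y - x)) \<le> ereal (c * norm (y - x))"
    proof eventually_elim
      case (elim y)
      then show ?case using assms(2)[of y]
        by (auto simp: divide_le_eq power2_eq_square algebra_simps)
    qed
  qed
  also have "\<dots> = 0"
  proof (rule lim_imp_Limsup)
    have "((\<lambda>y. ereal (c * norm (y - x))) \<longlongrightarrow> ereal (c * norm (x - x))) (at x)"
      by (intro tendsto_intros)
    then show "((\<lambda>y. ereal (c * norm (y - x))) \<longlongrightarrow> 0) (at x)"
      by (simp add: zero_ereal_def)
  qed simp
  finally show ?thesis by (simp add: superdiff_def)
qed

text \<open>Near \<open>x\<close> the function \<open>\<phi>\<close>, a quadratic minus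
  \<open>g\<close>, is convex, so a hyperplane supports its epigraph at \<open>x\<close>. As
  \<open>x\<close> is the centre of the ball, the hyperplane is not vertical and gives a subgradient
  \<open>s\<close> of \<open>\<phi>\<close>; the gradient of the quadratic at \<open>x\<close> minus
  \<open>s\<close> is a supergradient of \<open>g\<close>.\<close>

lemma locally_semiconcave_superdiff_nonempty:
  fixes g :: "'a::euclidean_space \<Rightarrow> real"
  assumes "locally_semiconcave g"
  shows "superdiff g x \<noteq> {}"
proof -
  obtain e c where e: "e > 0" and sc:
    "\<And>x0 x1 l. \<lbrakk>x0 \<in> ball x e; x1 \<in> ball x e; l \<in> {0..1}\<rbrakk> \<Longrightarrow>
        (1 - l) * g x0 + l * g x1 - g ((1 - l) *\<^sub>R x0 + l *\<^sub>R x1)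
          \<le> c * l * (1 - l) * (norm (x0 - x1))\<^sup>2"
    using assms unfolding locally_semiconcave_def by metis
  define \<phi> where "\<phi> = (\<lambda>z. c * (norm z)\<^sup>2 - g z)"
  define E where "E = {(z, \<beta>::real). z \<in> ball x e \<and> \<beta> > \<phi> z}"
  have cvx: "convex E"
    unfolding convex_alt
  proof (clarify)
    fix z0 b0 z1 b1 and u :: real
    assume z: "(z0, b0) \<in> E" "(z1, b1) \<in> E" and u: "0 \<le> u" "u \<le> 1"
    have "(1 - u) *\<^sub>R z0 + u *\<^sub>R z1 \<in> ball x e"
      using z u convexD_alt[OF convex_ball[of x e]] by (auto simp: E_def)
    moreover have "\<phi> ((1 - u) *\<^sub>R z0 + u *\<^sub>R z1) \<le> (1 - u) * \<phi> z0 + u * \<phi> z1"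
    proof -
      \<comment> \<open>The identity for squared norms of convex combinations: the defect that
        semiconcavity allows is exactly what the quadratic compensates.\<close>
      have "(norm ((1 - u) *\<^sub>R z0 + u *\<^sub>R z1))\<^sup>2 + u * (1 - u) * (norm (z0 - z1))\<^sup>2
         = (1 - u) * (norm z0)\<^sup>2 + u * (norm z1)\<^sup>2"
        by (simp add: power2_norm_eq_inner algebra_simps inner_commute)
      then have "c * (norm ((1 - u) *\<^sub>R z0 + u *\<^sub>R z1))\<^sup>2 + c * u * (1 - u) * (norm (z0 - z1))\<^sup>2
         = (1 - u) * (c * (norm z0)\<^sup>2) + u * (c * (norm z1)\<^sup>2)"
        by (simp add: algebra_simps) (metis (no_types, opaque_lifting) distrib_left mult.left_commute)
      then show ?thesis using sc[of z0 z1 u] z u by (simp add: \<phi>_def E_def algebra_simps)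
    qed
    moreover have "(1 - u) * \<phi> z0 + u * \<phi> z1 < (1 - u) * b0 + u * b1"
      using z u
      by (cases "u = 0") (auto simp: E_def intro!: add_le_less_mono mult_left_mono mult_strict_left_mono)
    ultimately show "(1 - u) *\<^sub>R (z0, b0) + u *\<^sub>R (z1, b1) \<in> E"
      by (simp add: E_def)
  qed
  have "(x, \<phi> x + 1) \<in> E" using e by (simp add: E_def)
  then have "E \<noteq> {}" by blast
  moreover have "E \<inter> {(x, \<phi> x)} = {}" by (auto simp: E_def)
  ultimately have "\<exists>a b. a \<noteq> 0 \<and> (\<forall>p\<in>E. a \<bullet> p \<le> b) \<and> (\<forall>p\<in>{(x, \<phi> x)}. a \<bullet> p \<ge> b)"
    by (intro separating_hyperplane_sets[OF cvx]) auto
  then obtain a b where a: "a \<noteq> 0" "\<And>p. p \<in> E \<Longrightarrow> a \<bullet> p \<le> b" "a \<bullet> (x, \<phi> x) \<ge> b"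
    by blast
  obtain a1 a2 where a12: "a = (a1, a2)" by fastforce
  have sep: "a1 \<bullet> z + a2 * \<beta> \<le> a1 \<bullet> x + a2 * \<phi> x" if "z \<in> ball x e" "\<beta> > \<phi> z" for z \<beta>
    using a(2)[of "(z, \<beta>)"] a(3) that by (simp add: a12 E_def)
  have "a2 \<le> 0" using sep[of x "\<phi> x + 1"] e by (simp add: algebra_simps)
  \<comment> \<open>A vertical hyperplane is violated half a radius away from \<open>x\<close> in
    the direction \<open>a1\<close>.\<close>
  moreover have "a2 \<noteq> 0"
  proof
    assume a2: "a2 = 0"
    then have "a1 \<noteq> 0" using a(1) a12 by (auto simp: zero_prod_def)
    define z where "z = x + (e / (2 * norm a1)) *\<^sub>R a1"
    have "z \<in> ball x e" using e \<open>a1 \<noteq> 0\<close> by (simp add: z_def dist_norm)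
    then have "a1 \<bullet> z \<le> a1 \<bullet> x" using sep[of z "\<phi> z + 1"] a2 by simp
    moreover have "a1 \<bullet> z = a1 \<bullet> x + (e / (2 * norm a1)) * (a1 \<bullet> a1)"
      by (simp add: z_def algebra_simps)
    moreover have "(e / (2 * norm a1)) * (a1 \<bullet> a1) > 0"
      using e \<open>a1 \<noteq> 0\<close> by (intro mult_pos_pos) auto
    ultimately show False by simp
  qed
  ultimately have "a2 < 0" by simp
  define s where "s = (1 / (- a2)) *\<^sub>R a1"
  have a1: "a1 = (- a2) *\<^sub>R s" using \<open>a2 < 0\<close> by (simp add: s_def)
  have sub: "s \<bullet> (z - x) \<le> \<phi> z - \<phi> x" if "z \<in> ball x e" for z
  proof (rule field_le_epsilon)
    fix r :: real assume "r > 0"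
    then have "(- a2) * (s \<bullet> (z - x)) \<le> (- a2) * (\<phi> z - \<phi> x + r)"
      using sep[OF that, of "\<phi> z + r"] by (simp add: a1 algebra_simps)
    then show "s \<bullet> (z - x) \<le> \<phi> z - \<phi> x + r" using \<open>a2 < 0\<close> by simp
  qed
  have "(2 * c) *\<^sub>R x - s \<in> superdiff g x"
  proof (rule superdiff_if_quadratic[OF e, of _ _ _ c])
    fix z assume "z \<in> ball x e"
    moreover have "c * (norm z)\<^sup>2 - c * (norm x)\<^sup>2 = (2 * c) *\<^sub>R x \<bullet> (z - x) + c * (norm (z - x))\<^sup>2"
      by (simp add: power2_norm_eq_inner algebra_simps inner_commute)
    ultimately show "g z \<le> g x + ((2 * c) *\<^sub>R x - s) \<bullet> (z - x) + c * (norm (z - x))\<^sup>2"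
      using sub[of z] by (simp add: \<phi>_def inner_diff_left)
  qed
  then show ?thesis by blast
qed

text \<open>A supergradient controls \<open>g\<close> only to first order as the argument tends to
  \<open>x\<close>. Semiconcavity on the segment from \<open>x\<close> to \<open>z\<close>, taken at
  a point so close to \<open>x\<close> that the first order bound holds there and then divided by
  the parameter \<open>l\<close>, carries the bound to the distant point \<open>z\<close> with a
  quadratic error.\<close>

lemma semiconcave_superdiff_upper:
  fixes g :: "'a::euclidean_space \<Rightarrow> real"
  assumes sc: "\<And>x0 x1 l. \<lbrakk>x0 \<in> B; x1 \<in> B; l \<in> {0..1}\<rbrakk> \<Longrightarrow>
        (1 - l) * g x0 + l * g x1 - g ((1 - l) *\<^sub>R x0 + l *\<^sub>R x1)
          \<le> c * l * (1 - l) * (norm (x0 - x1))\<^sup>2"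
    and "c \<ge> 0" "x \<in> B" "z \<in> B" "q \<in> superdiff g x"
  shows "g z \<le> g x + q \<bullet> (z - x) + c * (norm (z - x))\<^sup>2"
proof (cases "z = x")
  case False
  show ?thesis
  proof (rule field_le_epsilon)
    fix \<delta> :: real assume "\<delta> > 0"
    define n where "n = norm (z - x)"
    have n: "n > 0" using False by (simp add: n_def)
    obtain d where d: "d > 0"
      "\<And>y. norm (y - x) < d \<Longrightarrow> g y - g x - q \<bullet> (y - x) \<le> (\<delta> / n) * norm (y - x)"
      using superdiff_bound[OF assms(5), of "\<delta> / n"] \<open>\<delta> > 0\<close> n by auto
    define l where "l = min 1 (d / (2 * n))"
    have l: "0 < l" "l \<le> 1" using d n by (auto simp: l_def)
    have "l * n \<le> d / (2 * n) * n" using n by (intro mult_right_mono) (auto simp: l_def)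
    then have ln: "l * n < d" using n d(1) by simp
    define y where "y = (1 - l) *\<^sub>R x + l *\<^sub>R z"
    have yx: "y - x = l *\<^sub>R (z - x)" by (simp add: y_def algebra_simps)
    have "norm (y - x) = l * n" using l by (simp add: yx n_def)
    then have "g y - g x - l * (q \<bullet> (z - x)) \<le> l * \<delta>"
      using d(2)[of y] ln n l by (simp add: yx mult.commute)
    moreover have "(1 - l) * g x + l * g z - g y \<le> c * l * (1 - l) * n\<^sup>2"
      using sc[OF assms(3,4), of l] l by (simp add: y_def n_def norm_minus_commute)
    moreover have "c * l * (1 - l) * n\<^sup>2 \<le> l * (c * n\<^sup>2)"
      using l assms(2) by (simp add: algebra_simps)
    ultimately have "l * (g z) \<le> l * (g x + q \<bullet> (z - x) + c * n\<^sup>2 + \<delta>)"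
      by (simp add: algebra_simps)
    then show "g z \<le> g x + q \<bullet> (z - x) + c * (norm (z - x))\<^sup>2 + \<delta>"
      using l by (simp add: n_def)
  qed
qed simp

text \<open>Finitely many balls of half the local radius cover \<open>K\<close>. A point within the
  smallest half radius of \<open>x\<close> shares a full ball with \<open>x\<close>, so one radius
  and one constant serve all of \<open>K\<close>.\<close>

lemma locally_semiconcave_uniform:
  fixes g :: "'a::euclidean_space \<Rightarrow> real"
  assumes "locally_semiconcave g" "compact K"
  obtains e c where "e > 0" "c \<ge> 0"
    "\<And>x q z. \<lbrakk>x \<in> K; q \<in> superdiff g x; norm (z - x) < e\<rbrakk> \<Longrightarrow>
       g z \<le> g x + q \<bullet> (z - x) + c * (norm (z - x))\<^sup>2"
proof -
  obtain e c where e: "\<And>x. e x > 0" and c: "\<And>x. c x > 0" and sc: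
    "\<And>x x0 x1 l. \<lbrakk>x0 \<in> ball x (e x); x1 \<in> ball x (e x); l \<in> {0..1}\<rbrakk> \<Longrightarrow>
        (1 - l) * g x0 + l * g x1 - g ((1 - l) *\<^sub>R x0 + l *\<^sub>R x1)
          \<le> c x * l * (1 - l) * (norm (x0 - x1))\<^sup>2"
    using assms(1) unfolding locally_semiconcave_def by metis
  obtain F where F: "F \<subseteq> K" "finite F" "K \<subseteq> (\<Union>x\<in>F. ball x (e x / 2))"
    using compactE_image[OF assms(2), of K "\<lambda>x. ball x (e x / 2)"] e by force
  show ?thesis
  proof (cases "F = {}")
    case True
    then show ?thesis using that[of 1 0] F by auto
  next
    case False
    define \<epsilon> where "\<epsilon> = Min ((\<lambda>x. e x / 2) ` F)"
    define C where "C = Max (c ` F)"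
    have "\<epsilon> > 0" using False F e by (simp add: \<epsilon>_def)
    moreover have "C \<ge> 0"
    proof -
      obtain i where "i \<in> F" using False by blast
      then have "c i \<le> C" using F by (simp add: C_def)
      then show ?thesis using c[of i] by simp
    qed
    moreover have "g z \<le> g x + q \<bullet> (z - x) + C * (norm (z - x))\<^sup>2"
      if x: "x \<in> K" and that: "q \<in> superdiff g x" "norm (z - x) < \<epsilon>" for x q z
    proof -
      obtain i where i: "i \<in> F" "dist i x < e i / 2" using F x by auto
      have "\<epsilon> \<le> e i / 2" unfolding \<epsilon>_def using i F by (intro Min_le) auto
      then have "dist i z < e i"
        using i that(2) dist_triangle[of i z x] by (simp add: dist_norm norm_minus_commute)
      then have "g z \<le> g x + q \<bullet> (z - x) + c i * (norm (z - x))\<^sup>2"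
        using i that e[of i] c[of i]
        by (intro semiconcave_superdiff_upper[where B = "ball i (e i)"] sc) auto
      also have "c i * (norm (z - x))\<^sup>2 \<le> C * (norm (z - x))\<^sup>2"
        using i F by (intro mult_right_mono) (auto simp: C_def)
      finally show ?thesis by simp
    qed
    ultimately show ?thesis using that by blast
  qed
qed

text \<open>Along \<open>- q\<close> the function drops at a rate of at least
  \<open>norm q - \<delta>\<close>, which the Lipschitz bound limits to \<open>G\<close>.\<close>

lemma superdiff_norm_le:
  fixes g :: "'a::euclidean_space \<Rightarrow> real"
  assumes q: "q \<in> superdiff g x" and x: "x \<in> interior A"
    and lip: "\<And>x y. x \<in> A \<Longrightarrow> y \<in> A \<Longrightarrow> \<bar>g y - g x\<bar> \<le> G * norm (y - x)"
    and "G \<ge> 0"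
  shows "norm q \<le> G"
proof (cases "q = 0")
  case False
  obtain r where r: "r > 0" "ball x r \<subseteq> A" using x by (auto simp: mem_interior)
  show ?thesis
  proof (rule field_le_epsilon)
    fix \<delta> :: real assume "\<delta> > 0"
    then obtain d where d: "d > 0"
      "\<And>y. norm (y - x) < d \<Longrightarrow> g y - g x - q \<bullet> (y - x) \<le> \<delta> * norm (y - x)"
      using superdiff_bound[OF q] by auto
    define l where "l = min r d / 2"
    have l: "l > 0" "l < r" "l < d" using r d by (auto simp: l_def)
    define y where "y = x - (l / norm q) *\<^sub>R q"
    have yx: "y - x = - ((l / norm q) *\<^sub>R q)" by (simp add: y_def)
    have n: "norm (y - x) = l" using l False by (simp add: yx)
    have "x \<in> ball x r" "y \<in> ball x r" using n l r by (auto simp: dist_norm norm_minus_commute)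
    then have "x \<in> A" "y \<in> A" using r by auto
    then have "\<bar>g y - g x\<bar> \<le> G * l" using lip[of x y] n by simp
    moreover have "q \<bullet> (y - x) = - (l * norm q)"
      using False by (simp add: yx power2_norm_eq_inner[symmetric] power2_eq_square)
    ultimately have "l * norm q \<le> l * (G + \<delta>)"
      using d(2)[of y] n l by (simp add: algebra_simps)
    then show "norm q \<le> G + \<delta>" using l by simp
  qed
qed (use assms in auto)

text \<open>The best radius \<open>R\<close>, cut off at 1, is positive but in general neither
  continuous nor attained. Its largest 1-Lipschitz minorant \<open>m\<close>, an infimal convolution
  with the distance, stays positive because \<open>R\<close> is locally bounded away from 0; halving
  \<open>m\<close> gets strictly below the supremum.\<close>

lemma continuous_minorant_radius:
  fixes D :: "'a::metric_space set"
  assumes down: "\<And>x a b. \<lbrakk>x \<in> D; P x b; 0 < a; a \<le> b\<rbrakk> \<Longrightarrow> P x a"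
    and loc: "\<And>x. x \<in> D \<Longrightarrow> \<exists>e>0. \<exists>c>0. \<forall>y\<in>D. dist x y < e \<longrightarrow> P y c"
  shows "\<exists>\<rho>::'a \<Rightarrow> real. continuous_on D \<rho> \<and> (\<forall>x\<in>D. \<rho> x > 0 \<and> P x (\<rho> x))"
proof -
  define R where "R = (\<lambda>x. Sup {t. 0 < t \<and> t \<le> 1 \<and> P x t})"
  have bdd: "bdd_above {t. 0 < t \<and> t \<le> 1 \<and> P x t}" for x
    by (auto intro!: bdd_aboveI[of _ 1])
  have Rge: "min c 1 \<le> R x" if "x \<in> D" "c > 0" "P x c" for x c
    unfolding R_def using that down by (intro cSup_upper bdd) auto
  have Rpos: "R x > 0" if x: "x \<in> D" for x
  proof -
    obtain e c where "e > 0" "c > 0" and ec: "\<forall>y\<in>D. dist x y < e \<longrightarrow> P y c" using loc[OF x] by blast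
    then have "c > 0" "P x c" using x by auto
    then show ?thesis using Rge[OF x, of c] by linarith
  qed
  have RP: "P x t" if x: "x \<in> D" and t: "0 < t" "t < R x" for x t
  proof -
    have ne: "{t. 0 < t \<and> t \<le> 1 \<and> P x t} \<noteq> {}"
      using loc[OF x] down x by (metis (mono_tags, lifting) dist_self empty_Collect_eq linorder_le_cases order_refl zero_less_one)
    obtain s where "s > t" "P x s" using t less_cSup_iff[OF ne bdd, of t] by (auto simp: R_def)
    then show ?thesis using down x t by (meson less_imp_le)
  qed
  define m where "m = (\<lambda>x. INF y\<in>D. R y + dist x y)"
  have bb: "bdd_below ((\<lambda>y. R y + dist x y) ` D)" for x
    using Rpos by (intro bdd_belowI2[of _ 0]) (meson add_nonneg_nonneg less_imp_le zero_le_dist)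
  have mle: "m x \<le> R x" if "x \<in> D" for x
    using cINF_lower[OF bb that, of x] by (simp add: m_def)
  have mpos: "m x > 0" if x: "x \<in> D" for x
  proof -
    obtain e c where ec: "e > 0" "c > 0" "\<And>y. \<lbrakk>y \<in> D; dist x y < e\<rbrakk> \<Longrightarrow> P y c"
      using loc[OF x] by metis
    have "min e (min c 1) \<le> R y + dist x y" if y: "y \<in> D" for y
    proof (cases "dist x y < e")
      case True
      then show ?thesis using Rge[OF y ec(2) ec(3)[OF y]] zero_le_dist[of x y] by linarith
    next
      case False
      then show ?thesis using Rpos[OF y] by linarith
    qed
    then have "min e (min c 1) \<le> m x" unfolding m_def using x by (intro cINF_greatest) auto
    then show ?thesis using ec by linarith
  qed
  have "m x \<le> m y + dist x y" if "x \<in> D" "y \<in> D" for x y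
  proof -
    have "m x - dist x y \<le> R w + dist y w" if "w \<in> D" for w
      using cINF_lower[OF bb that, of x] dist_triangle[of x w y] by (simp add: m_def)
    then have "m x - dist x y \<le> (INF w\<in>D. R w + dist y w)" using \<open>x \<in> D\<close> by (intro cINF_greatest) auto
    then show ?thesis by (simp add: m_def)
  qed
  then have "1-lipschitz_on D m"
    by (intro lipschitz_onI) (auto simp: dist_real_def abs_le_iff, (metis dist_commute add.commute diff_le_eq)+)
  then have "continuous_on D (\<lambda>x. m x / 2)"
    by (intro continuous_intros lipschitz_on_continuous_on) auto
  moreover have "m x / 2 > 0 \<and> P x (m x / 2)" if "x \<in> D" for x
    using mpos[OF that] mle[OF that] RP[OF that, of "m x / 2"] by auto
  ultimately show ?thesis by blast
qed

section \<open>Proximal normals form a convex cone\<close>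

lemma prox_normal_add:
  assumes "v \<in> prox_normal Q x" "w \<in> prox_normal Q x"
  shows "v + w \<in> prox_normal Q x"
proof -
  obtain s t where "s \<ge> 0" "t \<ge> 0" "\<forall>y\<in>Q. v \<bullet> (y - x) \<le> s * (norm (y - x))\<^sup>2"
    "\<forall>y\<in>Q. w \<bullet> (y - x) \<le> t * (norm (y - x))\<^sup>2" "x \<in> Q"
    using assms unfolding prox_normal_def by blast
  then show ?thesis
    unfolding prox_normal_def by (force simp: inner_add_left distrib_right intro!: exI[of _ "s + t"] add_mono)
qed

lemma prox_normal_scaleR:
  assumes "v \<in> prox_normal Q x" "c \<ge> 0"
  shows "c *\<^sub>R v \<in> prox_normal Q x"
proof -
  obtain s where "s \<ge> 0" "\<forall>y\<in>Q. v \<bullet> (y - x) \<le> s * (norm (y - x))\<^sup>2" "x \<in> Q"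
    using assms unfolding prox_normal_def by blast
  then show ?thesis using assms(2)
    unfolding prox_normal_def by (force simp: mult.assoc intro!: exI[of _ "c * s"] mult_left_mono)
qed

lemma convex_prox_superdiff: "convex (prox_superdiff S V x)"
proof (unfold convex_def, intro ballI allI impI)
  fix v w and a b :: real
  assume "v \<in> prox_superdiff S V x" "w \<in> prox_superdiff S V x" "0 \<le> a" "0 \<le> b" and ab: "a + b = 1"
  then have "a *\<^sub>R (- v, 1) + b *\<^sub>R (- w, 1) \<in> prox_normal (hypo S V) (x, real_of_ereal (V x))"
    by (intro prox_normal_add prox_normal_scaleR) (auto simp: prox_superdiff_def)
  then show "a *\<^sub>R v + b *\<^sub>R w \<in> prox_superdiff S V x"
    using ab by (simp add: prox_superdiff_def)
qed

lemma convex_horizon_superdiff: "convex (horizon_superdiff S V x)"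
proof (unfold convex_def, intro ballI allI impI)
  fix v w and a b :: real
  assume "v \<in> horizon_superdiff S V x" "w \<in> horizon_superdiff S V x" "0 \<le> a" "0 \<le> b" and ab: "a + b = 1"
  then have "a *\<^sub>R (- v, 0) + b *\<^sub>R (- w, 0) \<in> prox_normal (hypo S V) (x, real_of_ereal (V x))"
    by (intro prox_normal_add prox_normal_scaleR) (auto simp: horizon_superdiff_def)
  then show "a *\<^sub>R v + b *\<^sub>R w \<in> horizon_superdiff S V x"
    by (simp add: horizon_superdiff_def)
qed

lemma horizon_add_prox_superdiff:
  assumes "a \<in> horizon_superdiff S V x" "b \<in> prox_superdiff S V x"
  shows "a + b \<in> prox_superdiff S V x"
  using assms prox_normal_add[of "(- a, 0)" "hypo S V" "(x, real_of_ereal (V x))" "(- b, 1)"]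
  by (simp add: horizon_superdiff_def prox_superdiff_def)

section \<open>Measurable selection and weak limits\<close>

text \<open>Continuity in \<omega> reduces the infimum to one over a countable dense subset.\<close>

lemma borel_measurable_INF_compact:
  fixes h :: "'a \<Rightarrow> 'b::euclidean_space \<Rightarrow> real"
  assumes C: "compact C" "C \<noteq> {}"
    and meas: "\<And>\<omega>. \<omega> \<in> C \<Longrightarrow> (\<lambda>t. h t \<omega>) \<in> borel_measurable M"
    and cont: "\<And>t. t \<in> space M \<Longrightarrow> continuous_on C (h t)"
  shows "(\<lambda>t. INF \<omega>\<in>C. h t \<omega>) \<in> borel_measurable M"
proof -
  obtain D where D: "countable D" "D \<subseteq> C" "C \<subseteq> closure D" using separable by blast
  then have "D \<noteq> {}" using C by auto
  have cl: "closure D = C"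
    using D C closure_minimal compact_imp_closed by (metis subset_antisym)
  have "(INF \<omega>\<in>C. h t \<omega>) = (INF \<omega>\<in>D. h t \<omega>)" if t: "t \<in> space M" for t
  proof (rule antisym)
    have bdd: "bdd_below (h t ` C)"
      using compact_continuous_image[OF cont[OF t] C(1)] by (simp add: bounded_imp_bdd_below compact_imp_bounded)
    show "(INF \<omega>\<in>C. h t \<omega>) \<le> (INF \<omega>\<in>D. h t \<omega>)"
      using D \<open>D \<noteq> {}\<close> bdd by (intro cINF_superset_mono) auto
    have "bdd_below (h t ` D)" using bdd D by (meson bdd_below_mono image_mono)
    then have "(INF \<omega>\<in>D. h t \<omega>) \<le> h t \<omega>" if "\<omega> \<in> C" for \<omega>
      using continuous_ge_on_closure[of D "h t" \<omega> "INF \<omega>\<in>D. h t \<omega>"] cont[OF t] that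
      by (auto simp: cl intro: cINF_lower)
    then show "(INF \<omega>\<in>D. h t \<omega>) \<le> (INF \<omega>\<in>C. h t \<omega>)" using C by (intro cINF_greatest) auto
  qed
  moreover have "(\<lambda>t. INF \<omega>\<in>D. h t \<omega>) \<in> borel_measurable M"
    using D meas by (intro borel_measurable_cINF_real) auto
  ultimately show ?thesis by (simp cong: measurable_cong)
qed

lemma compact_attains_INF:
  fixes h :: "'b::topological_space \<Rightarrow> real"
  assumes "compact C" "C \<noteq> {}" "continuous_on C h"
  obtains \<omega> where "\<omega> \<in> C" "h \<omega> = (INF \<omega>\<in>C. h \<omega>)" "\<And>\<omega>'. \<omega>' \<in> C \<Longrightarrow> h \<omega> \<le> h \<omega>'"
proof -
  obtain \<omega> where \<omega>: "\<omega> \<in> C" "\<And>\<omega>'. \<omega>' \<in> C \<Longrightarrow> h \<omega> \<le> h \<omega>'"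
    using continuous_attains_inf[OF assms] by blast
  moreover have "(INF \<omega>\<in>C. h \<omega>) = h \<omega>"
    using \<omega> by (intro cInf_eq_minimum) auto
  ultimately show ?thesis using that by simp
qed

text \<open>Among the minimisers, a measurable choice is the lexicographically smallest one: the
  penalty \<open>k\<close> below vanishes exactly on the minimisers whose coordinates along \<open>A\<close> have been
  successively minimised.\<close>

lemma measurable_argmin:
  fixes h :: "'a \<Rightarrow> 'b::euclidean_space \<Rightarrow> real"
  assumes U: "compact U" "U \<noteq> {}"
    and meas: "\<And>\<omega>. \<omega> \<in> U \<Longrightarrow> (\<lambda>t. h t \<omega>) \<in> borel_measurable M"
    and cont: "\<And>t. t \<in> space M \<Longrightarrow> continuous_on U (h t)"
  shows "\<exists>u \<in> borel_measurable M. \<forall>t\<in>space M. u t \<in> U \<and> (\<forall>\<omega>\<in>U. h t (u t) \<le> h t \<omega>)"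
proof -
  define Q where "Q = (\<lambda>A k c.
      (\<forall>\<omega>\<in>U. (\<lambda>t. k t \<omega>) \<in> borel_measurable M) \<and> (\<forall>t\<in>space M. continuous_on U (k t)) \<and>
      (\<forall>b\<in>A. c b \<in> borel_measurable M) \<and>
      (\<forall>t\<in>space M. (\<forall>\<omega>\<in>U. 0 \<le> k t \<omega>) \<and> (\<exists>\<omega>\<in>U. k t \<omega> = 0) \<and>
         (\<forall>\<omega>\<in>U. k t \<omega> = (0::real) \<longrightarrow> (\<forall>b\<in>A. \<omega> \<bullet> b = c b t) \<and> (\<forall>\<omega>'\<in>U. h t \<omega> \<le> h t \<omega>'))))"
  have QD: "\<And>\<omega>. \<omega> \<in> U \<Longrightarrow> (\<lambda>t. k t \<omega>) \<in> borel_measurable M"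
      "\<And>t. t \<in> space M \<Longrightarrow> continuous_on U (k t)"
      "\<And>b. b \<in> A \<Longrightarrow> c b \<in> borel_measurable M"
      "\<And>t \<omega>. \<lbrakk>t \<in> space M; \<omega> \<in> U\<rbrakk> \<Longrightarrow> 0 \<le> k t \<omega>"
      "\<And>t. t \<in> space M \<Longrightarrow> \<exists>\<omega>\<in>U. k t \<omega> = 0"
      "\<And>t \<omega> b. \<lbrakk>t \<in> space M; \<omega> \<in> U; k t \<omega> = 0; b \<in> A\<rbrakk> \<Longrightarrow> \<omega> \<bullet> b = c b t"
      "\<And>t \<omega> \<omega>'. \<lbrakk>t \<in> space M; \<omega> \<in> U; k t \<omega> = 0; \<omega>' \<in> U\<rbrakk> \<Longrightarrow> h t \<omega> \<le> h t \<omega>'"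
    if "Q A k c" for A k c
    using that[unfolded Q_def] by simp_all
  have "\<exists>k c. Q A k c"
    if "finite A" for A :: "'b set"
    using that
  proof (induction A)
    case empty
    define k where "k = (\<lambda>t \<omega>. h t \<omega> - (INF \<omega>\<in>U. h t \<omega>))"
    have "0 \<le> k t \<omega>" if "t \<in> space M" "\<omega> \<in> U" for t \<omega>
      using compact_attains_INF[OF U cont[OF that(1)]] that(2) by (metis diff_ge_0_iff_ge k_def)
    moreover have "\<exists>\<omega>\<in>U. k t \<omega> = 0" if "t \<in> space M" for t
      using compact_attains_INF[OF U cont[OF that]] by (metis diff_self k_def)
    moreover have "h t \<omega> \<le> h t \<omega>'" if "t \<in> space M" "\<omega> \<in> U" "k t \<omega> = 0" "\<omega>' \<in> U" for t \<omega> \<omega>'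
      using compact_attains_INF[OF U cont[OF that(1)]] that by (metis eq_iff_diff_eq_0 k_def)
    moreover have "(\<lambda>t. k t \<omega>) \<in> borel_measurable M" if "\<omega> \<in> U" for \<omega>
      unfolding k_def using meas that borel_measurable_INF_compact[OF U meas cont]
      by (intro borel_measurable_diff) auto
    moreover have "continuous_on U (k t)" if "t \<in> space M" for t
      unfolding k_def using cont that by (intro continuous_intros) auto
    ultimately show ?case unfolding Q_def by (intro exI[of _ k] exI[of _ "\<lambda>_ _. 0"]) blast
  next
    case (insert b A)
    obtain k c where "Q A k c" using insert.IH by blast
    note kc = QD[OF this]
    define Z where "Z = (\<lambda>t. {\<omega> \<in> U. k t \<omega> = 0})"
    define m where "m = (\<lambda>t. INF \<omega>\<in>Z t. \<omega> \<bullet> b)"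
    have Z: "compact (Z t)" "Z t \<noteq> {}" if "t \<in> space M" for t
    proof -
      have "closedin (top_of_set U) (U \<inter> k t -` {0})"
        by (rule continuous_closedin_preimage[OF kc(2)[OF that]]) auto
      moreover have "U \<inter> k t -` {0} = Z t" by (auto simp: Z_def)
      ultimately show "compact (Z t)" using U(1) closedin_compact by metis
      show "Z t \<noteq> {}" using kc(5)[OF that] by (auto simp: Z_def)
    qed
    have Zmin: "\<exists>\<omega>\<in>Z t. \<omega> \<bullet> b = m t \<and> (\<forall>\<omega>'\<in>Z t. m t \<le> \<omega>' \<bullet> b)" if "t \<in> space M" for t
      proof -
      have "continuous_on (Z t) (\<lambda>\<omega>. \<omega> \<bullet> b)" by (intro continuous_intros)
      from compact_attains_INF[OF Z[OF that] this] show ?thesis unfolding m_def by metis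
    qed
    \<comment> \<open>As \<open>k\<close> is nonnegative and minima over compact sets are attained,
      \<open>m t \<le> \<alpha>\<close> holds exactly when the infimum of \<open>k t\<close> over
      the compact part \<open>W\<close> of \<open>U\<close> is at most 0. Measurability of the
      set-valued map \<open>Z\<close> is thus replaced by that of an infimum.\<close>
    have m1: "m \<in> borel_measurable M"
    proof (rule borel_measurable_iff_le[THEN iffD2], rule allI)
      fix \<alpha> :: real
      define W where "W = {\<omega> \<in> U. \<omega> \<bullet> b \<le> \<alpha>}"
      have "compact W"
      proof -
        have "W = U \<inter> {\<omega>. b \<bullet> \<omega> \<le> \<alpha>}" by (auto simp: W_def inner_commute)
        then show ?thesis using U(1) closed_halfspace_le by (metis compact_Int_closed)
      qed
      have iff: "m t \<le> \<alpha> \<longleftrightarrow> (\<exists>\<omega>\<in>W. k t \<omega> = 0)" if t: "t \<in> space M" for t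
      proof -
        obtain \<omega> where "\<omega> \<in> U" "k t \<omega> = 0" "\<omega> \<bullet> b = m t" and le: "\<And>\<omega>'. \<omega>' \<in> U \<Longrightarrow> k t \<omega>' = 0 \<Longrightarrow> m t \<le> \<omega>' \<bullet> b"
          using Zmin[OF t] unfolding Z_def by blast
        then show ?thesis unfolding W_def by (metis (mono_tags, lifting) mem_Collect_eq order_trans)
      qed
      show "{t \<in> space M. m t \<le> \<alpha>} \<in> sets M"
      proof (cases "W = {}")
        case True
        then have "{t \<in> space M. m t \<le> \<alpha>} = {}" using iff True by auto
        then show ?thesis by (metis sets.empty_sets)
      next
        case False
        have WU: "W \<subseteq> U" by (auto simp: W_def)
        have "(\<exists>\<omega>\<in>W. k t \<omega> = 0) \<longleftrightarrow> (INF \<omega>\<in>W. k t \<omega>) \<le> 0" if t: "t \<in> space M" for t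
        proof -
          have cW: "continuous_on W (k t)" using kc(2)[OF t] WU by (rule continuous_on_subset)
          obtain \<omega> where "\<omega> \<in> W" "k t \<omega> = (INF \<omega>\<in>W. k t \<omega>)" "\<And>\<omega>'. \<omega>' \<in> W \<Longrightarrow> k t \<omega> \<le> k t \<omega>'"
            using compact_attains_INF[OF \<open>compact W\<close> False cW] by blast
          moreover have "k t \<omega>' \<ge> 0" if "\<omega>' \<in> W" for \<omega>' using kc(4)[OF t] WU that by blast
          ultimately show ?thesis by (metis order_antisym)
        qed
        then have "{t \<in> space M. m t \<le> \<alpha>} = {t \<in> space M. (INF \<omega>\<in>W. k t \<omega>) \<le> 0}"
          using iff by blast
        moreover have "(\<lambda>t. INF \<omega>\<in>W. k t \<omega>) \<in> borel_measurable M"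
          using WU kc(1,2) by (intro borel_measurable_INF_compact[OF \<open>compact W\<close> False])
            (auto intro: continuous_on_subset[OF kc(2) WU])
        ultimately show ?thesis by simp
      qed
    qed
    have m2: "\<exists>\<omega>\<in>U. k t \<omega> + \<bar>\<omega> \<bullet> b - m t\<bar> = 0" if "t \<in> space M" for t
      using Zmin[OF that] by (force simp: Z_def)
    have m3: "k t \<omega> = 0 \<and> \<omega> \<bullet> b = m t" if "t \<in> space M" "\<omega> \<in> U" "k t \<omega> + \<bar>\<omega> \<bullet> b - m t\<bar> = 0" for t \<omega>
      using kc(4)[OF that(1,2)] that(3) by linarith
    \<comment> \<open>Penalising the distance of \<open>\<omega> \<bullet> b\<close> from its
      constrained minimum keeps the zeros among those of \<open>k\<close> and fixes one more
      coordinate.\<close>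
    have "Q (insert b A) (\<lambda>t \<omega>. k t \<omega> + \<bar>\<omega> \<bullet> b - m t\<bar>) (c(b := m))"
      unfolding Q_def
    proof (intro conjI ballI impI)
      fix \<omega> assume "\<omega> \<in> U"
      then show "(\<lambda>t. k t \<omega> + \<bar>\<omega> \<bullet> b - m t\<bar>) \<in> borel_measurable M"
        by (intro borel_measurable_add borel_measurable_abs borel_measurable_diff kc(1) m1) auto
    next
      fix t assume "t \<in> space M"
      then show "continuous_on U (\<lambda>\<omega>. k t \<omega> + \<bar>\<omega> \<bullet> b - m t\<bar>)"
        by (intro continuous_intros kc(2))
    next
      fix b' assume "b' \<in> insert b A"
      then show "(c(b := m)) b' \<in> borel_measurable M" using kc(3) m1 by auto
    next
      fix t \<omega> assume "t \<in> space M" "\<omega> \<in> U"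
      then show "0 \<le> k t \<omega> + \<bar>\<omega> \<bullet> b - m t\<bar>" using kc(4) by (simp add: add_nonneg_nonneg)
    next
      fix t assume "t \<in> space M"
      then show "\<exists>\<omega>\<in>U. k t \<omega> + \<bar>\<omega> \<bullet> b - m t\<bar> = 0" by (rule m2)
    next
      fix t \<omega> b' assume *: "t \<in> space M" "\<omega> \<in> U" "k t \<omega> + \<bar>\<omega> \<bullet> b - m t\<bar> = 0" "b' \<in> insert b A"
      note ** = m3[OF *(1-3)]
      show "\<omega> \<bullet> b' = (c(b := m)) b' t"
        using ** kc(6)[OF *(1,2) conjunct1[OF **], of b'] *(4) by (cases "b' = b") auto
    next
      fix t \<omega> \<omega>' assume *: "t \<in> space M" "\<omega> \<in> U" "k t \<omega> + \<bar>\<omega> \<bullet> b - m t\<bar> = 0" "\<omega>' \<in> U"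
      show "h t \<omega> \<le> h t \<omega>'" by (rule kc(7)[OF *(1,2) conjunct1[OF m3[OF *(1-3)]] *(4)])
    qed
    then show ?case by blast
  qed
  from this[OF finite_Basis] obtain k c where "Q Basis k c" by blast
  note kc = QD[OF this]
  \<comment> \<open>With every coordinate fixed the zero of \<open>k t\<close> is unique, and it is
    assembled from its measurable coordinates \<open>c b\<close>.\<close>
  define u where "u = (\<lambda>t. \<Sum>b\<in>Basis. c b t *\<^sub>R (b::'b))"
  have "u \<in> borel_measurable M"
    unfolding u_def by (intro borel_measurable_sum borel_measurable_scaleR kc(3)) auto
  moreover have "u t \<in> U \<and> (\<forall>\<omega>\<in>U. h t (u t) \<le> h t \<omega>)" if t: "t \<in> space M" for t
  proof -
    obtain \<omega> where \<omega>: "\<omega> \<in> U" "k t \<omega> = 0" using kc(5)[OF t] by blast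
    have "\<omega> = (\<Sum>b\<in>Basis. (\<omega> \<bullet> b) *\<^sub>R b)" by (simp add: euclidean_representation)
    also have "\<dots> = u t" unfolding u_def using kc(6)[OF t \<omega>] by (intro sum.cong) auto
    finally show ?thesis using \<omega> kc(7)[OF t \<omega>] by auto
  qed
  ultimately show ?thesis by blast
qed

text \<open>A substitute for weak compactness. Elements of almost minimal \<open>L\<^sup>2\<close> norm in the tails of the
  midpoint hulls of a bounded sequence form a Cauchy sequence, by the parallelogram law; so they
  converge pointwise along a subsequence, and convex constraints and limits of integrals are
  inherited by the limit.\<close>

inductive_set midpoint_hull :: "(nat \<Rightarrow> 'b \<Rightarrow> 'a::real_vector) \<Rightarrow> nat \<Rightarrow> ('b \<Rightarrow> 'a) set"
  for w n where
  base: "m \<ge> n \<Longrightarrow> w m \<in> midpoint_hull w n"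
| midpoint: "\<lbrakk>g \<in> midpoint_hull w n; h \<in> midpoint_hull w n\<rbrakk> \<Longrightarrow>
    (\<lambda>t. (1/2) *\<^sub>R (g t + h t)) \<in> midpoint_hull w n"

lemma midpoint_hull_antimono:
  assumes "g \<in> midpoint_hull w n" "m \<le> n"
  shows "g \<in> midpoint_hull w m"
  using assms by (induction rule: midpoint_hull.induct) (auto intro: midpoint_hull.intros)

lemma midpoint_hull_pointwise:
  assumes "g \<in> midpoint_hull w n" "convex C" "\<And>m. m \<ge> n \<Longrightarrow> w m t \<in> C"
  shows "g t \<in> C"
  using assms(1)
proof (induction rule: midpoint_hull.induct)
  case (midpoint g h)
  then show ?case using convexD[OF assms(2), of "g t" "h t" "1/2" "1/2"]
    by (simp add: scaleR_right_distrib)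
qed (use assms in auto)

lemma midpoint_hull_measurable:
  fixes w :: "nat \<Rightarrow> 'b \<Rightarrow> 'a::euclidean_space"
  assumes "g \<in> midpoint_hull w n" "\<And>m. w m \<in> borel_measurable M"
  shows "g \<in> borel_measurable M"
  using assms by (induction rule: midpoint_hull.induct) auto

lemma integral_tendsto_bounded_AE:
  fixes g :: "nat \<Rightarrow> real \<Rightarrow> 'a::euclidean_space"
  assumes meas: "\<And>i. g i \<in> borel_measurable (lebesgue_on {0..T})"
    and D: "D \<in> borel_measurable (lebesgue_on {0..T})"
    and bound: "\<And>i t. t \<in> {0..T} \<Longrightarrow> norm (g i t) \<le> M"
    and conv: "AE t in lebesgue_on {0..T}. (\<lambda>i. g i t) \<longlonglongrightarrow> D t"
    and t: "t \<in> {0..T}"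
  shows "(\<lambda>i. integral {0..t} (g i)) \<longlonglongrightarrow> integral {0..t} D"
proof -
  have m: "g i \<in> borel_measurable (lebesgue_on {0..t})" "D \<in> borel_measurable (lebesgue_on {0..t})" for i
    using t by (auto intro!: borel_measurable_lebesgue_on_subset[OF meas] borel_measurable_lebesgue_on_subset[OF D])
  have c: "AE s in lebesgue_on {0..t}. (\<lambda>i. g i s) \<longlonglongrightarrow> D s"
    using conv t by (auto simp: AE_restrict_space_iff elim!: eventually_mono)
  have b: "AE s in lebesgue_on {0..t}. norm (g i s) \<le> M" for i
    using bound t by (auto simp: AE_restrict_space_iff)
  have "(\<lambda>i. integral\<^sup>L (lebesgue_on {0..t}) (g i)) \<longlonglongrightarrow> integral\<^sup>L (lebesgue_on {0..t}) D"
    by (rule integral_dominated_convergence[where w = "\<lambda>_. M"]) (use m c b in auto)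
  moreover have "integrable (lebesgue_on {0..t}) D"
    by (rule integrable_dominated_convergence[where w = "\<lambda>_. M" and s = g]) (use m c b in auto)
  moreover have "integrable (lebesgue_on {0..t}) (g i)" for i
    by (rule Bochner_Integration.integrable_bound[where f = "\<lambda>_. M"]) (use m b[of i] in \<open>auto elim!: eventually_mono\<close>)
  ultimately show ?thesis by (simp add: lebesgue_integral_eq_integral)
qed

lemma integrable_lebesgue_on_bounded:
  fixes h :: "real \<Rightarrow> 'a::euclidean_space"
  assumes "h \<in> borel_measurable (lebesgue_on {a..b})" "\<And>t. t \<in> {a..b} \<Longrightarrow> norm (h t) \<le> B"
  shows "integrable (lebesgue_on {a..b}) h"
  using assms by (intro finite_measure.integrable_const_bound[of _ _ B] finite_measure_lebesgue_on) auto

text \<open>The closed convex sets are quantified inside the almost-everywhere statement so that the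
  constraint may vary with \<open>t\<close>; it will be the epigraph at the limit trajectory. The
  last conclusion tests with a single vector \<open>b\<close>, so that only convergence of real
  numbers has to be known beforehand.\<close>

lemma convex_weak_limit:
  fixes w :: "nat \<Rightarrow> real \<Rightarrow> 'a::euclidean_space"
  assumes meas: "\<And>n. w n \<in> borel_measurable (lebesgue_on {0..T})"
    and bound: "\<And>n t. t \<in> {0..T} \<Longrightarrow> norm (w n t) \<le> M"
  obtains D where "D \<in> borel_measurable (lebesgue_on {0..T})"
    "\<And>t. t \<in> {0..T} \<Longrightarrow> norm (D t) \<le> M"
    "AE t in lebesgue_on {0..T}. \<forall>C. closed C \<longrightarrow> convex C \<longrightarrow> (\<forall>n. w n t \<in> C) \<longrightarrow> D t \<in> C"
    "\<And>t b l. \<lbrakk>t \<in> {0..T}; (\<lambda>n. integral {0..t} (w n) \<bullet> b) \<longlonglongrightarrow> l\<rbrakk> \<Longrightarrow> integral {0..t} D \<bullet> b = l"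
proof (cases "0 \<le> T")
  case True
  define \<Lambda> where "\<Lambda> = lebesgue_on {0..T}"
  have sp: "space \<Lambda> = {0..T}" by (simp add: \<Lambda>_def)
  have M: "M \<ge> 0" using bound[of 0 0] True norm_ge_zero order_trans by (metis atLeastAtMost_iff order_refl)
  interpret finite_measure \<Lambda>
    unfolding \<Lambda>_def by (intro finite_measure_lebesgue_on) auto
  have mm: "g \<in> borel_measurable \<Lambda>" if "g \<in> midpoint_hull w n" for g n
    using midpoint_hull_measurable[OF that] meas by (auto simp: \<Lambda>_def)
  have mb: "norm (g t) \<le> M" if "g \<in> midpoint_hull w n" "t \<in> {0..T}" for g n t
    using midpoint_hull_pointwise[OF that(1) convex_cball[of 0 M], of t] bound that(2) by auto
  define q where "q = (\<lambda>g::real \<Rightarrow> 'a. integral\<^sup>L \<Lambda> (\<lambda>t. (norm (g t))\<^sup>2))"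
  have iq: "integrable \<Lambda> (\<lambda>t. (norm (g t))\<^sup>2)" if "g \<in> midpoint_hull w n" for g n
    using mm[OF that] mb[OF that] unfolding \<Lambda>_def by (intro integrable_lebesgue_on_bounded[where B = "M\<^sup>2"]) (auto intro!: power_mono)
  have q0: "q g \<ge> 0" for g by (simp add: q_def)
  have qM: "q g \<le> M\<^sup>2 * measure \<Lambda> {0..T}" if "g \<in> midpoint_hull w n" for g n
  proof -
    have "q g \<le> integral\<^sup>L \<Lambda> (\<lambda>_. M\<^sup>2)"
      unfolding q_def using mb[OF that] iq[OF that] by (intro integral_mono) (auto simp: sp intro!: power_mono)
    then show ?thesis by (simp add: sp mult.commute)
  qed
  \<comment> \<open>The hulls shrink with \<open>n\<close>, so \<open>d\<close> is increasing; being
    bounded it converges, and this is what makes near-minimisers a Cauchy sequence.\<close>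
  define d where "d = (\<lambda>n. Inf (q ` midpoint_hull w n))"
  have ne: "midpoint_hull w n \<noteq> {}" for n using midpoint_hull.base[of n n w] by auto
  have bdd: "bdd_below (q ` midpoint_hull w n)" for n using q0 by (intro bdd_belowI2[of _ 0])
  have dle: "d n \<le> q g" if "g \<in> midpoint_hull w n" for n g
    unfolding d_def using that bdd by (intro cInf_lower) auto
  have "\<exists>g\<in>midpoint_hull w n. q g < d n + inverse (Suc n)" for n
    using cInf_lessD[of "q ` midpoint_hull w n" "d n + inverse (Suc n)"] ne[of n] unfolding d_def by auto
  then obtain G where G: "\<And>n. G n \<in> midpoint_hull w n" "\<And>n. q (G n) < d n + inverse (Suc n)" by metis
  have dmono: "mono d"
    unfolding d_def mono_def using ne bdd midpoint_hull_antimono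
    by (auto intro!: cInf_superset_mono image_mono)
  have "d n \<le> M\<^sup>2 * measure \<Lambda> {0..T}" for n using dle[OF G(1)] qM[OF G(1)] order_trans by blast
  then have "convergent d"
    using dmono incseq_convergent[of d "M\<^sup>2 * measure \<Lambda> {0..T}"] by (metis convergentI)
  then have Cd: "Cauchy d" by (rule convergent_Cauchy)
  \<comment> \<open>For \<open>n \<le> m\<close> the midpoint of \<open>G m\<close> and
    \<open>G n\<close> still lies in the hull of the tail from \<open>n\<close>, so its squared norm
    is at least \<open>d n\<close>; the parallelogram law then bounds the difference.\<close>
  have diff: "integral\<^sup>L \<Lambda> (\<lambda>t. (norm (G m t - G n t))\<^sup>2) \<le> 2 * (d m - d n) + 4 * inverse (Suc n)"
    if "n \<le> m" for m n
  proof -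
    have Gm: "G m \<in> midpoint_hull w n" using midpoint_hull_antimono[OF G(1) that] .
    define h where "h = (\<lambda>t. (1/2) *\<^sub>R (G m t + G n t))"
    have h: "h \<in> midpoint_hull w n" unfolding h_def using Gm G(1) by (rule midpoint_hull.midpoint)
    have "(norm (G m t - G n t))\<^sup>2 = 2 * (norm (G m t))\<^sup>2 + 2 * (norm (G n t))\<^sup>2 - 4 * (norm (h t))\<^sup>2" for t
      by (simp add: h_def power2_norm_eq_inner algebra_simps inner_commute)
    then have "integral\<^sup>L \<Lambda> (\<lambda>t. (norm (G m t - G n t))\<^sup>2) = 2 * q (G m) + 2 * q (G n) - 4 * q h"
      using iq[OF Gm] iq[OF G(1)[of n]] iq[OF h] by (simp add: q_def)
    also have "\<dots> \<le> 2 * (d m + inverse (Suc m)) + 2 * (d n + inverse (Suc n)) - 4 * d n"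
      using less_imp_le[OF G(2)] dle[OF h] by (intro diff_mono add_mono mult_left_mono) auto
    also have "inverse (real (Suc m)) \<le> inverse (real (Suc n))" using that by (intro le_imp_inverse_le) auto
    finally show ?thesis by (simp add: algebra_simps)
  qed
  have G_int: "integrable \<Lambda> (G n)" for n
    using mm[OF G(1)] mb[OF G(1)] unfolding \<Lambda>_def by (rule integrable_lebesgue_on_bounded)
  \<comment> \<open>From L2 to L1 by a <= \<eta> + a^2 / \<eta>: \<open>\<eta>\<close> times the
    measure of the interval is below \<open>e / 2\<close>, and \<open>\<theta>\<close> is chosen so
    that \<open>\<theta> / \<eta>\<close> is \<open>e / 2\<close>.\<close>
  have L1: "\<exists>N. \<forall>i\<ge>N. \<forall>j\<ge>N. integral\<^sup>L \<Lambda> (\<lambda>t. norm (G i t - G j t)) < e" if "e > 0" for e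
  proof -
    define m where "m = measure \<Lambda> {0..T}"
    have m: "m \<ge> 0" by (simp add: m_def)
    define \<eta> where "\<eta> = e / (2 * (m + 1))"
    have \<eta>: "\<eta> > 0" "\<eta> * m < e / 2" using m \<open>e > 0\<close> by (auto simp: \<eta>_def field_simps)
    define \<theta> where "\<theta> = \<eta> * e / 2"
    have \<theta>: "\<theta> > 0" using \<eta> \<open>e > 0\<close> by (simp add: \<theta>_def)
    obtain N1 where N1: "\<And>i j. \<lbrakk>i \<ge> N1; j \<ge> N1\<rbrakk> \<Longrightarrow> dist (d i) (d j) < \<theta> / 8"
      using Cd \<theta> unfolding Cauchy_def by (metis divide_pos_pos zero_less_numeral)
    obtain N2 where N2: "inverse (real (Suc N2)) < \<theta> / 16" using reals_Archimedean[of "\<theta> / 16"] \<theta> by auto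
    have *: "integral\<^sup>L \<Lambda> (\<lambda>t. norm (G i t - G j t)) < e" if ij: "i \<ge> max N1 N2" "j \<ge> max N1 N2" "j \<le> i" for i j
    proof -
      have "inverse (real (Suc j)) \<le> inverse (real (Suc N2))" using ij by (intro le_imp_inverse_le) auto
      then have small: "inverse (real (Suc j)) < \<theta> / 16" using N2 by (rule order.strict_trans1)
      have sq: "integral\<^sup>L \<Lambda> (\<lambda>t. (norm (G i t - G j t))\<^sup>2) < \<theta>"
      proof -
        define v where "v = inverse (real (Suc j))"
        have "d i - d j < \<theta> / 8" using N1[of i j] ij abs_ge_self[of "d i - d j"] by (simp add: dist_real_def)
        moreover have "integral\<^sup>L \<Lambda> (\<lambda>t. (norm (G i t - G j t))\<^sup>2) \<le> 2 * d i - 2 * d j + 4 * v" "v < \<theta> / 16"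
          using diff[OF ij(3)] small by (auto simp: v_def)
        ultimately show ?thesis using \<theta> by linarith
      qed
      have mij: "(\<lambda>t. G i t - G j t) \<in> borel_measurable \<Lambda>" using mm[OF G(1)] by (intro borel_measurable_diff) auto
      have bij: "norm (G i t - G j t) \<le> 2 * M" if "t \<in> {0..T}" for t
        using mb[OF G(1) that, of i] mb[OF G(1) that, of j] norm_triangle_ineq4[of "G i t" "G j t"] by linarith
      have i2: "integrable \<Lambda> (\<lambda>t. (norm (G i t - G j t))\<^sup>2)"
      proof -
        have "norm ((norm (G i t - G j t))\<^sup>2) \<le> (2 * M)\<^sup>2" if "t \<in> {0..T}" for t
          using power_mono[OF bij[OF that] norm_ge_zero, of 2] by simp
        then show ?thesis
          using mij unfolding \<Lambda>_def by (intro integrable_lebesgue_on_bounded) auto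
      qed
      have i1: "integrable \<Lambda> (\<lambda>t. norm (G i t - G j t))"
        using G_int by (intro integrable_norm Bochner_Integration.integrable_diff)
      have "integral\<^sup>L \<Lambda> (\<lambda>t. norm (G i t - G j t)) \<le> integral\<^sup>L \<Lambda> (\<lambda>t. \<eta> + (norm (G i t - G j t))\<^sup>2 / \<eta>)"
      proof (rule integral_mono[OF i1])
        show "integrable \<Lambda> (\<lambda>t. \<eta> + (norm (G i t - G j t))\<^sup>2 / \<eta>)" using i2 by simp
        fix t
        define n where "n = norm (G i t - G j t)"
        have "n \<ge> 0" by (simp add: n_def)
        have "n * \<eta> \<le> \<eta> * \<eta> + n * n"
          using \<eta>(1) \<open>n \<ge> 0\<close> by (cases "n \<le> \<eta>") (auto intro: add_increasing2 add_increasing mult_mono)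
        then show "norm (G i t - G j t) \<le> \<eta> + (norm (G i t - G j t))\<^sup>2 / \<eta>"
          unfolding n_def[symmetric] using \<eta>(1) by (simp add: field_simps power2_eq_square)
      qed
      also have "\<dots> = \<eta> * m + integral\<^sup>L \<Lambda> (\<lambda>t. (norm (G i t - G j t))\<^sup>2) / \<eta>"
        using i2 by (simp add: m_def sp mult.commute)
      also have "integral\<^sup>L \<Lambda> (\<lambda>t. (norm (G i t - G j t))\<^sup>2) / \<eta> < \<theta> / \<eta>"
        using sq \<eta>(1) by (rule divide_strict_right_mono)
      also have "\<theta> / \<eta> = e / 2" using \<eta>(1) by (simp add: \<theta>_def)
      finally show ?thesis using \<eta>(2) by simp
    qed
    show ?thesis
    proof (intro exI allI impI)
      fix i j assume "i \<ge> max N1 N2" "j \<ge> max N1 N2"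
      then show "integral\<^sup>L \<Lambda> (\<lambda>t. norm (G i t - G j t)) < e"
        using *[of i j] *[of j i] by (cases "j \<le> i") (auto simp: norm_minus_commute)
    qed
  qed
  obtain r where r: "strict_mono r" "AE t in \<Lambda>. Cauchy (\<lambda>i. G (r i) t)"
    using cauchy_L1_AE_cauchy_subseq[of \<Lambda> G, OF G_int L1] by blast
  define D0 where "D0 = (\<lambda>t. lim (\<lambda>i. G (r i) t))"
  \<comment> \<open>The limit is reset to 0 where it exceeds \<open>M\<close>, which happens only on
    a null set, so that the norm bound holds at every time.\<close>
  define D where "D = (\<lambda>t. if norm (D0 t) \<le> M then D0 t else 0)"
  have D0m: "D0 \<in> borel_measurable \<Lambda>"
    unfolding D0_def using mm[OF G(1)] by (intro borel_measurable_lim_metric) auto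
  have Dm: "D \<in> borel_measurable \<Lambda>"
    unfolding D_def using D0m by measurable
  have conv: "AE t in \<Lambda>. (\<lambda>i. G (r i) t) \<longlonglongrightarrow> D t"
    using r(2) AE_space
  proof eventually_elim
    case (elim t)
    then have c: "(\<lambda>i. G (r i) t) \<longlonglongrightarrow> D0 t"
      by (simp add: D0_def Cauchy_convergent convergent_LIMSEQ_iff[symmetric])
    have "norm (D0 t) \<le> M"
      using elim(2) mb[OF G(1)] by (intro LIMSEQ_le_const2[OF tendsto_norm[OF c]]) (auto simp: sp)
    then show ?case using c by (simp add: D_def)
  qed
  show ?thesis
  proof (rule that[of D])
    show "D \<in> borel_measurable (lebesgue_on {0..T})" using Dm by (simp add: \<Lambda>_def)
    show "norm (D t) \<le> M" for t using M by (simp add: D_def)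
    show "AE t in lebesgue_on {0..T}. \<forall>C. closed C \<longrightarrow> convex C \<longrightarrow> (\<forall>n. w n t \<in> C) \<longrightarrow> D t \<in> C"
      using conv unfolding \<Lambda>_def[symmetric]
    proof eventually_elim
      case (elim t)
      show ?case
      proof (intro allI impI)
        fix C assume "closed C" "convex C" "\<forall>n. w n t \<in> C"
        then show "D t \<in> C"
          using midpoint_hull_pointwise[OF G(1)] by (intro Lim_in_closed_set[OF _ _ _ elim]) auto
      qed
    qed
    fix t b l assume t: "t \<in> {0..T}" and l: "(\<lambda>n. integral {0..t} (w n) \<bullet> b) \<longlonglongrightarrow> l"
    have ihk: "g integrable_on {0..t}" if "g \<in> midpoint_hull w n" for g n
    proof -
      have "g \<in> borel_measurable (lebesgue_on {0..t})"
        using borel_measurable_lebesgue_on_subset[OF mm[OF that, unfolded \<Lambda>_def], of "{0..t}"] t by auto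
      then have "g absolutely_integrable_on {0..t}"
        using t mb[OF that] by (intro bounded_measurable_absolutely_integrable[of _ _ _ M]) auto
      then show ?thesis using set_lebesgue_integral_eq_integral(1) by blast
    qed
    \<comment> \<open>Closeness of the integrals to \<open>l\<close> passes to midpoints, hence to
      the whole hull of a tail.\<close>
    have near: "\<bar>integral {0..t} g \<bullet> b - l\<bar> \<le> e"
      if "g \<in> midpoint_hull w n" "\<And>m. m \<ge> n \<Longrightarrow> \<bar>integral {0..t} (w m) \<bullet> b - l\<bar> \<le> e" for g n e
      using that(1)
    proof (induction rule: midpoint_hull.induct)
      case (midpoint g h)
      have "integral {0..t} (\<lambda>s. (1/2) *\<^sub>R (g s + h s)) = (1/2) *\<^sub>R (integral {0..t} g + integral {0..t} h)"
        using ihk[OF midpoint(1)] ihk[OF midpoint(2)]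
        by (simp add: Henstock_Kurzweil_Integration.integral_add)
      then have "integral {0..t} (\<lambda>s. (1/2) *\<^sub>R (g s + h s)) \<bullet> b
          = (integral {0..t} g \<bullet> b + integral {0..t} h \<bullet> b) / 2"
        by (simp add: inner_add_left)
      then show ?case using midpoint.IH by (simp add: abs_le_iff field_simps)
    qed (use that in auto)
    have "(\<lambda>i. integral {0..t} (G (r i)) \<bullet> b) \<longlonglongrightarrow> l"
    proof (rule LIMSEQ_I)
      fix e :: real assume "e > 0"
      then obtain N where N: "\<And>m. m \<ge> N \<Longrightarrow> \<bar>integral {0..t} (w m) \<bullet> b - l\<bar> \<le> e / 2"
        using LIMSEQ_D[OF l, of "e / 2"] by (metis half_gt_zero less_imp_le real_norm_def)
      have "norm (integral {0..t} (G (r i)) \<bullet> b - l) < e" if "i \<ge> N" for i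
      proof -
        have "r i \<ge> N" using seq_suble[OF r(1), of i] that by linarith
        then have "\<bar>integral {0..t} (G (r i)) \<bullet> b - l\<bar> \<le> e / 2"
          using N by (intro near[OF G(1)[of "r i"]]) (meson order_trans)
        then show ?thesis using \<open>e > 0\<close> by simp
      qed
      then show "\<exists>N. \<forall>i\<ge>N. norm (integral {0..t} (G (r i)) \<bullet> b - l) < e" by blast
    qed
    moreover have "(\<lambda>i. integral {0..t} (G (r i)) \<bullet> b) \<longlonglongrightarrow> integral {0..t} D \<bullet> b"
      using mm[OF G(1)] Dm conv mb[OF G(1)] t unfolding \<Lambda>_def
      by (intro tendsto_inner tendsto_const integral_tendsto_bounded_AE[where T = T and M = M]) auto
    ultimately show "integral {0..t} D \<bullet> b = l" using LIMSEQ_unique by blast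
  qed
next
  case False
  then show ?thesis using that[of "\<lambda>_. 0"] by (auto simp: AE_restrict_space_iff)
qed

section \<open>Trajectories and exit times\<close>

lemma reach_setE:
  assumes "x \<in> reach_set U S f"
  obtains u where "u \<in> admissible U S f x"
proof -
  have "admissible U S f x \<noteq> {}" using assms unfolding reach_set_def by (rule CollectD)
  then show ?thesis using that by (meson equals0I)
qed

lemma lipschitz_has_derivative_norm_le:
  fixes \<phi> :: "'a::real_normed_vector \<Rightarrow> 'b::real_normed_vector"
  assumes D: "(\<phi> has_derivative A) (at x)"
    and lip: "\<And>y. norm (\<phi> y - \<phi> x) \<le> L * norm (y - x)"
  shows "norm (A h) \<le> L * norm h"
proof (cases "h = 0")
  case True
  then show ?thesis using linear_0[OF has_derivative_linear[OF D]] by simp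
next
  case False
  interpret linear A by (rule has_derivative_linear[OF D])
  show ?thesis
  proof (rule field_le_epsilon)
    fix e :: real assume "e > 0"
    then obtain d where d: "d > 0"
      "\<And>y. norm (y - x) < d \<Longrightarrow> norm (\<phi> y - \<phi> x - A (y - x)) \<le> (e / norm h) * norm (y - x)"
      using D False unfolding has_derivative_at_alt by (metis divide_pos_pos zero_less_norm_iff)
    define t where "t = d / (2 * norm h)"
    have t: "t > 0" "t * norm h < d" using d(1) False by (auto simp: t_def)
    then have "t * norm (A h) = norm (A (t *\<^sub>R h))" by (simp add: scale)
    also have "\<dots> \<le> norm (\<phi> (x + t *\<^sub>R h) - \<phi> x) + norm (\<phi> (x + t *\<^sub>R h) - \<phi> x - A (t *\<^sub>R h))"
      by (metis norm_triangle_sub add.commute norm_minus_commute)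
    also have "\<dots> \<le> L * (t * norm h) + (e / norm h) * (t * norm h)"
      using lip[of "x + t *\<^sub>R h"] d(2)[of "x + t *\<^sub>R h"] t by (intro add_mono) auto
    also have "\<dots> = t * (L * norm h + e)" using False by (simp add: field_simps)
    finally show "norm (A h) \<le> L * norm h + e" using t by simp
  qed
qed

locale exit_time_problem =
  fixes U :: "(real ^ 'm) set"
    and S :: "(real ^ 'd) set"
    and f :: "real ^ 'd \<Rightarrow> real ^ 'm \<Rightarrow> real ^ 'd"
    and r :: "real ^ 'd \<Rightarrow> real ^ 'm \<Rightarrow> real"
    and g :: "real ^ 'd \<Rightarrow> real"
    and Df :: "real ^ 'd \<Rightarrow> real ^ 'm \<Rightarrow> real ^ 'd ^ 'd"
    and Dr :: "real ^ 'd \<Rightarrow> real ^ 'm \<Rightarrow> real ^ 'd"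
    and N L r0 \<rho>0 G :: real
    and Nb :: "(real ^ 'd) set"
  assumes U: "U \<noteq> {}" "compact U"
    and S: "S \<noteq> {}" "closed S"
    and constants: "N > 0" "L > 0" "r0 > 0" "\<rho>0 > 0"
    and convexity: "\<And>x. convex {(v, l). \<exists>\<omega>\<in>U. v = f x \<omega> \<and> l \<ge> r x \<omega>}"
    and f_cont: "continuous_on (UNIV \<times> U) (\<lambda>(x, \<omega>). f x \<omega>)"
    and f_bound: "\<And>x \<omega>. \<omega> \<in> U \<Longrightarrow> norm (f x \<omega>) < N"
    and f_deriv: "\<And>x \<omega>. \<omega> \<in> U \<Longrightarrow> ((\<lambda>y. f y \<omega>) has_derivative (\<lambda>h. Df x \<omega> *v h)) (at x)"
    and Df_cont: "continuous_on (UNIV \<times> U) (\<lambda>(x, \<omega>). Df x \<omega>)"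
    and f_lip: "\<And>x y \<omega>. \<omega> \<in> U \<Longrightarrow> norm (f y \<omega> - f x \<omega>) \<le> L * norm (y - x)"
    and Df_lip: "\<And>x y \<omega>. \<omega> \<in> U \<Longrightarrow> onorm (\<lambda>h. (Df y \<omega> - Df x \<omega>) *v h) \<le> L * norm (y - x)"
    and r_cont: "continuous_on (UNIV \<times> U) (\<lambda>(x, \<omega>). r x \<omega>)"
    and r_deriv: "\<And>x \<omega>. \<omega> \<in> U \<Longrightarrow> ((\<lambda>y. r y \<omega>) has_derivative (\<lambda>h. Dr x \<omega> \<bullet> h)) (at x)"
    and Dr_cont: "continuous_on (UNIV \<times> U) (\<lambda>(x, \<omega>). Dr x \<omega>)"
    and r_lip: "\<And>x y \<omega>. \<omega> \<in> U \<Longrightarrow>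
        \<bar>r y \<omega> - r x \<omega>\<bar> + norm (Dr y \<omega> - Dr x \<omega>) \<le> L * norm (y - x)"
    and r_lower: "\<And>x \<omega>. \<omega> \<in> U \<Longrightarrow> r x \<omega> \<ge> r0"
    and terminal_nbhd: "frontier S \<subseteq> interior Nb"
    and terminal_const: "0 \<le> G" "G < r0 / N"
    and terminal_lip: "\<And>x y. x \<in> Nb \<Longrightarrow> y \<in> Nb \<Longrightarrow> \<bar>g y - g x\<bar> \<le> G * norm (y - x)"
    and inner_ball: "\<And>x. x \<in> frontier S \<Longrightarrow>
        \<exists>\<xi>. norm \<xi> = 1 \<and> \<xi> \<in> prox_normal (closure (- S)) x \<and>
          (\<forall>y\<in>closure (- S). \<xi> \<bullet> (y - x) \<le> 1 / (2 * \<rho>0) * (norm (y - x))\<^sup>2)"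
    and g_semiconcave: "locally_semiconcave g"
begin

lemma N_pos: "N > 0" and L_pos: "L > 0" and r0_pos: "r0 > 0"
  using constants by auto

lemma controls_measurable:
  assumes "u \<in> controls U" "A \<subseteq> {0..}" "A \<in> sets lebesgue"
  shows "u \<in> borel_measurable (lebesgue_on A)"
  using assms by (auto simp: controls_def intro: borel_measurable_lebesgue_on_subset)

lemma controls_in_U: "u \<in> controls U \<Longrightarrow> t \<ge> 0 \<Longrightarrow> u t \<in> U"
  by (simp add: controls_def)

lemma borel_measurable_along:
  fixes \<phi> :: "real ^ 'd \<Rightarrow> real ^ 'm \<Rightarrow> 'b::euclidean_space"
  assumes \<phi>: "continuous_on (UNIV \<times> U) (\<lambda>(x, \<omega>). \<phi> x \<omega>)" and u: "u \<in> controls U"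
    and y: "continuous_on A y" and A: "A \<subseteq> {0..}" "A \<in> sets lebesgue"
  shows "(\<lambda>s. \<phi> (y s) (u s)) \<in> borel_measurable (lebesgue_on A)"
proof -
  have "y \<in> borel_measurable (lebesgue_on A)"
    using y A by (intro continuous_imp_measurable_on_sets_lebesgue)
  then have "(\<lambda>s. (y s, u s)) \<in> borel_measurable (lebesgue_on A)"
    using controls_measurable[OF u A] by (intro borel_measurable_Pair)
  \<comment> \<open>Continuity of \<open>\<phi>\<close> is known on \<open>UNIV \<times> U\<close>,
    so the composition runs through the Borel space restricted to that set.\<close>
  then have "(\<lambda>s. (y s, u s)) \<in> measurable (lebesgue_on A) (restrict_space borel (UNIV \<times> U))"
    using controls_in_U[OF u] A by (intro measurable_restrict_space2) auto
  from measurable_compose[OF this borel_measurable_continuous_on_restrict[OF \<phi>]]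
  show ?thesis by simp
qed

lemma absolutely_integrable_along:
  fixes \<phi> :: "real ^ 'd \<Rightarrow> real ^ 'm \<Rightarrow> 'b::euclidean_space"
  assumes \<phi>: "continuous_on (UNIV \<times> U) (\<lambda>(x, \<omega>). \<phi> x \<omega>)" and u: "u \<in> controls U"
    and y: "continuous_on {a..b} y" and a: "0 \<le> a"
  shows "(\<lambda>s. \<phi> (y s) (u s)) absolutely_integrable_on {a..b}"
proof -
  have "compact ((\<lambda>(x, \<omega>). \<phi> x \<omega>) ` (y ` {a..b} \<times> U))"
    using U by (intro compact_continuous_image continuous_on_subset[OF \<phi>] compact_Times
        compact_continuous_image[OF y]) auto
  then obtain B where B: "\<And>p. p \<in> y ` {a..b} \<times> U \<Longrightarrow> norm (case p of (x, \<omega>) \<Rightarrow> \<phi> x \<omega>) \<le> B"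
    by (meson bounded_iff compact_imp_bounded imageI)
  have "norm (\<phi> (y s) (u s)) \<le> B" if "s \<in> {a..b}" for s
    using B[of "(y s, u s)"] that controls_in_U[OF u, of s] a by auto
  then show ?thesis
    using a by (intro bounded_measurable_absolutely_integrable borel_measurable_along[OF \<phi> u y]) auto
qed

lemma integrable_along:
  fixes \<phi> :: "real ^ 'd \<Rightarrow> real ^ 'm \<Rightarrow> 'b::euclidean_space"
  assumes "continuous_on (UNIV \<times> U) (\<lambda>(x, \<omega>). \<phi> x \<omega>)" "u \<in> controls U"
    "continuous_on {a..b} y" "0 \<le> a"
  shows "(\<lambda>s. \<phi> (y s) (u s)) integrable_on {a..b}"
  using absolutely_integrable_along[OF assms] set_lebesgue_integral_eq_integral(1) by blast

lemma continuous_on_f: "continuous_on U (f X)" and continuous_on_r: "continuous_on U (r X)"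
proof -
  have "continuous_on U (\<lambda>\<omega>. (\<lambda>(x, \<omega>). f x \<omega>) (X, \<omega>))"
    by (rule continuous_on_compose2[OF f_cont]) (auto intro!: continuous_intros)
  then show "continuous_on U (f X)" by simp
  have "continuous_on U (\<lambda>\<omega>. (\<lambda>(x, \<omega>). r x \<omega>) (X, \<omega>))"
    by (rule continuous_on_compose2[OF r_cont]) (auto intro!: continuous_intros)
  then show "continuous_on U (r X)" by simp
qed

lemma traj_solution:
  assumes u: "u \<in> controls U"
  shows "traj f x u 0 = x" "caratheodory_solution (\<lambda>s z. f z (u s)) {0..} (traj f x u)"
proof -
  have "\<exists>y. y 0 = x \<and> caratheodory_solution (\<lambda>s z. f z (u s)) {0..} y"
    using L_pos f_lip controls_in_U[OF u] less_imp_le[OF f_bound]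
    by (intro caratheodory_exists[where L = L and M = N] borel_measurable_along[OF f_cont u]) auto
  then have "traj f x u 0 = x \<and> caratheodory_solution (\<lambda>s z. f z (u s)) {0..} (traj f x u)"
    unfolding traj_def by (rule someI_ex)
  then show "traj f x u 0 = x" "caratheodory_solution (\<lambda>s z. f z (u s)) {0..} (traj f x u)"
    by auto
qed

lemma traj_continuous_on: "u \<in> controls U \<Longrightarrow> A \<subseteq> {0..} \<Longrightarrow> continuous_on A (traj f x u)"
  using caratheodory_continuous_on_atLeast[OF traj_solution(2)] continuous_on_subset by blast

lemma traj_increment:
  assumes "u \<in> controls U" "0 \<le> a" "a \<le> b"
  shows "traj f x u b - traj f x u a = integral {a..b} (\<lambda>s. f (traj f x u s) (u s))"
    "(\<lambda>s. f (traj f x u s) (u s)) integrable_on {a..b}"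
  using caratheodoryD[OF traj_solution(2)[OF assms(1)], of a b] assms by auto

lemma traj_lipschitz:
  assumes "u \<in> controls U" "0 \<le> a" "0 \<le> b"
  shows "norm (traj f x u b - traj f x u a) \<le> N * \<bar>b - a\<bar>"
  using assms less_imp_le[OF f_bound] controls_in_U[OF assms(1)]
  by (intro caratheodory_lipschitz[OF traj_solution(2)[OF assms(1)]]) auto

lemma traj_diff_le:
  assumes "u \<in> controls U" "0 \<le> t"
  shows "norm (traj f x u t - traj f y u t) \<le> norm (x - y) * exp (L * t)"
  using caratheodory_diff_le[of "\<lambda>s z. f z (u s)" t "traj f x u" "traj f y u" L t]
    traj_solution[OF assms(1)] caratheodory_subset[OF traj_solution(2)[OF assms(1)]]
    L_pos f_lip controls_in_U[OF assms(1)] assms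
  by auto

lemma traj_unique:
  assumes "u \<in> controls U" "caratheodory_solution (\<lambda>s z. f z (u s)) {0..T} y" "y 0 = x" "t \<in> {0..T}"
  shows "y t = traj f x u t"
  using caratheodory_diff_le[of "\<lambda>s z. f z (u s)" T y "traj f x u" L t]
    traj_solution[OF assms(1)] caratheodory_subset[OF traj_solution(2)[OF assms(1)], of "{0..T}"]
    L_pos f_lip controls_in_U[OF assms(1)] assms
  by auto

lemma traj_cong:
  assumes u: "u \<in> controls U" and w: "w \<in> controls U" and "\<And>s. s \<in> {0..T} \<Longrightarrow> u s = w s" "t \<in> {0..T}"
  shows "traj f x u t = traj f x w t"
proof (rule traj_unique[OF w])
  show "caratheodory_solution (\<lambda>s z. f z (w s)) {0..T} (traj f x u)"
    using assms by (intro caratheodory_cong[OF caratheodory_subset[OF traj_solution(2)[OF u]]])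
      (auto simp: is_interval_cc)
qed (use assms traj_solution in auto)

lemma concat_control:
  assumes "u \<in> controls U" "\<omega> \<in> U"
  shows "(\<lambda>t. if t \<le> T then u t else \<omega>) \<in> controls U"
proof -
  have "(\<lambda>t. if t \<le> T then u t else \<omega>) \<in> borel_measurable (lebesgue_on {0..})"
  proof (rule measurable_If)
    show "u \<in> borel_measurable (lebesgue_on {0..})" using assms by (simp add: controls_def)
    have "{x \<in> space (lebesgue_on {0..}). x \<le> T} = {0..T}" by auto
    then show "{x \<in> space (lebesgue_on {0..}). x \<le> T} \<in> sets (lebesgue_on {0..})"
      by (simp add: sets_restrict_space_iff)
  qed auto
  then show ?thesis using assms by (auto simp: controls_def)
qed

text \<open>\<open>LEAST\<close> over the reals is meaningful here because the set of hitting times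
  is closed and bounded below and therefore contains its infimum.\<close>

lemma hit_time_finite:
  assumes u: "u \<in> controls U" and t: "0 \<le> t" "traj f x u t \<in> S"
  shows "\<exists>\<Theta>\<le>t. hit_time S f x u = ereal \<Theta> \<and> 0 \<le> \<Theta> \<and> traj f x u \<Theta> \<in> S \<and>
    (\<forall>s\<ge>0. s < \<Theta> \<longrightarrow> traj f x u s \<notin> S)"
proof -
  define H where "H = {s. 0 \<le> s \<and> traj f x u s \<in> S}"
  have "closedin (top_of_set {0..}) ({0..} \<inter> traj f x u -` S)"
    by (rule continuous_closedin_preimage[OF traj_continuous_on[OF u] S(2)]) simp
  moreover have "{0..} \<inter> traj f x u -` S = H" by (auto simp: H_def)
  ultimately have "closed H" using closedin_closed_trans[OF _ closed_atLeast[of "0::real"]] by metis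
  moreover have H: "t \<in> H" "bdd_below H" using t by (auto simp: H_def bdd_below_def)
  ultimately have "Inf H \<in> H" by (intro closed_contains_Inf) auto
  moreover have le: "Inf H \<le> s" if "s \<in> H" for s using that H by (intro cInf_lower)
  ultimately have L: "(LEAST s. 0 \<le> s \<and> traj f x u s \<in> S) = Inf H"
    by (intro Least_equality) (auto simp: H_def)
  have "hit_time S f x u = ereal (Inf H)" using t L by (auto simp: hit_time_def)
  moreover have "traj f x u s \<notin> S" if "0 \<le> s" "s < Inf H" for s
    using le[of s] that by (auto simp: H_def)
  ultimately show ?thesis
    using \<open>Inf H \<in> H\<close> le[OF H(1)] by (intro exI[of _ "Inf H"]) (auto simp: H_def)
qed

lemma hit_time_eqD:
  assumes u: "u \<in> controls U" and hit: "hit_time S f x u = ereal \<Theta>"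
  shows "0 \<le> \<Theta>" "traj f x u \<Theta> \<in> S" "\<And>s. \<lbrakk>0 \<le> s; s < \<Theta>\<rbrakk> \<Longrightarrow> traj f x u s \<notin> S"
proof -
  obtain t where "0 \<le> t" "traj f x u t \<in> S" using hit by (auto simp: hit_time_def split: if_splits)
  from hit_time_finite[OF u this] show "0 \<le> \<Theta>" "traj f x u \<Theta> \<in> S" "\<And>s. \<lbrakk>0 \<le> s; s < \<Theta>\<rbrakk> \<Longrightarrow> traj f x u s \<notin> S"
    using hit by auto
qed

lemma admissible_iff:
  "u \<in> admissible U S f x \<longleftrightarrow> u \<in> controls U \<and> (\<exists>\<Theta>. hit_time S f x u = ereal \<Theta>)"
proof (cases "u \<in> controls U")
  case True
  have "hit_time S f x u \<noteq> - \<infinity>" by (simp add: hit_time_def)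
  then show ?thesis by (cases "hit_time S f x u") (auto simp: admissible_def True)
qed (simp add: admissible_def)

lemma cost_eq:
  assumes "hit_time S f x u = ereal \<Theta>"
  shows "cost S f r g x u = integral {0..\<Theta>} (\<lambda>s. r (traj f x u s) (u s)) + g (traj f x u \<Theta>)"
  using assms by (simp add: cost_def)

lemma value_fn_le_cost:
  assumes "u \<in> controls U" "hit_time S f x u = ereal \<Theta>"
  shows "value_fn U S f r g x \<le> ereal (cost S f r g x u)"
  unfolding value_fn_def using assms by (intro INF_lower) (auto simp: admissible_iff)

lemma in_closure_Compl: "x \<notin> S \<Longrightarrow> x \<in> closure (- S)"
  by (rule subsetD[OF closure_subset]) simp

lemma frontier_if_first_hit:
  assumes u: "u \<in> controls U" and x: "x \<in> closure (- S)"
    and hit: "hit_time S f x u = ereal \<Theta>"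
  shows "traj f x u \<Theta> \<in> frontier S"
proof -
  note \<Theta> = hit_time_eqD[OF u hit]
  have "traj f x u \<Theta> \<in> closure (- S)"
  proof (cases "\<Theta> = 0")
    case True
    then show ?thesis using x traj_solution(1)[OF u] by simp
  next
    case False
    show ?thesis
      unfolding closure_approachable
    proof (intro allI impI)
      fix e :: real assume "e > 0"
      define s where "s = max 0 (\<Theta> - e / (2 * N))"
      have s: "0 \<le> s" "s < \<Theta>" using \<Theta>(1) False \<open>e > 0\<close> N_pos by (auto simp: s_def)
      have "\<Theta> - s \<le> e / (2 * N)" by (simp add: s_def)
      then have "N * (\<Theta> - s) \<le> N * (e / (2 * N))" using N_pos by (intro mult_left_mono) auto
      then have "norm (traj f x u s - traj f x u \<Theta>) \<le> e / 2"
        using traj_lipschitz[OF u \<Theta>(1) s(1), of x] s N_pos by simp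
      then show "\<exists>y\<in>- S. dist y (traj f x u \<Theta>) < e"
        using \<Theta>(3)[OF s] \<open>e > 0\<close> by (intro bexI[of _ "traj f x u s"]) (auto simp: dist_norm)
    qed
  qed
  then show ?thesis using \<Theta>(2) S by (simp add: frontier_closures)
qed

section \<open>Exit times bounded by costs\<close>

lemma frontier_lipschitz:
  assumes "y \<in> frontier S" "z \<in> frontier S"
  shows "\<bar>g y - g z\<bar> \<le> G * norm (y - z)"
  using assms terminal_nbhd terminal_lip[of z y] interior_subset by blast

text \<open>The least net increase of the cost per unit of time: the running cost grows at rate at
  least \<open>r0\<close>, while an exit point reached at speed below \<open>N\<close> can lower the
  terminal cost at rate at most \<open>G * N\<close>.\<close>

definition "\<kappa> = r0 - G * N"

lemma kappa_pos: "\<kappa> > 0"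
  using terminal_const constants by (simp add: \<kappa>_def field_simps)

lemma r_integrable:
  assumes "u \<in> controls U" "0 \<le> a"
  shows "(\<lambda>s. r (traj f x u s) (u s)) integrable_on {a..b}"
  using assms by (intro integrable_along[OF r_cont] traj_continuous_on) auto

lemma r_integral_ge:
  assumes "u \<in> controls U" "0 \<le> a" "a \<le> b"
  shows "r0 * (b - a) \<le> integral {a..b} (\<lambda>s. r (traj f x u s) (u s))"
proof -
  have "integral {a..b} (\<lambda>_. r0) \<le> integral {a..b} (\<lambda>s. r (traj f x u s) (u s))"
    using assms r_lower controls_in_U[OF assms(1)] by (intro integral_le r_integrable) auto
  then show ?thesis using assms by (simp add: mult.commute)
qed

text \<open>Turns an upper bound on the cost into one on the exit time. The fixed boundary point
  \<open>z0\<close> serves to compare terminal costs.\<close>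

lemma cost_lower_bound:
  assumes u: "u \<in> controls U" and x: "x \<in> closure (- S)" and hit: "hit_time S f x u = ereal \<Theta>"
    and z0: "z0 \<in> frontier S"
  shows "\<kappa> * \<Theta> + g z0 - G * norm (x - z0) \<le> cost S f r g x u"
proof -
  note * = hit_time_eqD[OF u hit]
  define z where "z = traj f x u \<Theta>"
  have "z \<in> frontier S" unfolding z_def by (rule frontier_if_first_hit[OF u x hit])
  then have "g z0 - g z \<le> G * norm (z0 - z)" using frontier_lipschitz[OF z0, of z] by linarith
  also have "\<dots> \<le> G * (norm (x - z0) + N * \<Theta>)"
  proof (rule mult_left_mono)
    have "norm (z - x) \<le> N * \<Theta>"
      using traj_lipschitz[OF u, of 0 \<Theta> x] * traj_solution(1)[OF u] by (simp add: z_def)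
    then show "norm (z0 - z) \<le> norm (x - z0) + N * \<Theta>"
      using norm_triangle_ineq[of "z0 - x" "x - z"] by (simp add: norm_minus_commute)
  qed (use terminal_const in simp)
  finally have "g z0 - g z \<le> G * norm (x - z0) + G * N * \<Theta>" by (simp add: algebra_simps)
  moreover have "cost S f r g x u \<ge> r0 * \<Theta> + g z"
    using r_integral_ge[OF u, of 0 \<Theta> x] * by (simp add: cost_eq[OF hit] z_def)
  ultimately show ?thesis by (simp add: \<kappa>_def algebra_simps)
qed

lemma reach_set_frontier_point:
  assumes "x \<in> reach_set U S f" "x \<notin> S"
  obtains z0 where "z0 \<in> frontier S"
proof -
  obtain u where "u \<in> admissible U S f x" by (rule reach_setE[OF assms(1)])
  then obtain \<Theta> where "u \<in> controls U" "hit_time S f x u = ereal \<Theta>"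
    unfolding admissible_iff by blast
  moreover have "x \<in> closure (- S)" by (rule in_closure_Compl[OF assms(2)])
  ultimately show ?thesis using that[OF frontier_if_first_hit] by simp
qed

lemma value_fn_finite:
  assumes "x \<in> reach_set U S f" "x \<notin> S"
  shows "\<bar>value_fn U S f r g x\<bar> \<noteq> \<infinity>"
proof -
  obtain u where u: "u \<in> admissible U S f x" by (rule reach_setE[OF assms(1)])
  obtain z0 where z0: "z0 \<in> frontier S" using reach_set_frontier_point[OF assms] .
  have x: "x \<in> closure (- S)" by (rule in_closure_Compl[OF assms(2)])
  have "value_fn U S f r g x \<le> ereal (cost S f r g x u)"
    unfolding value_fn_def using u by (intro INF_lower)
  moreover have "ereal (g z0 - G * norm (x - z0)) \<le> value_fn U S f r g x"
    unfolding value_fn_def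
  proof (rule INF_greatest)
    fix u assume "u \<in> admissible U S f x"
    then obtain \<Theta> where *: "u \<in> controls U" "hit_time S f x u = ereal \<Theta>"
      by (auto simp: admissible_iff)
    have "0 \<le> \<kappa> * \<Theta>" using kappa_pos hit_time_eqD(1)[OF *] by simp
    then show "ereal (g z0 - G * norm (x - z0)) \<le> ereal (cost S f r g x u)"
      using cost_lower_bound[OF *(1) x *(2) z0] by simp
  qed
  ultimately show ?thesis by auto
qed

section \<open>Derivative bounds and second order remainders\<close>

lemma norm_Df_le:
  assumes \<omega>: "\<omega> \<in> U"
  shows "norm (Df x \<omega> *v h) \<le> L * norm h" "norm (transpose (Df x \<omega>) *v h) \<le> L * norm h"
proof -
  have *: "norm (Df x \<omega> *v h) \<le> L * norm h" for h
    using f_deriv[OF \<omega>] f_lip[OF \<omega>] by (rule lipschitz_has_derivative_norm_le)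
  then show "norm (Df x \<omega> *v h) \<le> L * norm h" .
  \<comment> \<open>The bound passes to the transpose by pairing \<open>k\<close> with itself and
    moving the matrix to the other factor.\<close>
  define k where "k = transpose (Df x \<omega>) *v h"
  have "norm k * norm k = k \<bullet> k" by (simp add: power2_norm_eq_inner[symmetric] power2_eq_square)
  also have "\<dots> = h \<bullet> (Df x \<omega> *v k)" unfolding k_def by (metis dot_lmul_matrix inner_commute transpose_matrix_vector)
  also have "\<dots> \<le> norm h * (L * norm k)"
    using norm_cauchy_schwarz[of h "Df x \<omega> *v k"] *[of k] by (meson mult_left_mono norm_ge_zero order_trans)
  finally have "norm k * norm k \<le> (L * norm h) * norm k" by (simp add: algebra_simps)
  then show "norm (transpose (Df x \<omega>) *v h) \<le> L * norm h"
    unfolding k_def[symmetric] using L_pos by (cases "k = 0") auto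
qed

lemma r_lipschitz: "\<omega> \<in> U \<Longrightarrow> \<bar>r y \<omega> - r x \<omega>\<bar> \<le> L * norm (y - x)"
  using r_lip[of \<omega> y x] norm_ge_zero[of "Dr y \<omega> - Dr x \<omega>"] by linarith

lemma norm_Dr_le:
  assumes \<omega>: "\<omega> \<in> U"
  shows "norm (Dr x \<omega>) \<le> L"
proof -
  have "norm (Dr x \<omega> \<bullet> Dr x \<omega>) \<le> L * norm (Dr x \<omega>)"
    using r_deriv[OF \<omega>, of x] r_lipschitz[OF \<omega>] by (intro lipschitz_has_derivative_norm_le) auto
  then have "norm (Dr x \<omega>) * norm (Dr x \<omega>) \<le> L * norm (Dr x \<omega>)"
    by (simp add: power2_norm_eq_inner[symmetric] power2_eq_square)
  then show ?thesis using L_pos by (cases "Dr x \<omega> = 0") auto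
qed

lemma Dr_lipschitz: "\<omega> \<in> U \<Longrightarrow> norm (Dr y \<omega> - Dr x \<omega>) \<le> L * norm (y - x)"
  using r_lip[of \<omega> y x] by linarith

text \<open>On a ball containing the segment the derivative varies by at most
  \<open>L * norm (y - x)\<close>, which yields a second order remainder without second
  derivatives.\<close>

lemma f_taylor:
  assumes \<omega>: "\<omega> \<in> U"
  shows "norm (f y \<omega> - f x \<omega> - Df x \<omega> *v (y - x)) \<le> L * (norm (y - x))\<^sup>2"
proof -
  define B where "B = cball x (norm (y - x))"
  have "norm (f y \<omega> - f x \<omega> - Df x \<omega> *v (y - x)) \<le> norm (y - x) * (L * norm (y - x))"
  proof (rule differentiable_bound_linearization[where S = B and f' = "\<lambda>x h. Df x \<omega> *v h"])
    show "x + t *\<^sub>R (y - x) \<in> B" if "t \<in> {0..1}" for t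
      using that by (auto simp: B_def dist_norm mult_left_le_one_le)
    show "((\<lambda>y. f y \<omega>) has_derivative (*v) (Df z \<omega>)) (at z within B)" for z
      using f_deriv[OF \<omega>] by (rule has_derivative_at_withinI)
    show "onorm ((*v) (Df z \<omega>) - (*v) (Df x \<omega>)) \<le> L * norm (y - x)" if "z \<in> B" for z
    proof -
      have "(*v) (Df z \<omega>) - (*v) (Df x \<omega>) = (\<lambda>h. (Df z \<omega> - Df x \<omega>) *v h)"
        by (auto simp: matrix_vector_mult_diff_rdistrib)
      moreover have "L * norm (z - x) \<le> L * norm (y - x)"
        using that L_pos by (simp add: B_def dist_norm norm_minus_commute)
      ultimately show ?thesis using Df_lip[OF \<omega>, of z x] by simp
    qed
  qed (simp add: B_def)
  then show ?thesis by (simp add: power2_eq_square algebra_simps)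
qed

lemma r_taylor:
  assumes \<omega>: "\<omega> \<in> U"
  shows "\<bar>r y \<omega> - r x \<omega> - Dr x \<omega> \<bullet> (y - x)\<bar> \<le> L * (norm (y - x))\<^sup>2"
proof -
  define B where "B = cball x (norm (y - x))"
  have "norm (r y \<omega> - r x \<omega> - Dr x \<omega> \<bullet> (y - x)) \<le> norm (y - x) * (L * norm (y - x))"
  proof (rule differentiable_bound_linearization[where S = B and f' = "\<lambda>x h. Dr x \<omega> \<bullet> h"])
    show "x + t *\<^sub>R (y - x) \<in> B" if "t \<in> {0..1}" for t
      using that by (auto simp: B_def dist_norm mult_left_le_one_le)
    show "((\<lambda>y. r y \<omega>) has_derivative (\<bullet>) (Dr z \<omega>)) (at z within B)" for z
      using r_deriv[OF \<omega>] by (rule has_derivative_at_withinI)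
    show "onorm ((\<bullet>) (Dr z \<omega>) - (\<bullet>) (Dr x \<omega>)) \<le> L * norm (y - x)" if "z \<in> B" for z
    proof (rule onorm_le)
      fix h
      have "norm (((\<bullet>) (Dr z \<omega>) - (\<bullet>) (Dr x \<omega>)) h) \<le> norm (Dr z \<omega> - Dr x \<omega>) * norm h"
        by (simp add: Cauchy_Schwarz_ineq2 flip: inner_diff_left)
      also have "\<dots> \<le> L * norm (y - x) * norm h"
      proof (rule mult_right_mono)
        have "L * norm (z - x) \<le> L * norm (y - x)"
          using that L_pos by (simp add: B_def dist_norm norm_minus_commute)
        then show "norm (Dr z \<omega> - Dr x \<omega>) \<le> L * norm (y - x)"
          using Dr_lipschitz[OF \<omega>, of z x] by simp
      qed simp
      finally show "norm (((\<bullet>) (Dr z \<omega>) - (\<bullet>) (Dr x \<omega>)) h) \<le> L * norm (y - x) * norm h" .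
    qed
  qed (simp add: B_def)
  then show ?thesis by (simp add: power2_eq_square algebra_simps)
qed

end

section \<open>Perturbation of an optimal trajectory\<close>

text \<open>Uniform constants for optimal trajectories with exit time at most \<open>Tm\<close>: a perturbation of
  size \<open>d\<close> changes the exit time by at most \<open>delay_const Tm * d\<close>.\<close>

context exit_time_problem
begin

definition "delay_const Tm = (1 + (G + L * Tm) * exp (L * Tm)) / \<kappa>"
text \<open>For perturbations of size at most 1 the trajectory is followed no longer than
  \<open>Tm + delay_const Tm\<close>.\<close>

definition "growth_const Tm = exp (L * (Tm + delay_const Tm))"
definition "reach_const Tm = growth_const Tm + N * delay_const Tm"
text \<open>The summands, in order: 1 for points far away; the Taylor remainders along the
  trajectory; the change of the costate between an early exit and \<open>T\<close>; the Hamiltonian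
  on the arc cut off by an early exit; the motion after \<open>T\<close> when the exit is late or
  missing; the curvature of the boundary and of \<open>g\<close> at the exit point.\<close>

definition "bound_const Tm c = 1 + Tm * L * (growth_const Tm)\<^sup>2 + delay_const Tm * L * growth_const Tm
  + L * N * (delay_const Tm)\<^sup>2 + delay_const Tm * L * reach_const Tm * (1 + G) + (1 + c) * (reach_const Tm)\<^sup>2"

end

text \<open>One setting for both kinds of normals: \<open>\<mu>\<close> will be 1 for
  \<open>N1\<close> and 0 for \<open>N0\<close>, where \<open>q\<close> drops out of
  \<open>p_T\<close>. The bounds \<open>P\<close>, \<open>\<sigma>\<close>, \<open>c\<close> and
  \<open>Tm\<close> are parameters so that all later constants are explicit in them.
  \<open>g_q\<close> is the supergradient inequality in the quadratic form that semiconcavity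
  supplies.\<close>

locale transported_normal = exit_time_problem +
  fixes x :: "real ^ 'd" and u :: "real \<Rightarrow> real ^ 'm" and T v \<mu> P \<sigma> c Tm :: real
    and X q \<xi> :: "real ^ 'd" and p :: "real \<Rightarrow> real ^ 'd" and \<omega>0 :: "real ^ 'm"
  assumes x: "x \<in> closure (- S)"
    and u: "u \<in> controls U" and hit: "hit_time S f x u = ereal T"
    and cost_v: "cost S f r g x u = v" and X: "X = traj f x u T" and T_le: "T \<le> Tm"
    and mu: "0 \<le> \<mu>"
    and p: "caratheodory_solution (\<lambda>t z. - (transpose (Df (traj f x u t) (u t)) *v z)
              - \<mu> *\<^sub>R Dr (traj f x u t) (u t)) {0..T} p"
    and p_T: "p T = \<mu> *\<^sub>R q - \<xi>"
    and P: "\<And>t. t \<in> {0..T} \<Longrightarrow> norm (p t) \<le> P"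
    and sigma: "0 \<le> \<sigma>" and xi: "\<And>z. z \<in> closure (- S) \<Longrightarrow> \<xi> \<bullet> (z - X) \<le> \<sigma> * (norm (z - X))\<^sup>2"
    and q: "norm q \<le> G" and c: "0 \<le> c"
    and g_q: "\<And>z. z \<in> frontier S \<Longrightarrow> g z \<le> g X + q \<bullet> (z - X) + c * (norm (z - X))\<^sup>2"
    and omega0: "\<omega>0 \<in> U" "p T \<bullet> f X \<omega>0 + \<mu> * r X \<omega>0 = 0"
    and ham: "\<And>\<omega>. \<omega> \<in> U \<Longrightarrow> 0 \<le> p T \<bullet> f X \<omega> + \<mu> * r X \<omega>"
begin

abbreviation "K \<equiv> delay_const Tm"
abbreviation "E \<equiv> growth_const Tm"
abbreviation "Z \<equiv> reach_const Tm"
abbreviation "C \<equiv> bound_const Tm c"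

lemma T_nonneg: "0 \<le> T"
  using hit_time_eqD(1)[OF u hit] .

lemma X_frontier: "X \<in> frontier S"
  unfolding X by (rule frontier_if_first_hit[OF u x hit])

lemma Tm_nonneg: "0 \<le> Tm"
  using T_nonneg T_le by simp

lemma K_pos: "K > 0"
  using kappa_pos terminal_const L_pos Tm_nonneg unfolding delay_const_def
  by (intro divide_pos_pos add_pos_nonneg mult_nonneg_nonneg add_nonneg_nonneg) auto

lemma E_pos: "E > 0" by (simp add: growth_const_def)

lemma Z_nonneg: "Z \<ge> 0"
  using E_pos N_pos K_pos by (simp add: reach_const_def)

lemma P_nonneg: "P \<ge> 0"
  using P[of T] T_nonneg norm_ge_zero order_trans by (metis atLeastAtMost_iff order_refl)

lemma xi_norm_le: "norm \<xi> \<le> P + \<mu> * G"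
proof -
  have "\<xi> = \<mu> *\<^sub>R q - p T" using p_T by simp
  then have "norm \<xi> \<le> \<mu> * norm q + norm (p T)"
    using norm_triangle_ineq4[of "\<mu> *\<^sub>R q" "p T"] mu by simp
  also have "\<dots> \<le> \<mu> * G + P" using q P[of T] T_nonneg mu by (intro add_mono mult_left_mono) auto
  finally show ?thesis by simp
qed

lemma p_deriv_norm_le:
  assumes "t \<in> {0..T}"
  shows "norm (- (transpose (Df (traj f x u t) (u t)) *v p t) - \<mu> *\<^sub>R Dr (traj f x u t) (u t)) \<le> L * (P + \<mu>)"
proof -
  have ut: "u t \<in> U" using controls_in_U[OF u] assms by auto
  have "norm (- (transpose (Df (traj f x u t) (u t)) *v p t) - \<mu> *\<^sub>R Dr (traj f x u t) (u t))
     \<le> norm (transpose (Df (traj f x u t) (u t)) *v p t) + \<mu> * norm (Dr (traj f x u t) (u t))"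
    using norm_triangle_ineq4[of "- (transpose (Df (traj f x u t) (u t)) *v p t)" "\<mu> *\<^sub>R Dr (traj f x u t) (u t)"] mu
    by simp
  also have "\<dots> \<le> L * P + \<mu> * L"
    using norm_Df_le(2)[OF ut, of "traj f x u t" "p t"] norm_Dr_le[OF ut, of "traj f x u t"] P[OF assms] L_pos mu
    by (intro add_mono mult_left_mono) (auto intro: order_trans[OF _ mult_left_mono])
  finally show ?thesis by (simp add: algebra_simps)
qed

lemma ham_lipschitz:
  assumes "\<omega> \<in> U"
  shows "\<bar>(p T \<bullet> f z \<omega> + \<mu> * r z \<omega>) - (p T \<bullet> f X \<omega> + \<mu> * r X \<omega>)\<bar> \<le> (P + \<mu>) * (L * norm (z - X))"
proof -
  have "\<bar>p T \<bullet> (f z \<omega> - f X \<omega>)\<bar> \<le> norm (p T) * norm (f z \<omega> - f X \<omega>)"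
    by (rule Cauchy_Schwarz_ineq2)
  also have "\<dots> \<le> P * (L * norm (z - X))"
    using P[of T] T_nonneg f_lip[OF assms] P_nonneg by (intro mult_mono) auto
  finally have 1: "\<bar>p T \<bullet> (f z \<omega> - f X \<omega>)\<bar> \<le> P * (L * norm (z - X))" .
  have "\<bar>\<mu> * (r z \<omega> - r X \<omega>)\<bar> \<le> \<mu> * (L * norm (z - X))"
    using r_lipschitz[OF assms, of z X] mu by (simp add: abs_mult mult_left_mono)
  with 1 show ?thesis by (simp add: algebra_simps)
qed

text \<open>The vanishing Hamiltonian turns \<xi>.f into \<mu> * (q.f + r), and q.f + r is at least
  r0 - G * N.\<close>

lemma xi_f_omega0: "\<xi> \<bullet> f X \<omega>0 \<ge> \<mu> * \<kappa>"
proof -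
  have "\<xi> \<bullet> f X \<omega>0 = \<mu> * (q \<bullet> f X \<omega>0 + r X \<omega>0)"
    using omega0(2) p_T by (simp add: inner_diff_left algebra_simps)
  moreover have "\<kappa> \<le> q \<bullet> f X \<omega>0 + r X \<omega>0"
  proof -
    have "\<bar>q \<bullet> f X \<omega>0\<bar> \<le> G * N"
      using Cauchy_Schwarz_ineq2[of q "f X \<omega>0"] q f_bound[OF omega0(1), of X]
      by (meson less_imp_le mult_mono norm_ge_zero order_trans)
    then show ?thesis using r_lower[OF omega0(1), of X] by (simp add: \<kappa>_def)
  qed
  ultimately show ?thesis using mu by (simp add: mult_left_mono)
qed

end

section \<open>Comparison with a perturbed start\<close>

locale perturbed_start = transported_normal +
  fixes y :: "real ^ 'd" and \<beta> d :: real
  assumes y: "y \<in> closure (- S)" and beta: "ereal \<beta> \<le> value_fn U S f r g y"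
    and d: "d = norm ((y, \<beta>) - (x, v))" "d \<le> 1"
begin

definition "w = (\<lambda>t. if t \<le> T then u t else \<omega>0)"

lemma w: "w \<in> controls U"
  unfolding w_def using u omega0(1) by (rule concat_control)

lemma w_in_U: "t \<ge> 0 \<Longrightarrow> w t \<in> U"
  by (rule controls_in_U[OF w])

lemma d_ge: "0 \<le> d" "norm (y - x) \<le> d" "\<bar>\<beta> - v\<bar> \<le> d"
  using norm_fst_le[of "y - x" "\<beta> - v"] norm_snd_le[of "\<beta> - v" "y - x"] by (auto simp: d(1))

lemma Kd: "0 \<le> K * d" "K * d \<le> K"
  using K_pos d_ge d(2) by (auto simp: mult_left_le)

abbreviation "y' \<equiv> traj f y w"
abbreviation "x' \<equiv> traj f x w"

lemma x'_eq: "t \<in> {0..T} \<Longrightarrow> x' t = traj f x u t"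
  by (rule traj_cong[OF w u, of T]) (auto simp: w_def)

lemma x'_T: "x' T = X"
  using x'_eq[of T] T_nonneg X by simp

text \<open>Kept apart from \<open>dev_le\<close> because its constant does not involve
  \<open>K\<close>: the constants entering the definition of \<open>K\<close> come from this
  bound.\<close>

lemma dev_le_Tm: "norm (y' t - x' t) \<le> exp (L * Tm) * d" if "0 \<le> t" "t \<le> Tm" for t
proof -
  have "norm (y' t - x' t) \<le> norm (y - x) * exp (L * t)" by (rule traj_diff_le[OF w that(1)])
  also have "\<dots> \<le> d * exp (L * Tm)" using d_ge L_pos that by (intro mult_mono) auto
  finally show ?thesis by (simp add: mult.commute)
qed

lemma dev_le: "norm (y' t - x' t) \<le> E * d" if "0 \<le> t" "t \<le> T + K * d" for t
proof -
  have "norm (y' t - x' t) \<le> norm (y - x) * exp (L * t)" by (rule traj_diff_le[OF w that(1)])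
  also have "\<dots> \<le> d * E" unfolding growth_const_def using d_ge L_pos that T_le Kd by (intro mult_mono) auto
  finally show ?thesis by (simp add: mult.commute)
qed

lemma dist_X_le: "norm (y' t - X) \<le> Z * d" if "0 \<le> t" "\<bar>t - T\<bar> \<le> K * d" for t
proof -
  have "norm (y' t - X) \<le> norm (y' t - x' t) + norm (x' t - x' T)"
    using norm_triangle_ineq[of "y' t - x' t" "x' t - x' T"] by (simp add: x'_T)
  also have "\<dots> \<le> E * d + N * (K * d)"
    using dev_le[OF that(1)] traj_lipschitz[OF w T_nonneg that(1), of x] that(2) N_pos
    by (intro add_mono) (auto intro: order_trans[OF _ mult_left_mono])
  finally show ?thesis by (simp add: reach_const_def algebra_simps)
qed

lemma cost_v': "v = integral {0..T} (\<lambda>s. r (x' s) (w s)) + g X"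
proof -
  have "integral {0..T} (\<lambda>s. r (traj f x u s) (u s)) = integral {0..T} (\<lambda>s. r (x' s) (w s))"
    using x'_eq by (intro integral_cong) (auto simp: w_def)
  then show ?thesis using cost_v cost_eq[OF hit] X by simp
qed

lemma beta_le:
  assumes "hit_time S f y w = ereal \<Theta>"
  shows "\<beta> \<le> integral {0..\<Theta>} (\<lambda>s. r (y' s) (w s)) + g (y' \<Theta>)"
  using order_trans[OF beta value_fn_le_cost[OF w assms]] by (simp add: cost_eq[OF assms])

text \<open>The adjoint equation cancels the first order variation of the running cost.\<close>

lemma duality:
  assumes t: "t \<in> {0..T}"
  shows "- (p 0 \<bullet> (y - x)) + p t \<bullet> (y' t - x' t)
     + \<mu> * (integral {0..t} (\<lambda>s. r (y' s) (w s)) - integral {0..t} (\<lambda>s. r (x' s) (w s)))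
     \<le> (P + \<mu>) * (Tm * L * E\<^sup>2) * d\<^sup>2"
proof -
  define p' where "p' = (\<lambda>s. - (transpose (Df (traj f x u s) (u s)) *v p s) - \<mu> *\<^sub>R Dr (traj f x u s) (u s))"
  define e where "e = (\<lambda>s. y' s - x' s)"
  define e' where "e' = (\<lambda>s. f (y' s) (w s) - f (x' s) (w s))"
  define h where "h = (\<lambda>s. r (y' s) (w s) - r (x' s) (w s))"
  have ie: "(\<lambda>s. f (y' s) (w s)) integrable_on {a..b}" "(\<lambda>s. f (x' s) (w s)) integrable_on {a..b}"
    if "0 \<le> a" for a b using that by (auto intro!: integrable_along[OF f_cont w] traj_continuous_on[OF w])
  have ir: "(\<lambda>s. r (y' s) (w s)) integrable_on {a..b}" "(\<lambda>s. r (x' s) (w s)) integrable_on {a..b}"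
    if "0 \<le> a" for a b by (rule r_integrable[OF w that])+
  have ih: "h integrable_on {0..t}"
    unfolding h_def using ir by (intro Henstock_Kurzweil_Integration.integrable_diff) auto
  have by_parts: "(\<lambda>s. p' s \<bullet> e s + p s \<bullet> e' s) integrable_on {0..t}"
    "p t \<bullet> e t - p 0 \<bullet> e 0 = integral {0..t} (\<lambda>s. p' s \<bullet> e s + p s \<bullet> e' s)"
  proof -
    have 1: "p' \<in> borel_measurable (lebesgue_on {0..t})"
      unfolding p'_def using caratheodoryD(2)[OF p, of 0 t] t by (intro integrable_imp_measurable) auto
    have 2: "norm (p' s) \<le> L * (P + \<mu>)" if "s \<in> {0..t}" for s
      unfolding p'_def using p_deriv_norm_le[of s] that t by auto
    have 3: "e' \<in> borel_measurable (lebesgue_on {0..t})"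
      unfolding e'_def using ie by (intro integrable_imp_measurable Henstock_Kurzweil_Integration.integrable_diff) auto
    have 4: "norm (e' s) \<le> 2 * N" if "s \<in> {0..t}" for s
      unfolding e'_def using that w_in_U[of s] f_bound[of "w s" "y' s"] f_bound[of "w s" "x' s"]
        norm_triangle_ineq4[of "f (y' s) (w s)" "f (x' s) (w s)"] by auto
    have 5: "p b - p a = integral {a..b} p'" if "0 \<le> a" "a \<le> b" "b \<le> t" for a b
      unfolding p'_def using caratheodoryD(3)[OF p, of a b] that t by auto
    have 6: "e b - e a = integral {a..b} e'" if "0 \<le> a" "a \<le> b" "b \<le> t" for a b
      unfolding e'_def e_def using traj_increment[OF w that(1,2), of y] traj_increment[OF w that(1,2), of x] that
      by (simp add: Henstock_Kurzweil_Integration.integral_diff algebra_simps)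
    from t have "0 \<le> t" by simp
    from integral_by_parts_bounded[OF this 1 2 3 4 5 6]
    show "(\<lambda>s. p' s \<bullet> e s + p s \<bullet> e' s) integrable_on {0..t}"
      "p t \<bullet> e t - p 0 \<bullet> e 0 = integral {0..t} (\<lambda>s. p' s \<bullet> e s + p s \<bullet> e' s)" by blast+
  qed
  have "- (p 0 \<bullet> e 0) + p t \<bullet> e t + \<mu> * integral {0..t} h
     = integral {0..t} (\<lambda>s. (p' s \<bullet> e s + p s \<bullet> e' s) + \<mu> * h s)"
    using Henstock_Kurzweil_Integration.integral_add[OF by_parts(1) integrable_on_mult_right[OF ih, of \<mu>]]
      by_parts(2) by simp
  also have "\<dots> \<le> integral {0..t} (\<lambda>_. (P + \<mu>) * (L * (E * d)\<^sup>2))"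
  proof (rule integral_le)
    show "(\<lambda>s. (p' s \<bullet> e s + p s \<bullet> e' s) + \<mu> * h s) integrable_on {0..t}"
      by (rule Henstock_Kurzweil_Integration.integrable_add[OF by_parts(1) integrable_on_mult_right[OF ih]])
    fix s assume s: "s \<in> {0..t}"
    then have sT: "s \<in> {0..T}" using t by auto
    have ws: "w s \<in> U" "w s = u s" "x' s = traj f x u s"
      using sT w_in_U[of s] x'_eq[OF sT] by (simp_all add: w_def)
    have eE: "norm (e s) \<le> E * d" unfolding e_def using dev_le[of s] sT Kd by auto
    then have e2: "(norm (e s))\<^sup>2 \<le> (E * d)\<^sup>2" by (intro power_mono) auto
    have "p' s \<bullet> e s = - (p s \<bullet> (Df (x' s) (w s) *v e s)) - \<mu> * (Dr (x' s) (w s) \<bullet> e s)"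
      by (simp add: p'_def ws inner_diff_left transpose_matrix_vector dot_lmul_matrix)
    \<comment> \<open>What survives are the Taylor remainders of \<open>f\<close> and
      \<open>r\<close>, each at most \<open>L * (E * d)\<^sup>2\<close>.\<close>
    then have "(p' s \<bullet> e s + p s \<bullet> e' s) + \<mu> * h s
       = p s \<bullet> (e' s - Df (x' s) (w s) *v e s) + \<mu> * (h s - Dr (x' s) (w s) \<bullet> e s)"
      by (simp add: algebra_simps)
    also have "p s \<bullet> (e' s - Df (x' s) (w s) *v e s) \<le> P * (L * (E * d)\<^sup>2)"
    proof -
      have "norm (e' s - Df (x' s) (w s) *v e s) \<le> L * (norm (e s))\<^sup>2"
        using f_taylor[OF ws(1), of "y' s" "x' s"] by (simp add: e'_def e_def)
      also have "\<dots> \<le> L * (E * d)\<^sup>2" using e2 L_pos by (intro mult_left_mono) auto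
      finally show ?thesis
        using norm_cauchy_schwarz[of "p s" "e' s - Df (x' s) (w s) *v e s"] P[OF sT] P_nonneg
        by (smt (verit) mult_mono norm_ge_zero)
    qed
    also have "\<mu> * (h s - Dr (x' s) (w s) \<bullet> e s) \<le> \<mu> * (L * (E * d)\<^sup>2)"
    proof (rule mult_left_mono[OF _ mu])
      have "h s - Dr (x' s) (w s) \<bullet> e s \<le> L * (norm (e s))\<^sup>2"
        using r_taylor[OF ws(1), of "y' s" "x' s"] by (simp add: h_def e_def)
      also have "\<dots> \<le> L * (E * d)\<^sup>2" using e2 L_pos by (intro mult_left_mono) auto
      finally show "h s - Dr (x' s) (w s) \<bullet> e s \<le> L * (E * d)\<^sup>2" .
    qed
    finally show "(p' s \<bullet> e s + p s \<bullet> e' s) + \<mu> * h s \<le> (P + \<mu>) * (L * (E * d)\<^sup>2)"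
      by (simp add: algebra_simps)
  qed auto
  also have "\<dots> = t * ((P + \<mu>) * (L * (E * d)\<^sup>2))" using t by simp
  also have "\<dots> \<le> Tm * ((P + \<mu>) * (L * (E * d)\<^sup>2))"
    using t T_le P_nonneg mu L_pos by (intro mult_right_mono) auto
  also have "\<dots> = (P + \<mu>) * (Tm * L * E\<^sup>2) * d\<^sup>2" by (simp add: power_mult_distrib)
  finally have "- (p 0 \<bullet> e 0) + p t \<bullet> e t + \<mu> * integral {0..t} h \<le> (P + \<mu>) * (Tm * L * E\<^sup>2) * d\<^sup>2" .
  moreover have "integral {0..t} h = integral {0..t} (\<lambda>s. r (y' s) (w s)) - integral {0..t} (\<lambda>s. r (x' s) (w s))"
    unfolding h_def using ir by (intro Henstock_Kurzweil_Integration.integral_diff) auto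
  ultimately show ?thesis by (simp add: e_def traj_solution(1)[OF w])
qed

text \<open>The two halves of \<mu> q - \<xi> are treated separately: the proximal inequality
  applies to \<xi> because \<open>z\<close> is a boundary point, the semiconcave bound on
  \<open>g\<close> applies to q.\<close>

lemma terminal_gap:
  assumes "z \<in> frontier S" "norm (z - X) \<le> Z * d"
  shows "- (p T \<bullet> (z - X)) + \<mu> * (g z - g X) \<le> (\<sigma> + \<mu> * c) * Z\<^sup>2 * d\<^sup>2"
proof -
  have n: "(norm (z - X))\<^sup>2 \<le> Z\<^sup>2 * d\<^sup>2"
    using power_mono[OF assms(2) norm_ge_zero, of 2] by (simp add: power_mult_distrib)
  have "z \<in> closure (- S)" using assms(1) by (simp add: frontier_closures)
  then have "\<xi> \<bullet> (z - X) \<le> \<sigma> * (norm (z - X))\<^sup>2" by (rule xi)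
  moreover have "\<mu> * (g z - g X) \<le> \<mu> * (q \<bullet> (z - X) + c * (norm (z - X))\<^sup>2)"
    using g_q[OF assms(1)] mu by (intro mult_left_mono) auto
  moreover have "p T \<bullet> (z - X) = \<mu> * (q \<bullet> (z - X)) - \<xi> \<bullet> (z - X)"
    by (simp add: p_T inner_diff_left)
  ultimately have "- (p T \<bullet> (z - X)) + \<mu> * (g z - g X) \<le> (\<sigma> + \<mu> * c) * (norm (z - X))\<^sup>2"
    by (simp add: algebra_simps)
  also have "\<dots> \<le> (\<sigma> + \<mu> * c) * (Z\<^sup>2 * d\<^sup>2)"
    using n sigma mu c by (intro mult_left_mono) auto
  finally show ?thesis by simp
qed

lemma running_cost_diff_le:
  assumes t: "0 \<le> t" "t \<le> Tm"
  shows "\<bar>integral {0..t} (\<lambda>s. r (y' s) (w s)) - integral {0..t} (\<lambda>s. r (x' s) (w s))\<bar>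
    \<le> Tm * (L * (exp (L * Tm) * d))"
proof -
  have i: "(\<lambda>s. r (y' s) (w s)) integrable_on {0..t}" "(\<lambda>s. r (x' s) (w s)) integrable_on {0..t}"
    by (rule r_integrable[OF w], simp)+
  have "norm (integral {0..t} (\<lambda>s. r (y' s) (w s) - r (x' s) (w s))) \<le> L * (exp (L * Tm) * d) * (t - 0)"
  proof (rule norm_integral_interval_le[OF Henstock_Kurzweil_Integration.integrable_diff[OF i] t(1)])
    fix s assume s: "s \<in> {0..t}"
    have "\<bar>r (y' s) (w s) - r (x' s) (w s)\<bar> \<le> L * norm (y' s - x' s)"
      using s by (intro r_lipschitz w_in_U) auto
    also have "\<dots> \<le> L * (exp (L * Tm) * d)"
      using dev_le_Tm[of s] s t L_pos by (intro mult_left_mono) auto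
    finally show "norm (r (y' s) (w s) - r (x' s) (w s)) \<le> L * (exp (L * Tm) * d)" by simp
  qed
  also have "\<dots> \<le> L * (exp (L * Tm) * d) * Tm"
    using t L_pos d_ge by (intro mult_left_mono) auto
  finally show ?thesis
    by (simp add: Henstock_Kurzweil_Integration.integral_diff[OF i] mult.commute)
qed

text \<open>Exiting earlier by \<open>T - \<Theta>\<close> saves at least
  \<open>\<kappa> * (T - \<Theta>)\<close> up to errors linear in \<open>d\<close>, whereas the cost
  from \<open>y\<close> is at least \<open>\<beta> \<ge> v - d\<close>. Dividing the collected
  errors by \<open>\<kappa>\<close> gives exactly \<open>K * d\<close>.\<close>

lemma early_hit_time:
  assumes hy: "hit_time S f y w = ereal \<Theta>" and \<Theta>: "\<Theta> \<le> T"
  shows "T - \<Theta> \<le> K * d"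
proof -
  have \<Theta>0: "0 \<le> \<Theta>" using hit_time_eqD(1)[OF w hy] .
  define z where "z = y' \<Theta>"
  have z: "z \<in> frontier S" unfolding z_def by (rule frontier_if_first_hit[OF w y hy])
  define E0 where "E0 = exp (L * Tm)"
  have zX: "norm (z - X) \<le> E0 * d + N * (T - \<Theta>)"
    using norm_triangle_ineq[of "y' \<Theta> - x' \<Theta>" "x' \<Theta> - x' T"] dev_le_Tm[OF \<Theta>0]
      traj_lipschitz[OF w T_nonneg \<Theta>0, of x] \<Theta> T_le by (simp add: z_def x'_T E0_def)
  have "g z - g X \<le> G * norm (z - X)" using frontier_lipschitz[OF z X_frontier] by simp
  also have "\<dots> \<le> G * (E0 * d + N * (T - \<Theta>))" using zX terminal_const by (intro mult_left_mono) auto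
  finally have gz: "g z - g X \<le> G * (E0 * d + N * (T - \<Theta>))" .
  have A: "integral {0..\<Theta>} (\<lambda>s. r (y' s) (w s)) - integral {0..\<Theta>} (\<lambda>s. r (x' s) (w s)) \<le> Tm * (L * (E0 * d))"
    using running_cost_diff_le[OF \<Theta>0] \<Theta> T_le by (simp add: E0_def abs_le_iff)
  have split: "integral {0..\<Theta>} (\<lambda>s. r (x' s) (w s)) + integral {\<Theta>..T} (\<lambda>s. r (x' s) (w s)) = integral {0..T} (\<lambda>s. r (x' s) (w s))"
    using \<Theta>0 \<Theta> r_integrable[OF w] by (intro Henstock_Kurzweil_Integration.integral_combine) auto
  have "\<beta> - v \<le> Tm * (L * (E0 * d)) - r0 * (T - \<Theta>) + G * (E0 * d + N * (T - \<Theta>))"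
    using beta_le[OF hy] cost_v' A split gz r_integral_ge[OF w \<Theta>0 \<Theta>, of x] by (simp add: z_def)
  then have "\<kappa> * (T - \<Theta>) \<le> d + Tm * (L * (E0 * d)) + G * (E0 * d)"
    using d_ge(3) by (simp add: \<kappa>_def algebra_simps)
  also have "\<dots> = \<kappa> * (K * d)"
  proof -
    have "\<kappa> * K = 1 + (G + L * Tm) * E0" using kappa_pos by (simp add: delay_const_def E0_def)
    then have "\<kappa> * K * d = (1 + (G + L * Tm) * E0) * d" by simp
    then show ?thesis by (simp add: algebra_simps)
  qed
  finally show ?thesis using kappa_pos by simp
qed

lemma early_hit:
  assumes hy: "hit_time S f y w = ereal \<Theta>" and \<Theta>: "\<Theta> \<le> T"
  shows "- (p 0 \<bullet> (y - x)) + \<mu> * (\<beta> - v)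
    \<le> (P + \<mu>) * (Tm * L * E\<^sup>2 + K * L * E + L * N * K\<^sup>2) * d\<^sup>2 + (\<sigma> + \<mu> * c) * Z\<^sup>2 * d\<^sup>2"
proof -
  have \<Theta>0: "0 \<le> \<Theta>" using hit_time_eqD(1)[OF w hy] .
  have time: "0 \<le> T - \<Theta>" "T - \<Theta> \<le> K * d" using early_hit_time[OF hy \<Theta>] \<Theta> by auto
  define z where "z = y' \<Theta>"
  have z: "z \<in> frontier S" unfolding z_def by (rule frontier_if_first_hit[OF w y hy])
  have zX: "norm (z - X) \<le> Z * d" unfolding z_def using dist_X_le[OF \<Theta>0] time by auto
  define A where "A = integral {0..\<Theta>} (\<lambda>s. r (y' s) (w s)) - integral {0..\<Theta>} (\<lambda>s. r (x' s) (w s))"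
  define B where "B = integral {\<Theta>..T} (\<lambda>s. r (x' s) (w s))"
  have "integral {0..\<Theta>} (\<lambda>s. r (x' s) (w s)) + B = integral {0..T} (\<lambda>s. r (x' s) (w s))"
    unfolding B_def using \<Theta>0 \<Theta> r_integrable[OF w] by (intro Henstock_Kurzweil_Integration.integral_combine) auto
  then have "\<beta> - v \<le> A - B + (g z - g X)"
    using beta_le[OF hy] cost_v' by (simp add: A_def z_def)
  then have "\<mu> * (\<beta> - v) \<le> \<mu> * (A - B + (g z - g X))" using mu by (intro mult_left_mono)
  then have 1: "\<mu> * (\<beta> - v) \<le> \<mu> * A - \<mu> * B + \<mu> * (g z - g X)" by (simp add: algebra_simps)
  have 2: "- (p 0 \<bullet> (y - x)) + p \<Theta> \<bullet> (z - x' \<Theta>) + \<mu> * A \<le> (P + \<mu>) * (Tm * L * E\<^sup>2) * d\<^sup>2"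
    using duality[of \<Theta>] \<Theta>0 \<Theta> by (simp add: A_def z_def)
  \<comment> \<open>Evaluating the costate at \<open>T\<close> instead of \<open>\<Theta>\<close>
    costs a product of two quantities of order \<open>d\<close>.\<close>
  have 3: "(p T - p \<Theta>) \<bullet> (z - x' \<Theta>) \<le> (P + \<mu>) * (K * L * E) * d\<^sup>2"
  proof -
    have "norm (p T - p \<Theta>) \<le> L * (P + \<mu>) * \<bar>T - \<Theta>\<bar>"
      using \<Theta>0 \<Theta> p_deriv_norm_le by (intro caratheodory_lipschitz[OF p]) (auto simp: is_interval_cc)
    also have "\<dots> \<le> L * (P + \<mu>) * (K * d)"
      using time L_pos P_nonneg mu by (intro mult_left_mono) auto
    finally have pd: "norm (p T - p \<Theta>) \<le> L * (P + \<mu>) * (K * d)" .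
    have "(p T - p \<Theta>) \<bullet> (z - x' \<Theta>) \<le> norm (p T - p \<Theta>) * norm (z - x' \<Theta>)"
      by (rule norm_cauchy_schwarz)
    also have "\<dots> \<le> (L * (P + \<mu>) * (K * d)) * (E * d)"
      using pd dev_le[OF \<Theta>0] \<Theta> Kd L_pos P_nonneg mu by (intro mult_mono) (auto simp: z_def)
    finally show ?thesis by (simp add: power2_eq_square algebra_simps)
  qed
  \<comment> \<open>On the arc of the unperturbed trajectory after \<open>\<Theta>\<close> only the
    sign condition \<open>ham\<close> at \<open>X\<close> is available. Moving away from
    \<open>X\<close> costs a Lipschitz error of order \<open>d\<close>, over a time of at most
    \<open>K * d\<close>.\<close>
  have 4: "- (p T \<bullet> (X - x' \<Theta>)) - \<mu> * B \<le> (P + \<mu>) * (L * N * K\<^sup>2) * d\<^sup>2"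
  proof -
    have inc: "X - x' \<Theta> = integral {\<Theta>..T} (\<lambda>s. f (x' s) (w s))"
      "(\<lambda>s. f (x' s) (w s)) integrable_on {\<Theta>..T}"
      using traj_increment[OF w \<Theta>0 \<Theta>, of x] by (auto simp: x'_T)
    have hi: "((\<lambda>s. p T \<bullet> f (x' s) (w s) + \<mu> * r (x' s) (w s)) has_integral p T \<bullet> (X - x' \<Theta>) + \<mu> * B) {\<Theta>..T}"
      unfolding inc(1) B_def
      using has_integral_linear[OF integrable_integral[OF inc(2)] bounded_linear_inner_right[of "p T"]]
        integrable_integral[OF r_integrable[OF w \<Theta>0]]
      by (intro has_integral_add has_integral_mult_right) (auto simp: o_def)
    have "(T - \<Theta>) * (- ((P + \<mu>) * (L * (N * (K * d))))) \<le> p T \<bullet> (X - x' \<Theta>) + \<mu> * B"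
    proof (rule has_integral_le[OF _ hi])
      show "((\<lambda>_. - ((P + \<mu>) * (L * (N * (K * d))))) has_integral (T - \<Theta>) * (- ((P + \<mu>) * (L * (N * (K * d)))))) {\<Theta>..T}"
        using has_integral_const_real[of "- ((P + \<mu>) * (L * (N * (K * d))))" \<Theta> T] \<Theta> by simp
      fix s assume s: "s \<in> {\<Theta>..T}"
      have ws: "w s \<in> U" using w_in_U s \<Theta>0 by auto
      have "norm (x' s - X) \<le> N * (K * d)"
        using traj_lipschitz[OF w T_nonneg, of s x] s \<Theta>0 time(2) N_pos
        by (auto simp: x'_T intro: order_trans[OF _ mult_left_mono])
      then have "(P + \<mu>) * (L * norm (x' s - X)) \<le> (P + \<mu>) * (L * (N * (K * d)))"
        using P_nonneg mu L_pos by (intro mult_left_mono) auto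
      then show "- ((P + \<mu>) * (L * (N * (K * d)))) \<le> p T \<bullet> f (x' s) (w s) + \<mu> * r (x' s) (w s)"
        using ham_lipschitz[OF ws, of "x' s"] ham[OF ws] by linarith
    qed
    moreover have "(T - \<Theta>) * ((P + \<mu>) * (L * (N * (K * d)))) \<le> (K * d) * ((P + \<mu>) * (L * (N * (K * d))))"
      using time P_nonneg mu L_pos N_pos Kd by (intro mult_right_mono) auto
    moreover have "(T - \<Theta>) * (- ((P + \<mu>) * (L * (N * (K * d))))) = - ((T - \<Theta>) * ((P + \<mu>) * (L * (N * (K * d)))))"
      by (rule mult_minus_right)
    ultimately have "- (p T \<bullet> (X - x' \<Theta>)) - \<mu> * B \<le> (K * d) * ((P + \<mu>) * (L * (N * (K * d))))"
      by linarith
    then show ?thesis by (simp add: power2_eq_square algebra_simps)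
  qed
  have "- (p T \<bullet> (z - X)) + \<mu> * (g z - g X) \<le> (\<sigma> + \<mu> * c) * Z\<^sup>2 * d\<^sup>2"
    by (rule terminal_gap[OF z zX])
  moreover have "p \<Theta> \<bullet> (z - x' \<Theta>) + (p T - p \<Theta>) \<bullet> (z - x' \<Theta>) = p T \<bullet> (z - X) + p T \<bullet> (X - x' \<Theta>)"
    by (simp add: algebra_simps)
  ultimately have "- (p 0 \<bullet> (y - x)) + \<mu> * (\<beta> - v) \<le> (P + \<mu>) * (Tm * L * E\<^sup>2) * d\<^sup>2
      + (P + \<mu>) * (K * L * E) * d\<^sup>2 + (P + \<mu>) * (L * N * K\<^sup>2) * d\<^sup>2 + (\<sigma> + \<mu> * c) * Z\<^sup>2 * d\<^sup>2"
    using 1 2 3 4 by linarith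
  then show ?thesis by (simp add: algebra_simps)
qed

lemma late_hit:
  assumes hy: "hit_time S f y w = ereal \<Theta>" and \<Theta>: "T \<le> \<Theta>" "\<Theta> \<le> T + K * d"
  shows "- (p 0 \<bullet> (y - x)) + \<mu> * (\<beta> - v)
    \<le> (P + \<mu>) * (Tm * L * E\<^sup>2 + K * L * Z) * d\<^sup>2 + (\<sigma> + \<mu> * c) * Z\<^sup>2 * d\<^sup>2"
proof -
  have \<Theta>0: "0 \<le> \<Theta>" using hit_time_eqD(1)[OF w hy] .
  define z where "z = y' \<Theta>"
  have z: "z \<in> frontier S" unfolding z_def by (rule frontier_if_first_hit[OF w y hy])
  have zX: "norm (z - X) \<le> Z * d" unfolding z_def using dist_X_le[OF \<Theta>0] \<Theta> by auto
  define A where "A = integral {0..T} (\<lambda>s. r (y' s) (w s)) - integral {0..T} (\<lambda>s. r (x' s) (w s))"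
  define B where "B = integral {T..\<Theta>} (\<lambda>s. r (y' s) (w s))"
  have "integral {0..T} (\<lambda>s. r (y' s) (w s)) + B = integral {0..\<Theta>} (\<lambda>s. r (y' s) (w s))"
    unfolding B_def using \<Theta>0 \<Theta> T_nonneg r_integrable[OF w] by (intro Henstock_Kurzweil_Integration.integral_combine) auto
  then have "\<beta> - v \<le> A + B + (g z - g X)"
    using beta_le[OF hy] cost_v' by (simp add: A_def z_def)
  then have "\<mu> * (\<beta> - v) \<le> \<mu> * (A + B + (g z - g X))" using mu by (intro mult_left_mono)
  then have 1: "\<mu> * (\<beta> - v) \<le> \<mu> * A + \<mu> * B + \<mu> * (g z - g X)" by (simp add: algebra_simps)
  have 2: "- (p 0 \<bullet> (y - x)) + p T \<bullet> (y' T - X) + \<mu> * A \<le> (P + \<mu>) * (Tm * L * E\<^sup>2) * d\<^sup>2"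
    using duality[of T] T_nonneg by (simp add: A_def x'_T)
  \<comment> \<open>After \<open>T\<close> the control is \<open>\<omega>0\<close>, whose
    Hamiltonian expression vanishes at \<open>X\<close>. Along the extra arc it is of order
    \<open>d\<close>, for a time of at most \<open>K * d\<close>.\<close>
  have 3: "p T \<bullet> (z - y' T) + \<mu> * B \<le> (P + \<mu>) * (K * L * Z) * d\<^sup>2"
  proof -
    have inc: "z - y' T = integral {T..\<Theta>} (\<lambda>s. f (y' s) (w s))"
      "(\<lambda>s. f (y' s) (w s)) integrable_on {T..\<Theta>}"
      using traj_increment[OF w T_nonneg \<Theta>(1), of y] by (auto simp: z_def)
    have hi: "((\<lambda>s. p T \<bullet> f (y' s) (w s) + \<mu> * r (y' s) (w s)) has_integral p T \<bullet> (z - y' T) + \<mu> * B) {T..\<Theta>}"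
      unfolding inc(1) B_def
      using has_integral_linear[OF integrable_integral[OF inc(2)] bounded_linear_inner_right[of "p T"]]
        integrable_integral[OF r_integrable[OF w T_nonneg]]
      by (intro has_integral_add has_integral_mult_right) (auto simp: o_def)
    \<comment> \<open>At the single time \<open>T\<close> the control \<open>w\<close> still takes
      the value \<open>u T\<close>; one point does not affect the integral.\<close>
    have hi': "((\<lambda>s. p T \<bullet> f (y' s) \<omega>0 + \<mu> * r (y' s) \<omega>0) has_integral p T \<bullet> (z - y' T) + \<mu> * B) {T..\<Theta>}"
      by (rule has_integral_spike_finite[OF _ _ hi, of "{T}"]) (auto simp: w_def)
    have "p T \<bullet> (z - y' T) + \<mu> * B \<le> (\<Theta> - T) * ((P + \<mu>) * (L * (Z * d)))"
    proof (rule has_integral_le[OF hi'])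
      show "((\<lambda>_. (P + \<mu>) * (L * (Z * d))) has_integral (\<Theta> - T) * ((P + \<mu>) * (L * (Z * d)))) {T..\<Theta>}"
        using has_integral_const_real[of "(P + \<mu>) * (L * (Z * d))" T \<Theta>] \<Theta> by simp
      fix s assume s: "s \<in> {T..\<Theta>}"
      have "norm (y' s - X) \<le> Z * d" using dist_X_le[of s] s T_nonneg \<Theta> by auto
      then have "(P + \<mu>) * (L * norm (y' s - X)) \<le> (P + \<mu>) * (L * (Z * d))"
        using P_nonneg mu L_pos by (intro mult_left_mono) auto
      then show "p T \<bullet> f (y' s) \<omega>0 + \<mu> * r (y' s) \<omega>0 \<le> (P + \<mu>) * (L * (Z * d))"
        using ham_lipschitz[OF omega0(1), of "y' s"] omega0(2) by linarith
    qed
    also have "\<dots> \<le> (K * d) * ((P + \<mu>) * (L * (Z * d)))"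
      using \<Theta> P_nonneg mu L_pos Z_nonneg d_ge by (intro mult_right_mono) auto
    finally show ?thesis by (simp add: power2_eq_square algebra_simps)
  qed
  have "- (p T \<bullet> (z - X)) + \<mu> * (g z - g X) \<le> (\<sigma> + \<mu> * c) * Z\<^sup>2 * d\<^sup>2"
    by (rule terminal_gap[OF z zX])
  moreover have "p T \<bullet> (y' T - X) + p T \<bullet> (z - y' T) = p T \<bullet> (z - X)"
    by (simp add: algebra_simps)
  ultimately have "- (p 0 \<bullet> (y - x)) + \<mu> * (\<beta> - v) \<le> (P + \<mu>) * (Tm * L * E\<^sup>2) * d\<^sup>2
      + (P + \<mu>) * (K * L * Z) * d\<^sup>2 + (\<sigma> + \<mu> * c) * Z\<^sup>2 * d\<^sup>2"
    using 1 2 3 by linarith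
  then show ?thesis by (simp add: algebra_simps)
qed

text \<open>Here \<open>V\<close> may exceed its linearisation by a large amount; instead, staying outside \<open>S\<close> for the time
  \<open>K * d\<close> while moving along \<open>f X \<omega>0\<close> forces \<open>\<xi> \<bullet> (y' T - X)\<close> to be very negative.\<close>

lemma no_hit:
  assumes no: "\<And>s. \<lbrakk>0 \<le> s; s \<le> T + K * d\<rbrakk> \<Longrightarrow> y' s \<notin> S"
  shows "- (p 0 \<bullet> (y - x)) + \<mu> * (\<beta> - v)
    \<le> (P + \<mu>) * (Tm * L * E\<^sup>2 + K * L * Z * (1 + G)) * d\<^sup>2 + \<sigma> * Z\<^sup>2 * d\<^sup>2"
proof -
  define E0 where "E0 = exp (L * Tm)"
  define s1 where "s1 = T + K * d"
  have s1: "0 \<le> s1" "T \<le> s1" using T_nonneg Kd by (auto simp: s1_def)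
  define z where "z = y' s1"
  have zX: "norm (z - X) \<le> Z * d" unfolding z_def using dist_X_le[OF s1(1)] Kd by (auto simp: s1_def)
  have "z \<in> closure (- S)" unfolding z_def using no[of s1] s1 by (intro in_closure_Compl) (auto simp: s1_def)
  then have "\<xi> \<bullet> (z - X) \<le> \<sigma> * (norm (z - X))\<^sup>2" by (rule xi)
  also have "\<dots> \<le> \<sigma> * (Z\<^sup>2 * d\<^sup>2)"
    using power_mono[OF zX norm_ge_zero, of 2] sigma by (intro mult_left_mono) (auto simp: power_mult_distrib)
  finally have 1: "\<xi> \<bullet> (z - X) \<le> \<sigma> * (Z\<^sup>2 * d\<^sup>2)" .
  \<comment> \<open>Up to a Lipschitz error the velocity along \<open>\<xi>\<close> is at least
    \<open>\<mu> * \<kappa>\<close> throughout the delay, so the displacement along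
    \<open>\<xi>\<close> is of first order in \<open>d\<close>.\<close>
  have 2: "(K * d) * (\<mu> * \<kappa> - norm \<xi> * (L * (Z * d))) \<le> \<xi> \<bullet> (z - y' T)"
  proof -
    have inc: "z - y' T = integral {T..s1} (\<lambda>s. f (y' s) (w s))"
      "(\<lambda>s. f (y' s) (w s)) integrable_on {T..s1}"
      using traj_increment[OF w T_nonneg s1(2), of y] by (auto simp: z_def)
    have hi: "((\<lambda>s. \<xi> \<bullet> f (y' s) (w s)) has_integral \<xi> \<bullet> (z - y' T)) {T..s1}"
      unfolding inc(1)
      using has_integral_linear[OF integrable_integral[OF inc(2)] bounded_linear_inner_right[of \<xi>]]
      by (simp add: o_def)
    have hi': "((\<lambda>s. \<xi> \<bullet> f (y' s) \<omega>0) has_integral \<xi> \<bullet> (z - y' T)) {T..s1}"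
      by (rule has_integral_spike_finite[OF _ _ hi, of "{T}"]) (auto simp: w_def)
    show ?thesis
    proof (rule has_integral_le[OF _ hi'])
      show "((\<lambda>_. \<mu> * \<kappa> - norm \<xi> * (L * (Z * d))) has_integral (K * d) * (\<mu> * \<kappa> - norm \<xi> * (L * (Z * d)))) {T..s1}"
        using has_integral_const_real[of "\<mu> * \<kappa> - norm \<xi> * (L * (Z * d))" T s1] s1 by (simp add: s1_def)
      fix s assume s: "s \<in> {T..s1}"
      have "norm (y' s - X) \<le> Z * d" using dist_X_le[of s] s T_nonneg by (auto simp: s1_def)
      then have "norm (f (y' s) \<omega>0 - f X \<omega>0) \<le> L * (Z * d)"
        using f_lip[OF omega0(1), of "y' s" X] L_pos by (auto intro: order_trans[OF _ mult_left_mono])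
      then have "norm \<xi> * norm (f (y' s) \<omega>0 - f X \<omega>0) \<le> norm \<xi> * (L * (Z * d))"
        by (intro mult_left_mono) auto
      then have "\<bar>\<xi> \<bullet> (f (y' s) \<omega>0 - f X \<omega>0)\<bar> \<le> norm \<xi> * (L * (Z * d))"
        using Cauchy_Schwarz_ineq2 order_trans by blast
      then show "\<mu> * \<kappa> - norm \<xi> * (L * (Z * d)) \<le> \<xi> \<bullet> f (y' s) \<omega>0"
        using xi_f_omega0 by (simp add: inner_diff_right)
    qed
  qed
  have dev: "norm (y' T - X) \<le> E0 * d" using dev_le_Tm[OF T_nonneg T_le] by (simp add: x'_T E0_def)
  have 3: "- (\<mu> * (integral {0..T} (\<lambda>s. r (y' s) (w s)) - integral {0..T} (\<lambda>s. r (x' s) (w s)))) \<le> \<mu> * (Tm * (L * (E0 * d)))"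
  proof -
    have "integral {0..T} (\<lambda>s. r (x' s) (w s)) - integral {0..T} (\<lambda>s. r (y' s) (w s)) \<le> Tm * (L * (E0 * d))"
      using running_cost_diff_le[OF T_nonneg T_le] by (simp add: E0_def abs_le_iff)
    then show ?thesis using mu by (simp add: mult_left_mono flip: mult_minus_right)
  qed
  have 4: "- (p 0 \<bullet> (y - x)) + p T \<bullet> (y' T - X)
     + \<mu> * (integral {0..T} (\<lambda>s. r (y' s) (w s)) - integral {0..T} (\<lambda>s. r (x' s) (w s)))
     \<le> (P + \<mu>) * (Tm * L * E\<^sup>2) * d\<^sup>2"
    using duality[of T] T_nonneg by (simp add: x'_T)
  have 5: "- (p T \<bullet> (y' T - X)) \<le> \<xi> \<bullet> (y' T - X) + \<mu> * (G * (E0 * d))"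
  proof -
    have "\<bar>q \<bullet> (y' T - X)\<bar> \<le> norm q * norm (y' T - X)" by (rule Cauchy_Schwarz_ineq2)
    also have "\<dots> \<le> G * (E0 * d)" using q dev terminal_const by (intro mult_mono) auto
    finally have "\<mu> * (- (q \<bullet> (y' T - X))) \<le> \<mu> * (G * (E0 * d))" using mu by (intro mult_left_mono) auto
    then show ?thesis by (simp add: p_T inner_diff_left)
  qed
  have 6: "\<mu> * (\<beta> - v) \<le> \<mu> * d" using d_ge mu by (intro mult_left_mono) auto
  have 7: "\<xi> \<bullet> (y' T - X) = \<xi> \<bullet> (z - X) - \<xi> \<bullet> (z - y' T)" by (simp add: algebra_simps)
  \<comment> \<open>The definition of \<open>delay_const\<close> makes this an identity: the
    displacement along \<open>\<xi>\<close> offsets the first order errors from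
    \<open>\<beta> - v\<close>, from \<open>q\<close> and from the running cost.\<close>
  have 8: "\<mu> * d + \<mu> * (G * (E0 * d)) + \<mu> * (Tm * (L * (E0 * d))) = (K * d) * (\<mu> * \<kappa>)"
    using kappa_pos by (simp add: delay_const_def E0_def field_simps)
  have 9: "(K * d) * (norm \<xi> * (L * (Z * d))) \<le> (P + \<mu>) * (K * L * Z * (1 + G)) * d\<^sup>2"
  proof -
    have "(P + \<mu>) * (1 + G) = (P + \<mu> * G) + \<mu> + G * P" by (simp add: algebra_simps)
    then have "norm \<xi> \<le> (P + \<mu>) * (1 + G)"
      using xi_norm_le mu mult_nonneg_nonneg[OF terminal_const(1) P_nonneg] by linarith
    then have "(K * d) * (norm \<xi> * (L * (Z * d))) \<le> (K * d) * (((P + \<mu>) * (1 + G)) * (L * (Z * d)))"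
      using Kd Z_nonneg L_pos d_ge by (intro mult_left_mono mult_right_mono) auto
    then show ?thesis by (simp add: power2_eq_square algebra_simps)
  qed
  have "(K * d) * (\<mu> * \<kappa> - norm \<xi> * (L * (Z * d))) = (K * d) * (\<mu> * \<kappa>) - (K * d) * (norm \<xi> * (L * (Z * d)))"
    by (simp add: algebra_simps)
  then have "- (p 0 \<bullet> (y - x)) + \<mu> * (\<beta> - v) \<le> (P + \<mu>) * (Tm * L * E\<^sup>2) * d\<^sup>2
      + (P + \<mu>) * (K * L * Z * (1 + G)) * d\<^sup>2 + \<sigma> * (Z\<^sup>2 * d\<^sup>2)"
    using 1 2 3 4 5 6 7 8 9 by linarith
  then show ?thesis by (simp add: algebra_simps)
qed

lemma perturbation_bound: "- (p 0 \<bullet> (y - x)) + \<mu> * (\<beta> - v) \<le> (P + \<mu> + \<sigma>) * C * d\<^sup>2"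
proof -
  \<comment> \<open>Each case of the exit needs only some of the nonnegative summands of
    \<open>C\<close>. With the summands as atoms the comparison becomes linear.\<close>
  define a1 a2 a3 a4 a5 a6 where a: "a1 = Tm * L * E\<^sup>2" "a2 = K * L * E" "a3 = L * N * K\<^sup>2"
    "a4 = K * L * Z" "a5 = K * L * Z * G" "a6 = Z\<^sup>2"
  have a0: "a1 \<ge> 0" "a2 \<ge> 0" "a3 \<ge> 0" "a4 \<ge> 0" "a5 \<ge> 0" "a6 \<ge> 0"
    using Tm_nonneg L_pos K_pos E_pos N_pos Z_nonneg terminal_const by (auto simp: a)
  have C: "C = 1 + a1 + a2 + a3 + a4 + a5 + a6 + c * a6"
    by (simp add: bound_const_def a algebra_simps)
  have bd: "(P + \<mu>) * b * d\<^sup>2 + (\<sigma> + \<mu> * c) * a6 * d\<^sup>2 \<le> (P + \<mu> + \<sigma>) * C * d\<^sup>2" if "b \<le> a1 + a2 + a3 + a4 + a5" for b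
  proof -
    have "(P + \<mu>) * b \<le> (P + \<mu>) * (a1 + a2 + a3 + a4 + a5)"
      using that P_nonneg mu by (intro mult_left_mono) auto
    also have "\<dots> \<le> (P + \<mu> + \<sigma>) * (a1 + a2 + a3 + a4 + a5)"
      using a0 sigma by (intro mult_right_mono) auto
    finally have 1: "(P + \<mu>) * b \<le> (P + \<mu> + \<sigma>) * (a1 + a2 + a3 + a4 + a5)" .
    have "\<sigma> + \<mu> * c \<le> (P + \<mu> + \<sigma>) * (1 + c)"
      using P_nonneg mu sigma c by (simp add: algebra_simps add_nonneg_nonneg)
    then have "(\<sigma> + \<mu> * c) * a6 \<le> ((P + \<mu> + \<sigma>) * (1 + c)) * a6" using a0 by (intro mult_right_mono)
    with 1 have "(P + \<mu>) * b + (\<sigma> + \<mu> * c) * a6 \<le> (P + \<mu> + \<sigma>) * C"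
      using P_nonneg mu sigma by (simp add: C algebra_simps)
    then have "((P + \<mu>) * b + (\<sigma> + \<mu> * c) * a6) * d\<^sup>2 \<le> ((P + \<mu> + \<sigma>) * C) * d\<^sup>2"
      by (intro mult_right_mono) auto
    then show ?thesis by (simp add: algebra_simps)
  qed
  show ?thesis
  proof (cases "\<exists>s. 0 \<le> s \<and> s \<le> T + K * d \<and> y' s \<in> S")
    case True
    then obtain \<Theta> where \<Theta>: "\<Theta> \<le> T + K * d" "hit_time S f y w = ereal \<Theta>"
      using hit_time_finite[OF w] by (meson order_trans)
    show ?thesis
    proof (cases "\<Theta> \<le> T")
      case True
      from early_hit[OF \<Theta>(2) True] bd[of "a1 + a2 + a3"] a0 show ?thesis by (simp add: a)
    next
      case False
      from late_hit[OF \<Theta>(2) _ \<Theta>(1)] False bd[of "a1 + a4"] a0 show ?thesis by (simp add: a)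
    qed
  next
    case False
    then have "- (p 0 \<bullet> (y - x)) + \<mu> * (\<beta> - v)
      \<le> (P + \<mu>) * (Tm * L * E\<^sup>2 + K * L * Z * (1 + G)) * d\<^sup>2 + \<sigma> * Z\<^sup>2 * d\<^sup>2"
      by (intro no_hit) auto
    also have "\<sigma> * Z\<^sup>2 * d\<^sup>2 \<le> (\<sigma> + \<mu> * c) * Z\<^sup>2 * d\<^sup>2"
      using mu c by (intro mult_right_mono) auto
    finally show ?thesis using bd[of "a1 + a4 + a5"] a0 by (simp add: a algebra_simps)
  qed
qed

end

context transported_normal
begin

lemma C_ge_1: "C \<ge> 1"
  using Tm_nonneg L_pos K_pos E_pos N_pos Z_nonneg terminal_const c
  unfolding bound_const_def by (simp add: add_nonneg_nonneg)

text \<open>Beyond distance 1 the Cauchy-Schwarz bound, linear in the distance, is already dominated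
  by the quadratic one; the summand 1 in \<open>bound_const\<close> ensures this.\<close>

lemma hypo_bound:
  assumes "(y, \<beta>) \<in> hypo S (value_fn U S f r g)"
  shows "(- p 0, \<mu>) \<bullet> ((y, \<beta>) - (x, v)) \<le> (P + \<mu> + \<sigma>) * C * (norm ((y, \<beta>) - (x, v)))\<^sup>2"
proof (cases "norm ((y, \<beta>) - (x, v)) \<le> 1")
  case True
  interpret perturbed_start U S f r g Df Dr N L r0 \<rho>0 G Nb x u T v \<mu> P \<sigma> c Tm X q \<xi> p \<omega>0 y \<beta>
    "norm ((y, \<beta>) - (x, v))"
    using assms True by unfold_locales (auto simp: hypo_def)
  show ?thesis using perturbation_bound by simp
next
  case False
  define d where "d = norm ((y, \<beta>) - (x, v))"
  have d: "d \<ge> 1" "norm (y - x) \<le> d" "\<bar>\<beta> - v\<bar> \<le> d"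
    using False norm_fst_le[of "y - x" "\<beta> - v"] norm_snd_le[of "\<beta> - v" "y - x"] by (auto simp: d_def)
  have "- (p 0 \<bullet> (y - x)) \<le> norm (p 0) * norm (y - x)"
    using Cauchy_Schwarz_ineq2[of "p 0" "y - x"] by linarith
  also have "\<dots> \<le> P * d" using P[of 0] T_nonneg d P_nonneg by (intro mult_mono) auto
  finally have "(- p 0, \<mu>) \<bullet> ((y, \<beta>) - (x, v)) \<le> P * d + \<mu> * (\<beta> - v)" by simp
  also have "\<mu> * (\<beta> - v) \<le> \<mu> * d" using d mu by (intro mult_left_mono) auto
  also have "P * d + \<mu> * d \<le> (P + \<mu> + \<sigma>) * d" using sigma d by (simp add: algebra_simps)
  also have "\<dots> \<le> (P + \<mu> + \<sigma>) * (C * d\<^sup>2)"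
  proof (rule mult_left_mono)
    have "1 * (d * 1) \<le> C * (d * d)" using C_ge_1 d by (intro mult_mono) auto
    then show "d \<le> C * d\<^sup>2" by (simp add: power2_eq_square)
  qed (use P_nonneg mu sigma in auto)
  finally show ?thesis by (simp add: d_def mult.assoc)
qed

end

section \<open>Transported normals\<close>

lemma SUP_eq_0_iff:
  fixes \<phi> :: "'a::topological_space \<Rightarrow> real"
  assumes "compact A" "A \<noteq> {}" "continuous_on A \<phi>"
  shows "(SUP \<omega>\<in>A. \<phi> \<omega>) = 0 \<longleftrightarrow> (\<forall>\<omega>\<in>A. \<phi> \<omega> \<le> 0) \<and> (\<exists>\<omega>\<in>A. \<phi> \<omega> = 0)"
proof -
  obtain \<omega> where \<omega>: "\<omega> \<in> A" "\<And>\<omega>'. \<omega>' \<in> A \<Longrightarrow> \<phi> \<omega>' \<le> \<phi> \<omega>"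
    using continuous_attains_sup[OF assms] by blast
  then have "(SUP \<omega>\<in>A. \<phi> \<omega>) = \<phi> \<omega>" by (intro cSup_eq_maximum) auto
  then show ?thesis using \<omega> by (metis order_antisym)
qed

context exit_time_problem
begin

lemma hamiltonian_eq_0_iff:
  "hamiltonian U f r X p = 0 \<longleftrightarrow>
     (\<forall>\<omega>\<in>U. 0 \<le> p \<bullet> f X \<omega> + r X \<omega>) \<and> (\<exists>\<omega>\<in>U. p \<bullet> f X \<omega> + r X \<omega> = 0)"
proof -
  have "continuous_on U (\<lambda>\<omega>. - (p \<bullet> f X \<omega>) - r X \<omega>)"
    by (intro continuous_intros continuous_on_f continuous_on_r)
  from SUP_eq_0_iff[OF U(2,1) this] show ?thesis
    unfolding hamiltonian_def by (smt (verit, best))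
qed

lemma inner_f_eq_0_iff:
  "(SUP \<omega>\<in>U. \<xi> \<bullet> f X \<omega>) = 0 \<longleftrightarrow> (\<forall>\<omega>\<in>U. \<xi> \<bullet> f X \<omega> \<le> 0) \<and> (\<exists>\<omega>\<in>U. \<xi> \<bullet> f X \<omega> = 0)"
  by (intro SUP_eq_0_iff U continuous_intros continuous_on_f)

lemma inner_f_pos_iff: "(SUP \<omega>\<in>U. \<xi> \<bullet> f X \<omega>) > 0 \<longleftrightarrow> (\<exists>\<omega>\<in>U. \<xi> \<bullet> f X \<omega> > 0)"
proof -
  have "compact ((\<lambda>\<omega>. \<xi> \<bullet> f X \<omega>) ` U)"
    using U by (intro compact_continuous_image continuous_intros continuous_on_f)
  then have "bdd_above ((\<lambda>\<omega>. \<xi> \<bullet> f X \<omega>) ` U)"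
    by (intro bounded_imp_bdd_above compact_imp_bounded)
  then show ?thesis using U by (intro less_cSUP_iff)
qed

lemma superdiff_frontier_norm_le:
  assumes "X \<in> frontier S" "q \<in> superdiff g X"
  shows "norm q \<le> G"
  using assms terminal_nbhd terminal_lip terminal_const by (intro superdiff_norm_le[where A = Nb]) auto

text \<open>Within distance \<open>e\<close> the semiconcave bound is uniform, since the boundary
  points in the ball form a compact set. Farther away the Lipschitz bounds on \<open>g\<close> and
  \<open>q\<close> give \<open>2 * G * n\<close>, at most
  \<open>(2 * G / e) * n\<^sup>2\<close>.\<close>

lemma semiconcave_frontier:
  obtains c where "c \<ge> 0"
    "\<And>X q z. \<lbrakk>X \<in> frontier S; norm (X - x0) \<le> R; q \<in> superdiff g X; z \<in> frontier S\<rbrakk> \<Longrightarrow>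
       g z \<le> g X + q \<bullet> (z - X) + c * (norm (z - X))\<^sup>2"
proof -
  have "compact (frontier S \<inter> cball x0 R)" by (simp add: closed_Int_compact)
  then obtain e c where ec: "e > 0" "c \<ge> 0"
    "\<And>X q z. \<lbrakk>X \<in> frontier S \<inter> cball x0 R; q \<in> superdiff g X; norm (z - X) < e\<rbrakk> \<Longrightarrow>
       g z \<le> g X + q \<bullet> (z - X) + c * (norm (z - X))\<^sup>2"
    using locally_semiconcave_uniform[OF g_semiconcave] by blast
  have Ge: "2 * G / e \<ge> 0" using ec terminal_const by simp
  have "g z \<le> g X + q \<bullet> (z - X) + (c + 2 * G / e) * (norm (z - X))\<^sup>2"
    if X: "X \<in> frontier S" "norm (X - x0) \<le> R" and q: "q \<in> superdiff g X" and z: "z \<in> frontier S" for X q z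
  proof (cases "norm (z - X) < e")
    case True
    have "X \<in> frontier S \<inter> cball x0 R" using X by (simp add: dist_norm norm_minus_commute)
    from ec(3)[OF this q True] have "g z \<le> g X + q \<bullet> (z - X) + c * (norm (z - X))\<^sup>2" .
    moreover have "c * (norm (z - X))\<^sup>2 \<le> (c + 2 * G / e) * (norm (z - X))\<^sup>2"
      using Ge by (intro mult_right_mono) auto
    ultimately show ?thesis by linarith
  next
    case False
    define n where "n = norm (z - X)"
    have n: "n \<ge> e" using False by (simp add: n_def)
    have "g z - g X \<le> G * n" using frontier_lipschitz[OF z X(1)] by (simp add: n_def)
    moreover have "\<bar>q \<bullet> (z - X)\<bar> \<le> G * n"
      using Cauchy_Schwarz_ineq2[of q "z - X"] superdiff_frontier_norm_le[OF X(1) q]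
      by (smt (verit) mult_right_mono n_def norm_ge_zero)
    moreover have "2 * (G * n) \<le> (c + 2 * G / e) * n\<^sup>2"
    proof -
      have "2 * (G * n) = (2 * G / e) * (e * n)" using ec(1) by simp
      also have "\<dots> \<le> (2 * G / e) * (n * n)" using n ec(1) Ge by (intro mult_left_mono mult_right_mono) auto
      also have "\<dots> \<le> (c + 2 * G / e) * (n * n)" using ec(2) by (intro mult_right_mono) auto
      finally show ?thesis by (simp add: power2_eq_square)
    qed
    ultimately show ?thesis unfolding n_def[symmetric] by linarith
  qed
  moreover have "c + 2 * G / e \<ge> 0" using ec Ge by simp
  ultimately show ?thesis using that by blast
qed

text \<open>The values 1 and 0 of \<open>\<mu>\<close> give the equations of
  \<open>N1_dagger\<close> and \<open>N0_dagger\<close>.\<close>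

definition adjoint :: "real ^ 'd \<Rightarrow> (real \<Rightarrow> real ^ 'm) \<Rightarrow> real \<Rightarrow> real \<Rightarrow> real ^ 'd \<Rightarrow> real ^ 'd" where
  "adjoint x u \<mu> = (\<lambda>t z. - (transpose (Df (traj f x u t) (u t)) *v z) - \<mu> *\<^sub>R Dr (traj f x u t) (u t))"

lemma adjoint_norm_le:
  assumes "u \<in> controls U" "0 \<le> t" "0 \<le> \<mu>"
  shows "norm (adjoint x u \<mu> t z) \<le> \<mu> * L + L * norm z"
proof -
  have ut: "u t \<in> U" using controls_in_U assms by blast
  have "norm (adjoint x u \<mu> t z) \<le> norm (transpose (Df (traj f x u t) (u t)) *v z) + \<mu> * norm (Dr (traj f x u t) (u t))"
    unfolding adjoint_def
    using norm_triangle_ineq4[of "- (transpose (Df (traj f x u t) (u t)) *v z)" "\<mu> *\<^sub>R Dr (traj f x u t) (u t)"] assms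
    by simp
  also have "\<dots> \<le> L * norm z + \<mu> * L"
    using norm_Df_le(2)[OF ut] norm_Dr_le[OF ut] assms by (intro add_mono mult_left_mono) auto
  finally show ?thesis by simp
qed

lemma adjoint_exists:
  assumes u: "u \<in> controls U" and "0 \<le> T" "0 \<le> \<mu>"
  obtains p where "p T = pT" "caratheodory_solution (adjoint x u \<mu>) {0..T} p"
proof (rule caratheodory_terminal_exists[OF L_pos assms(2), where F = "adjoint x u \<mu>" and M = "\<mu> * L" and pT = pT])
  fix y :: "real \<Rightarrow> real ^ 'd" assume y: "continuous_on {0..T} y"
  have tc: "continuous_on {0..T} (traj f x u)" by (rule traj_continuous_on[OF u]) simp
  have m1: "(\<lambda>s. transpose (Df (traj f x u s) (u s)) *v y s) \<in> borel_measurable (lebesgue_on {0..T})"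
  proof -
    have 1: "(\<lambda>s. (Df (traj f x u s) (u s), y s)) \<in> borel_measurable (lebesgue_on {0..T})"
      by (intro borel_measurable_Pair borel_measurable_along[OF Df_cont u tc]
          continuous_imp_measurable_on_sets_lebesgue[OF y]) auto
    have 2: "continuous_on UNIV (\<lambda>(A :: real ^ 'd ^ 'd, z). transpose A *v z)"
      by (auto simp: matrix_vector_mult_def transpose_def case_prod_beta intro!: continuous_intros)
    from measurable_compose[OF 1 borel_measurable_continuous_onI[OF 2]] show ?thesis by simp
  qed
  have m: "(\<lambda>s. adjoint x u \<mu> s (y s)) \<in> borel_measurable (lebesgue_on {0..T})"
    unfolding adjoint_def
    using m1 by (intro borel_measurable_diff borel_measurable_uminus borel_measurable_scaleR borel_measurable_along[OF Dr_cont u tc]) auto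
  obtain B where B: "\<And>s. s \<in> {0..T} \<Longrightarrow> norm (y s) \<le> B"
    using compact_imp_bounded[OF compact_continuous_image[OF y compact_Icc]] by (meson bounded_iff imageI)
  have "norm (adjoint x u \<mu> s (y s)) \<le> \<mu> * L + L * B" if "s \<in> {0..T}" for s
    using adjoint_norm_le[OF u, of s \<mu> x "y s"] B[OF that] that assms L_pos
    by (smt (verit) atLeastAtMost_iff mult_left_mono)
  then show "(\<lambda>s. adjoint x u \<mu> s (y s)) integrable_on {0..T}"
    using bounded_measurable_absolutely_integrable[OF m] set_lebesgue_integral_eq_integral(1) by blast
next
  fix s v w assume s: "s \<in> {0..T}"
  have "adjoint x u \<mu> s v - adjoint x u \<mu> s w = - (transpose (Df (traj f x u s) (u s)) *v (v - w))"
    by (simp add: adjoint_def matrix_vector_mult_diff_distrib)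
  then show "norm (adjoint x u \<mu> s v - adjoint x u \<mu> s w) \<le> L * norm (v - w)"
    using norm_Df_le(2)[OF controls_in_U[OF u]] s by simp
  show "norm (adjoint x u \<mu> s 0) \<le> \<mu> * L" using adjoint_norm_le[OF u, of s \<mu> x 0] s assms by simp
qed (use that in auto)

lemma optimalD:
  assumes "u \<in> optimal_controls U S f r g x"
  shows "u \<in> controls U" "\<exists>T. hit_time S f x u = ereal T"
    "cost S f r g x u = real_of_ereal (value_fn U S f r g x)" "ereal (cost S f r g x u) = value_fn U S f r g x"
proof -
  have *: "u \<in> admissible U S f x" "ereal (cost S f r g x u) = value_fn U S f r g x"
    using assms by (auto simp: optimal_controls_def)
  then show "u \<in> controls U" "\<exists>T. hit_time S f x u = ereal T" by (auto simp: admissible_iff)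
  show "cost S f r g x u = real_of_ereal (value_fn U S f r g x)" using *(2) by (metis real_of_ereal.simps(1))
  show "ereal (cost S f r g x u) = value_fn U S f r g x" by (rule *(2))
qed

lemma adjoint_growth:
  assumes u: "u \<in> controls U" and T: "0 \<le> T" "T \<le> Tm" and "0 \<le> \<mu>"
    and p: "caratheodory_solution (adjoint x u \<mu>) {0..T} p" and t: "t \<in> {0..T}"
  shows "norm (p t) \<le> (norm (p T) + \<mu> * L * Tm) * exp (L * Tm)"
    "norm (p t) \<le> (norm (p 0) + \<mu> * L * Tm) * exp (L * Tm)"
proof -
  have le: "norm (adjoint x u \<mu> s (p s)) \<le> \<mu> * L + L * norm (p s)" if "s \<in> {0..T}" for s
    using adjoint_norm_le[OF u] that assms by auto
  have "norm (p t) \<le> (norm (p T) + \<mu> * L * T) * exp (L * (T - t))"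
    using le t L_pos assms by (intro caratheodory_growth_backward[OF p]) auto
  also have "\<dots> \<le> (norm (p T) + \<mu> * L * Tm) * exp (L * Tm)"
    using t L_pos assms by (intro mult_mono add_mono) (auto intro: add_nonneg_nonneg mult_left_mono)
  finally show "norm (p t) \<le> (norm (p T) + \<mu> * L * Tm) * exp (L * Tm)" .
  have "norm (p t) \<le> (norm (p 0) + \<mu> * L * T) * exp (L * t)"
    using le t L_pos assms by (intro caratheodory_growth[OF p]) auto
  also have "\<dots> \<le> (norm (p 0) + \<mu> * L * Tm) * exp (L * Tm)"
    using t L_pos assms by (intro mult_mono add_mono) (auto intro: add_nonneg_nonneg mult_left_mono)
  finally show "norm (p t) \<le> (norm (p 0) + \<mu> * L * Tm) * exp (L * Tm)" .
qed

text \<open>The perturbation estimate with the costate bound of \<open>adjoint_growth\<close> in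
  place of \<open>P\<close>. \<open>Tm\<close> may exceed the actual exit time, so that one constant
  can serve many starting points.\<close>

lemma transported_normal_hypo:
  assumes x: "x \<notin> S" and u: "u \<in> optimal_controls U S f r g x" and hit: "hit_time S f x u = ereal T"
    and X: "X = traj f x u T" and T: "T \<le> Tm" and mu: "0 \<le> \<mu>"
    and p: "caratheodory_solution (adjoint x u \<mu>) {0..T} p" "p T = \<mu> *\<^sub>R q - \<xi>"
    and sigma: "0 \<le> \<sigma>" "\<And>z. z \<in> closure (- S) \<Longrightarrow> \<xi> \<bullet> (z - X) \<le> \<sigma> * (norm (z - X))\<^sup>2"
    and q: "q \<in> superdiff g X" and c: "0 \<le> c"
    "\<And>z. z \<in> frontier S \<Longrightarrow> g z \<le> g X + q \<bullet> (z - X) + c * (norm (z - X))\<^sup>2"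
    and ham: "\<And>\<omega>. \<omega> \<in> U \<Longrightarrow> 0 \<le> p T \<bullet> f X \<omega> + \<mu> * r X \<omega>" "\<exists>\<omega>\<in>U. p T \<bullet> f X \<omega> + \<mu> * r X \<omega> = 0"
    and z: "z \<in> hypo S (value_fn U S f r g)"
  shows "(- p 0, \<mu>) \<bullet> (z - (x, real_of_ereal (value_fn U S f r g x)))
    \<le> ((norm (p T) + \<mu> * L * Tm) * exp (L * Tm) + \<mu> + \<sigma>) * bound_const Tm c
       * (norm (z - (x, real_of_ereal (value_fn U S f r g x))))\<^sup>2"
proof -
  obtain \<omega>0 where \<omega>0: "\<omega>0 \<in> U" "p T \<bullet> f X \<omega>0 + \<mu> * r X \<omega>0 = 0" using ham(2) by blast
  note o = optimalD[OF u]
  have xc: "x \<in> closure (- S)" by (rule in_closure_Compl[OF x])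
  have XF: "X \<in> frontier S" unfolding X by (rule frontier_if_first_hit[OF o(1) xc hit])
  have T0: "0 \<le> T" by (rule hit_time_eqD(1)[OF o(1) hit])
  interpret transported_normal U S f r g Df Dr N L r0 \<rho>0 G Nb x u T "real_of_ereal (value_fn U S f r g x)" \<mu>
    "(norm (p T) + \<mu> * L * Tm) * exp (L * Tm)" \<sigma> c Tm X q \<xi> p \<omega>0
    using xc o(1,3) hit X T mu p sigma superdiff_frontier_norm_le[OF XF q] c \<omega>0 ham(1)
      adjoint_growth(1)[OF o(1) T0 T mu p(1)]
    by unfold_locales (auto simp: adjoint_def)
  show ?thesis using hypo_bound[of "fst z" "snd z"] z by simp
qed

lemma value_in_hypo:
  assumes "x \<notin> S" "u \<in> optimal_controls U S f r g x"
  shows "(x, real_of_ereal (value_fn U S f r g x)) \<in> hypo S (value_fn U S f r g)"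
  using in_closure_Compl[OF assms(1)] optimalD(3,4)[OF assms(2)] by (auto simp: hypo_def)

lemma transported_normal_prox:
  assumes x: "x \<notin> S" and u: "u \<in> optimal_controls U S f r g x" and hit: "hit_time S f x u = ereal T"
    and X: "X = traj f x u T" and mu: "0 \<le> \<mu>"
    and p: "caratheodory_solution (adjoint x u \<mu>) {0..T} p" "p T = \<mu> *\<^sub>R q - \<xi>"
    and xi: "\<xi> \<in> prox_normal (closure (- S)) X" and q: "q \<in> superdiff g X"
    and ham: "\<And>\<omega>. \<omega> \<in> U \<Longrightarrow> 0 \<le> p T \<bullet> f X \<omega> + \<mu> * r X \<omega>" "\<exists>\<omega>\<in>U. p T \<bullet> f X \<omega> + \<mu> * r X \<omega> = 0"
  shows "(- p 0, \<mu>) \<in> prox_normal (hypo S (value_fn U S f r g)) (x, real_of_ereal (value_fn U S f r g x))"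
proof -
  note o = optimalD[OF u]
  have xc: "x \<in> closure (- S)" by (rule in_closure_Compl[OF x])
  have XF: "X \<in> frontier S" unfolding X by (rule frontier_if_first_hit[OF o(1) xc hit])
  have T0: "0 \<le> T" by (rule hit_time_eqD(1)[OF o(1) hit])
  obtain \<sigma> where \<sigma>: "\<sigma> \<ge> 0" "\<And>z. z \<in> closure (- S) \<Longrightarrow> \<xi> \<bullet> (z - X) \<le> \<sigma> * (norm (z - X))\<^sup>2"
    using xi by (auto simp: prox_normal_def)
  \<comment> \<open>A single exit point is involved here, hence the radius 0.\<close>
  obtain c where c: "c \<ge> 0"
    "\<And>Y q z. \<lbrakk>Y \<in> frontier S; norm (Y - X) \<le> 0; q \<in> superdiff g Y; z \<in> frontier S\<rbrakk> \<Longrightarrow>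
       g z \<le> g Y + q \<bullet> (z - Y) + c * (norm (z - Y))\<^sup>2"
    using semiconcave_frontier by blast
  \<comment> \<open>The definition of a proximal normal demands a nonnegative coefficient, hence the
    maximum with 0 below.\<close>
  define M where "M = ((norm (p T) + \<mu> * L * T) * exp (L * T) + \<mu> + \<sigma>) * bound_const T c"
  have "\<forall>z\<in>hypo S (value_fn U S f r g). (- p 0, \<mu>) \<bullet> (z - (x, real_of_ereal (value_fn U S f r g x)))
    \<le> max 0 M * (norm (z - (x, real_of_ereal (value_fn U S f r g x))))\<^sup>2"
  proof
    fix z assume z: "z \<in> hypo S (value_fn U S f r g)"
    have "(- p 0, \<mu>) \<bullet> (z - (x, real_of_ereal (value_fn U S f r g x)))
      \<le> M * (norm (z - (x, real_of_ereal (value_fn U S f r g x))))\<^sup>2"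
      unfolding M_def
      by (rule transported_normal_hypo[OF x u hit X order_refl mu p \<sigma> q c(1) c(2)[OF XF _ q] ham z]) auto
    also have "\<dots> \<le> max 0 M * (norm (z - (x, real_of_ereal (value_fn U S f r g x))))\<^sup>2"
      by (intro mult_right_mono) auto
    finally show "(- p 0, \<mu>) \<bullet> (z - (x, real_of_ereal (value_fn U S f r g x)))
      \<le> max 0 M * (norm (z - (x, real_of_ereal (value_fn U S f r g x))))\<^sup>2" .
  qed
  then show ?thesis
    unfolding prox_normal_def using value_in_hypo[OF x u] by (auto intro!: exI[of _ "max 0 M"])
qed

lemma N1_dagger_subset:
  assumes x: "x \<notin> S"
  shows "N1_dagger U S f r g Df Dr x \<subseteq> prox_superdiff S (value_fn U S f r g) x"
proof
  fix p0 assume "p0 \<in> N1_dagger U S f r g Df Dr x"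
  then obtain p u T \<xi> q where *: "p0 = p 0" "u \<in> optimal_controls U S f r g x"
    "T = real_of_ereal (hit_time S f x u)" "\<xi> \<in> N1 U S f (traj f x u T)" "q \<in> superdiff g (traj f x u T)"
    "hamiltonian U f r (traj f x u T) (q - \<xi>) = 0"
    "caratheodory_solution
          (\<lambda>t z. - (transpose (Df (traj f x u t) (u t)) *v z) - Dr (traj f x u t) (u t)) {0..T} p"
    "p T = q - \<xi>" unfolding N1_dagger_def by blast
  have hit: "hit_time S f x u = ereal T" using optimalD(2)[OF *(2)] *(3) by auto
  have "caratheodory_solution (adjoint x u 1) {0..T} p" using *(7) by (simp add: adjoint_def)
  moreover have "p T = 1 *\<^sub>R q - \<xi>" using *(8) by simp
  moreover have "\<xi> \<in> prox_normal (closure (- S)) (traj f x u T)" using *(4) by (simp add: N1_def)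
  ultimately have "(- p 0, 1) \<in> prox_normal (hypo S (value_fn U S f r g)) (x, real_of_ereal (value_fn U S f r g x))"
    using *(6,8) by (intro transported_normal_prox[OF x *(2) hit refl _ _ _ _ *(5)]) (auto simp: hamiltonian_eq_0_iff)
  then show "p0 \<in> prox_superdiff S (value_fn U S f r g) x" by (simp add: prox_superdiff_def *(1))
qed

lemma N0_dagger_subset:
  assumes x: "x \<notin> S"
  shows "N0_dagger U S f r g Df x \<subseteq> horizon_superdiff S (value_fn U S f r g) x"
proof
  fix p0 assume "p0 \<in> N0_dagger U S f r g Df x"
  then obtain p u T \<xi> where *: "p0 = p 0" "u \<in> optimal_controls U S f r g x"
    "T = real_of_ereal (hit_time S f x u)" "\<xi> \<in> N0 U S f (traj f x u T)"
    "caratheodory_solution (\<lambda>t z. - (transpose (Df (traj f x u t) (u t)) *v z)) {0..T} p"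
    "p T = - \<xi>" unfolding N0_dagger_def by blast
  have hit: "hit_time S f x u = ereal T" using optimalD(2)[OF *(2)] *(3) by auto
  \<comment> \<open>Any supergradient serves, since it enters with the factor
    \<open>\<mu> = 0\<close>.\<close>
  obtain q where q: "q \<in> superdiff g (traj f x u T)"
    using locally_semiconcave_superdiff_nonempty[OF g_semiconcave] by blast
  have "caratheodory_solution (adjoint x u 0) {0..T} p" using *(5) by (simp add: adjoint_def)
  moreover have "p T = 0 *\<^sub>R q - \<xi>" using *(6) by simp
  moreover have "\<xi> \<in> prox_normal (closure (- S)) (traj f x u T)" using *(4) by (simp add: N0_def)
  ultimately have "(- p 0, 0) \<in> prox_normal (hypo S (value_fn U S f r g)) (x, real_of_ereal (value_fn U S f r g x))"
    using *(4,6) by (intro transported_normal_prox[OF x *(2) hit refl _ _ _ _ q]) (auto simp: N0_def inner_f_eq_0_iff)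
  then show "p0 \<in> horizon_superdiff S (value_fn U S f r g) x" by (simp add: horizon_superdiff_def *(1))
qed

end

section \<open>Existence of optimal controls\<close>

context exit_time_problem
begin

text \<open>Velocities paired with costs that may be larger than the actual ones. This slack is part
  of the convexity hypothesis, which keeps weak limits of velocity and cost inside the set.\<close>

definition "epi x = {(v, l). \<exists>\<omega>\<in>U. v = f x \<omega> \<and> l \<ge> r x \<omega>}"

lemma convex_epi: "convex (epi x)"
  unfolding epi_def by (rule convexity)

text \<open>The set is the sum of a compact image of \<open>U\<close> and a closed vertical
  ray.\<close>

lemma closed_epi: "closed (epi x)"
proof -
  have "compact ((\<lambda>\<omega>. (f x \<omega>, r x \<omega>)) ` U)"
    by (intro compact_continuous_image continuous_intros continuous_on_f continuous_on_r U)
  then have "closed (\<Union>a\<in>(\<lambda>\<omega>. (f x \<omega>, r x \<omega>)) ` U. \<Union>b\<in>{0} \<times> {0..}. {a + b})"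
    by (intro compact_closed_sums) (auto intro: closed_Times)
  also have "(\<Union>a\<in>(\<lambda>\<omega>. (f x \<omega>, r x \<omega>)) ` U. \<Union>b\<in>{0} \<times> {0..}. {a + b}) = epi x"
  proof (intro set_eqI iffI)
    fix p assume "p \<in> epi x"
    then obtain \<omega> where \<omega>: "\<omega> \<in> U" "fst p = f x \<omega>" "snd p \<ge> r x \<omega>" by (auto simp: epi_def)
    then have p: "p = (f x \<omega>, r x \<omega>) + (0, snd p - r x \<omega>)" by (simp add: prod_eq_iff)
    show "p \<in> (\<Union>a\<in>(\<lambda>\<omega>. (f x \<omega>, r x \<omega>)) ` U. \<Union>b\<in>{0} \<times> {0..}. {a + b})"
    proof (rule UN_I)
      show "(f x \<omega>, r x \<omega>) \<in> (\<lambda>\<omega>. (f x \<omega>, r x \<omega>)) ` U" using \<omega>(1) by (rule imageI)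
      show "p \<in> (\<Union>b\<in>{0} \<times> {0..}. {(f x \<omega>, r x \<omega>) + b})"
        using p \<omega>(3) by (intro UN_I[of "(0, snd p - r x \<omega>)"]) auto
    qed
  qed (auto simp: epi_def)
  finally show ?thesis .
qed

text \<open>The penalty \<open>h t\<close> is nonnegative and vanishes exactly at those controls in
  \<open>U\<close> that realise the velocity in \<open>D t\<close> at no larger cost. A measurable
  minimiser is therefore a selection wherever \<open>D t\<close> lies in
  \<open>epi (Y t)\<close>.\<close>

lemma filippov_selection:
  assumes T: "0 \<le> T" and Y: "continuous_on {0..T} Y"
    and D: "D \<in> borel_measurable (lebesgue_on {0..T})"
    and mem: "AE t in lebesgue_on {0..T}. D t \<in> epi (Y t)"
  obtains u N0 where "u \<in> controls U" "negligible N0"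
    "\<And>t. t \<in> {0..T} - N0 \<Longrightarrow> f (Y t) (u t) = fst (D t) \<and> r (Y t) (u t) \<le> snd (D t)"
proof -
  define h where "h = (\<lambda>t \<omega>. norm (f (Y t) \<omega> - fst (D t)) + max 0 (r (Y t) \<omega> - snd (D t)))"
  have const: "continuous_on {0..T} (\<lambda>t. f (Y t) \<omega>)" "continuous_on {0..T} (\<lambda>t. r (Y t) \<omega>)" if "\<omega> \<in> U" for \<omega>
  proof -
    have "continuous_on {0..T} (\<lambda>t. (\<lambda>(x, \<omega>). f x \<omega>) (Y t, \<omega>))"
      by (rule continuous_on_compose2[OF f_cont]) (use that Y in \<open>auto intro!: continuous_intros\<close>)
    then show "continuous_on {0..T} (\<lambda>t. f (Y t) \<omega>)" by simp
    have "continuous_on {0..T} (\<lambda>t. (\<lambda>(x, \<omega>). r x \<omega>) (Y t, \<omega>))"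
      by (rule continuous_on_compose2[OF r_cont]) (use that Y in \<open>auto intro!: continuous_intros\<close>)
    then show "continuous_on {0..T} (\<lambda>t. r (Y t) \<omega>)" by simp
  qed
  have hm: "(\<lambda>t. h t \<omega>) \<in> borel_measurable (lebesgue_on {0..T})" if "\<omega> \<in> U" for \<omega>
  proof -
    have [measurable]: "(\<lambda>t. f (Y t) \<omega>) \<in> borel_measurable (lebesgue_on {0..T})"
      "(\<lambda>t. r (Y t) \<omega>) \<in> borel_measurable (lebesgue_on {0..T})"
      using const[OF that] by (auto intro: continuous_imp_measurable_on_sets_lebesgue)
    have [measurable]: "(\<lambda>t. fst (D t)) \<in> borel_measurable (lebesgue_on {0..T})"
      "(\<lambda>t. snd (D t)) \<in> borel_measurable (lebesgue_on {0..T})"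
      using measurable_compose[OF D borel_measurable_continuous_onI[OF continuous_on_fst[OF continuous_on_id]]]
        measurable_compose[OF D borel_measurable_continuous_onI[OF continuous_on_snd[OF continuous_on_id]]]
      by auto
    show ?thesis unfolding h_def by measurable
  qed
  have "\<exists>u\<in>borel_measurable (lebesgue_on {0..T}). \<forall>t\<in>space (lebesgue_on {0..T}). u t \<in> U \<and> (\<forall>\<omega>\<in>U. h t (u t) \<le> h t \<omega>)"
  proof (rule measurable_argmin[OF U(2,1) hm])
    show "continuous_on U (h t)" for t
      unfolding h_def by (intro continuous_intros continuous_on_f continuous_on_r)
  qed
  then obtain u0 where u0: "u0 \<in> borel_measurable (lebesgue_on {0..T})"
    "\<And>t. t \<in> {0..T} \<Longrightarrow> u0 t \<in> U" "\<And>t \<omega>. \<lbrakk>t \<in> {0..T}; \<omega> \<in> U\<rbrakk> \<Longrightarrow> h t (u0 t) \<le> h t \<omega>"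
    by auto
  obtain \<omega>0 where \<omega>0: "\<omega>0 \<in> U" using U by blast
  define u where "u = (\<lambda>t. if t \<in> {0..T} then u0 t else \<omega>0)"
  have "u \<in> borel_measurable lebesgue"
    unfolding u_def using u0(1) by (subst measurable_restrict_space_iff[symmetric]) auto
  then have "u \<in> borel_measurable (lebesgue_on {0..})" by (rule measurable_restrict_space1)
  then have u: "u \<in> controls U" using u0(2) \<omega>0 by (auto simp: controls_def u_def)
  have "AE t in lebesgue. t \<in> {0..T} \<longrightarrow> D t \<in> epi (Y t)"
    using mem by (simp add: AE_restrict_space_iff)
  then obtain N0 where N0: "N0 \<in> null_sets lebesgue" "{t. \<not> (t \<in> {0..T} \<longrightarrow> D t \<in> epi (Y t))} \<subseteq> N0"
    by (auto simp: eventually_ae_filter)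
  have "f (Y t) (u t) = fst (D t) \<and> r (Y t) (u t) \<le> snd (D t)" if t: "t \<in> {0..T} - N0" for t
  proof -
    have "D t \<in> epi (Y t)" using N0(2) t by blast
    then obtain \<omega> where \<omega>: "\<omega> \<in> U" "fst (D t) = f (Y t) \<omega>" "r (Y t) \<omega> \<le> snd (D t)" by (auto simp: epi_def)
    then have "h t (u t) \<le> 0" using u0(3)[of t \<omega>] t by (simp add: h_def u_def)
    then have "norm (f (Y t) (u t) - fst (D t)) = 0" "max 0 (r (Y t) (u t) - snd (D t)) = 0"
      unfolding h_def using norm_ge_zero[of "f (Y t) (u t) - fst (D t)"] by linarith+
    then show ?thesis by (auto simp: max_def split: if_splits)
  qed
  then show ?thesis using that[OF u] N0(1) negligible_iff_null_sets by blast
qed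

text \<open>Replaces the moving trajectories by their uniform limit inside the integrand while the
  controls stay. Afterwards all integrands are attached to the same state, where convexity can be
  used.\<close>

lemma integral_along_limit:
  fixes \<phi> :: "real ^ 'd \<Rightarrow> real ^ 'm \<Rightarrow> 'b::euclidean_space"
  assumes \<phi>: "continuous_on (UNIV \<times> U) (\<lambda>(x, \<omega>). \<phi> x \<omega>)"
    and lip: "\<And>x y \<omega>. \<omega> \<in> U \<Longrightarrow> norm (\<phi> y \<omega> - \<phi> x \<omega>) \<le> L * norm (y - x)"
    and u: "\<And>n. u n \<in> controls U" and T: "0 \<le> T"
    and y: "\<And>n. continuous_on {0..T} (y n)" and Y: "continuous_on {0..T} Y"
    and unif: "\<And>e. e > 0 \<Longrightarrow> \<exists>n0. \<forall>n\<ge>n0. \<forall>t\<in>{0..T}. norm (y n t - Y t) < e"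
  shows "(\<lambda>n. integral {0..T} (\<lambda>s. \<phi> (Y s) (u n s)) - integral {0..T} (\<lambda>s. \<phi> (y n s) (u n s))) \<longlonglongrightarrow> 0"
proof (rule LIMSEQ_I)
  fix e :: real assume "e > 0"
  define e' where "e' = e / (2 * (L * T + 1))"
  have LT: "L * T + 1 > 0" using L_pos T by (simp add: add_nonneg_pos)
  then have e': "e' > 0" "(L * e') * (T - 0) < e"
  proof -
    show "e' > 0" using LT \<open>e > 0\<close> by (simp add: e'_def)
    have "(L * e') * (T - 0) \<le> (L * T + 1) * e'" using \<open>e' > 0\<close> by (simp add: algebra_simps)
    also have "\<dots> = e / 2"
    proof -
      have "A * (e / (2 * A)) = e / 2" if "A > 0" for A :: real using that by simp
      from this[OF LT] show ?thesis by (simp only: e'_def)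
    qed
    finally show "(L * e') * (T - 0) < e" using \<open>e > 0\<close> by linarith
  qed
  then obtain n0 where n0: "\<And>n t. \<lbrakk>n \<ge> n0; t \<in> {0..T}\<rbrakk> \<Longrightarrow> norm (y n t - Y t) < e'"
    using unif by blast
  have "norm (integral {0..T} (\<lambda>s. \<phi> (Y s) (u n s)) - integral {0..T} (\<lambda>s. \<phi> (y n s) (u n s)) - 0) < e"
    if n: "n \<ge> n0" for n
  proof -
    have i: "(\<lambda>s. \<phi> (Y s) (u n s)) integrable_on {0..T}" "(\<lambda>s. \<phi> (y n s) (u n s)) integrable_on {0..T}"
      by (rule integrable_along[OF \<phi> u Y] integrable_along[OF \<phi> u y], simp)+
    have "norm (integral {0..T} (\<lambda>s. \<phi> (Y s) (u n s) - \<phi> (y n s) (u n s))) \<le> (L * e') * (T - 0)"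
    proof (rule norm_integral_interval_le)
      show "(\<lambda>s. \<phi> (Y s) (u n s) - \<phi> (y n s) (u n s)) integrable_on {0..T}"
        using i by (rule Henstock_Kurzweil_Integration.integrable_diff)
      fix s assume s: "s \<in> {0..T}"
      have "norm (\<phi> (Y s) (u n s) - \<phi> (y n s) (u n s)) \<le> L * norm (Y s - y n s)"
        using s by (intro lip controls_in_U[OF u]) auto
      also have "\<dots> \<le> L * e'"
        using n0[OF n s] L_pos by (intro mult_left_mono) (auto simp: norm_minus_commute)
      finally show "norm (\<phi> (Y s) (u n s) - \<phi> (y n s) (u n s)) \<le> L * e'" .
    qed (use T in auto)
    then show ?thesis
      using e'(2) by (simp add: Henstock_Kurzweil_Integration.integral_diff[OF i])
  qed
  then show "\<exists>n0. \<forall>n\<ge>n0. norm (integral {0..T} (\<lambda>s. \<phi> (Y s) (u n s)) - integral {0..T} (\<lambda>s. \<phi> (y n s) (u n s)) - 0) < e"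
    by blast
qed

lemma integral_upper_limit_lipschitz:
  fixes h :: "real \<Rightarrow> real"
  assumes h: "h integrable_on {0..Tm}" and B: "\<And>s. s \<in> {0..Tm} \<Longrightarrow> \<bar>h s\<bar> \<le> B"
    and a: "a \<in> {0..Tm}" and b: "b \<in> {0..Tm}"
  shows "\<bar>integral {0..a} h - integral {0..b} h\<bar> \<le> B * \<bar>a - b\<bar>"
proof -
  have *: "\<bar>integral {0..b} h - integral {0..a} h\<bar> \<le> B * (b - a)" if "a \<le> b" "a \<in> {0..Tm}" "b \<in> {0..Tm}" for a b
  proof -
    have i: "h integrable_on {0..b}" "h integrable_on {a..b}"
      using that by (auto intro: integrable_subinterval_real[OF h])
    have "integral {0..a} h + integral {a..b} h = integral {0..b} h"
      using that i by (intro Henstock_Kurzweil_Integration.integral_combine) auto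
    moreover have "norm (integral {a..b} h) \<le> B * (b - a)"
      using that i B by (intro norm_integral_interval_le) auto
    ultimately show ?thesis by auto
  qed
  show ?thesis using *[of a b] *[of b a] a b by (cases "a \<le> b") (auto simp: abs_minus_commute)
qed

text \<open>The controls of a minimising sequence need not converge. Their velocities and running
  costs, taken at the limit trajectory, do have a weak limit \<open>D\<close> in its epigraphs, and
  a control selected from \<open>D\<close> drives the same trajectory at no larger running
  cost.\<close>

lemma optimal_control_exists:
  assumes x: "x \<in> reach_set U S f" "x \<notin> S"
  shows "\<exists>u. u \<in> optimal_controls U S f r g x"
proof -
  obtain v where v: "value_fn U S f r g x = ereal v" using value_fn_finite[OF x] by auto
  obtain z0 where z0: "z0 \<in> frontier S" by (rule reach_set_frontier_point[OF x])
  have xc: "x \<in> closure (- S)" by (rule in_closure_Compl[OF x(2)])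
  have "\<exists>u\<in>admissible U S f x. cost S f r g x u < v + inverse (real (Suc n))" for n
  proof -
    have "value_fn U S f r g x < ereal (v + inverse (real (Suc n)))" by (simp add: v)
    then show ?thesis unfolding value_fn_def INF_less_iff by auto
  qed
  then obtain a where a: "\<And>n. a n \<in> admissible U S f x" "\<And>n. cost S f r g x (a n) < v + inverse (real (Suc n))"
    by metis
  then have "\<forall>n. \<exists>\<theta>. hit_time S f x (a n) = ereal \<theta>" and ac: "\<And>n. a n \<in> controls U" by (auto simp: admissible_iff)
  then obtain \<Theta> where \<Theta>: "\<And>n. hit_time S f x (a n) = ereal (\<Theta> n)" by metis
  \<comment> \<open>The bound on exit times that \<open>cost_lower_bound\<close> gives for costs of
    at most \<open>v + 1\<close>.\<close>
  define Tm where "Tm = (v + 1 - g z0 + G * norm (x - z0)) / \<kappa>"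
  have \<Theta>m: "\<Theta> n \<in> {0..Tm}" for n
  proof -
    have "inverse (real (Suc n)) \<le> 1" by (simp add: inverse_le_1_iff)
    then have "\<kappa> * \<Theta> n \<le> v + 1 - g z0 + G * norm (x - z0)"
      using cost_lower_bound[OF ac xc \<Theta> z0, of n] a(2)[of n] by linarith
    then have "\<Theta> n \<le> Tm" using kappa_pos by (simp add: Tm_def pos_le_divide_eq mult.commute)
    then show ?thesis using hit_time_eqD(1)[OF ac \<Theta>, of n] by simp
  qed
  then have Tm: "0 \<le> Tm" using \<Theta>m[of 0] by (meson atLeastAtMost_iff order_trans)
  obtain Y k where Y: "continuous_on {0..Tm} Y" and k: "strict_mono (k :: nat \<Rightarrow> nat)"
    and unif0: "\<And>e. 0 < e \<Longrightarrow> \<exists>n0. \<forall>n t. n \<ge> n0 \<and> t \<in> {0..Tm} \<longrightarrow> norm (traj f x (a (k n)) t - Y t) < e"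
  proof (rule Arzela_Ascoli[of "{0..Tm}" "\<lambda>n. traj f x (a n)" "norm x + N * Tm"])
    show "norm (traj f x (a n) t) \<le> norm x + N * Tm" if "t \<in> {0..Tm}" for n t
    proof -
      have "norm (traj f x (a n) t - x) \<le> N * \<bar>t - 0\<bar>"
        using traj_lipschitz[OF ac, of 0 t x n] traj_solution(1)[OF ac] that by simp
      also have "\<dots> \<le> N * Tm" using that N_pos by (intro mult_left_mono) auto
      finally show ?thesis using norm_triangle_sub[of "traj f x (a n) t" x] by linarith
    qed
    show "\<exists>d>0. \<forall>n t'. t' \<in> {0..Tm} \<and> norm (t - t') < d \<longrightarrow> norm (traj f x (a n) t - traj f x (a n) t') < e"
      if "t \<in> {0..Tm}" "e > 0" for t e
    proof (intro exI[of _ "e / N"] conjI allI impI)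
      fix n t' assume t': "t' \<in> {0..Tm} \<and> norm (t - t') < e / N"
      have "norm (traj f x (a n) t - traj f x (a n) t') \<le> N * \<bar>t - t'\<bar>"
        using that t' by (intro traj_lipschitz[OF ac]) auto
      also have "\<dots> < N * (e / N)" using t' N_pos by (intro mult_strict_left_mono) auto
      finally show "norm (traj f x (a n) t - traj f x (a n) t') < e" using N_pos by simp
    qed (use that N_pos in auto)
  qed (use that in auto)
  obtain T j where T: "T \<in> {0..Tm}" and j: "strict_mono (j :: nat \<Rightarrow> nat)" and jT: "((\<Theta> \<circ> k) \<circ> j) \<longlonglongrightarrow> T"
    using seq_compactE[OF compact_imp_seq_compact[OF compact_Icc[of 0 Tm]], of "\<Theta> \<circ> k"] \<Theta>m by auto
  define m where "m = (\<lambda>n. k (j n))"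
  have mn: "m n \<ge> n" for n
    using seq_suble[OF j, of n] seq_suble[OF k, of "j n"] by (simp add: m_def)
  define u where "u = (\<lambda>n. a (m n))"
  define y where "y = (\<lambda>n. traj f x (u n))"
  define \<theta> where "\<theta> = (\<lambda>n. \<Theta> (m n))"
  have uc: "u n \<in> controls U" for n by (simp add: u_def ac)
  have \<theta>: "hit_time S f x (u n) = ereal (\<theta> n)" "\<theta> n \<in> {0..Tm}" for n
    using \<Theta> \<Theta>m by (auto simp: u_def \<theta>_def)
  have \<theta>T: "\<theta> \<longlonglongrightarrow> T" using jT by (simp add: \<theta>_def m_def o_def)
  have unif: "\<exists>n0. \<forall>n\<ge>n0. \<forall>t\<in>{0..Tm}. norm (y n t - Y t) < e" if "e > 0" for e
  proof -
    obtain n0 where n0: "\<And>n t. n \<ge> n0 \<Longrightarrow> t \<in> {0..Tm} \<Longrightarrow> norm (traj f x (a (k n)) t - Y t) < e"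
      using unif0[OF \<open>e > 0\<close>] by blast
    have "norm (y n t - Y t) < e" if "n \<ge> n0" "t \<in> {0..Tm}" for n t
      using n0[of "j n" t] seq_suble[OF j, of n] that by (simp add: y_def u_def m_def)
    then show ?thesis by blast
  qed
  have lim: "(\<lambda>n. y n t) \<longlonglongrightarrow> Y t" if t: "t \<in> {0..Tm}" for t
  proof (rule LIMSEQ_I)
    fix e :: real assume "e > 0"
    then show "\<exists>n0. \<forall>n\<ge>n0. norm (y n t - Y t) < e" using unif t by meson
  qed
  have ylip: "norm (y n b - y n a) \<le> N * \<bar>b - a\<bar>" if "0 \<le> a" "0 \<le> b" for n a b
    unfolding y_def using traj_lipschitz[OF uc that] .
  have Y0: "Y 0 = x"
    using LIMSEQ_unique[OF lim[of 0]] Tm traj_solution(1)[OF uc] by (simp add: y_def)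
  have Ylip: "norm (Y b - Y a) \<le> N * \<bar>b - a\<bar>" if "a \<in> {0..Tm}" "b \<in> {0..Tm}" for a b
    using ylip that by (intro LIMSEQ_le_const2[OF tendsto_norm[OF tendsto_diff[OF lim[OF that(2)] lim[OF that(1)]]]]) auto
  have y\<theta>: "(\<lambda>n. y n (\<theta> n)) \<longlonglongrightarrow> Y T"
  proof -
    have "(\<lambda>n. y n (\<theta> n) - y n T) \<longlonglongrightarrow> 0"
    proof (rule Lim_null_comparison)
      show "\<forall>\<^sub>F n in sequentially. norm (y n (\<theta> n) - y n T) \<le> N * \<bar>\<theta> n - T\<bar>"
        using ylip T \<theta>(2) by auto
      have "(\<lambda>n. N * \<bar>\<theta> n - T\<bar>) \<longlonglongrightarrow> N * \<bar>T - T\<bar>" by (intro tendsto_intros \<theta>T)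
      then show "(\<lambda>n. N * \<bar>\<theta> n - T\<bar>) \<longlonglongrightarrow> 0" by simp
    qed
    from tendsto_add[OF this lim[OF T]] show ?thesis by simp
  qed
  have yF: "y n (\<theta> n) \<in> frontier S" for n
    unfolding y_def by (rule frontier_if_first_hit[OF uc xc \<theta>(1)])
  have YF: "Y T \<in> frontier S"
    using closed_sequentially[OF frontier_closed _ y\<theta>] yF by blast
  have glim: "(\<lambda>n. g (y n (\<theta> n))) \<longlonglongrightarrow> g (Y T)"
  proof -
    have "(\<lambda>n. g (y n (\<theta> n)) - g (Y T)) \<longlonglongrightarrow> 0"
    proof (rule Lim_null_comparison)
      show "\<forall>\<^sub>F n in sequentially. norm (g (y n (\<theta> n)) - g (Y T)) \<le> G * norm (y n (\<theta> n) - Y T)"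
        using frontier_lipschitz[OF yF YF] by simp
      have "(\<lambda>n. G * norm (y n (\<theta> n) - Y T)) \<longlonglongrightarrow> G * norm (Y T - Y T)" by (intro tendsto_intros y\<theta>)
      then show "(\<lambda>n. G * norm (y n (\<theta> n) - Y T)) \<longlonglongrightarrow> 0" by simp
    qed
    then show ?thesis by (simp add: LIM_zero_iff)
  qed
  have clim: "(\<lambda>n. cost S f r g x (u n)) \<longlonglongrightarrow> v"
  proof (rule real_tendsto_sandwich)
    show "\<forall>\<^sub>F n in sequentially. v \<le> cost S f r g x (u n)"
      using value_fn_le_cost[OF uc \<theta>(1)] by (simp add: v)
    have "cost S f r g x (u n) \<le> v + inverse (real (Suc n))" for n
    proof -
      have "inverse (real (Suc (m n))) \<le> inverse (real (Suc n))" using mn[of n] by (intro le_imp_inverse_le) auto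
      then show ?thesis using a(2)[of "m n"] unfolding u_def by (meson add_left_mono less_imp_le order_trans)
    qed
    then show "\<forall>\<^sub>F n in sequentially. cost S f r g x (u n) \<le> v + inverse (real (Suc n))" by simp
    show "(\<lambda>n. v + inverse (real (Suc n))) \<longlonglongrightarrow> v"
      using tendsto_add[OF tendsto_const LIMSEQ_inverse_real_of_nat, of v] by simp
  qed simp
  have yc: "continuous_on {0..t} (y n)" for n t unfolding y_def by (rule traj_continuous_on[OF uc]) simp
  have Yc: "continuous_on {0..t} Y" if "t \<in> {0..Tm}" for t
    using that by (intro continuous_on_subset[OF Y]) auto
  have unif_t: "\<exists>n0. \<forall>n\<ge>n0. \<forall>s\<in>{0..t}. norm (y n s - Y s) < e" if "t \<in> {0..Tm}" "e > 0" for t e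
  proof -
    have "{0..t} \<subseteq> {0..Tm}" using that by auto
    then show ?thesis using unif[OF \<open>e > 0\<close>] by (meson subsetD)
  qed
  have flim: "(\<lambda>n. integral {0..t} (\<lambda>s. f (Y s) (u n s))) \<longlonglongrightarrow> Y t - x" if t: "t \<in> {0..Tm}" for t
  proof -
    have "(\<lambda>n. integral {0..t} (\<lambda>s. f (Y s) (u n s)) - integral {0..t} (\<lambda>s. f (y n s) (u n s))) \<longlonglongrightarrow> 0"
      using t by (intro integral_along_limit[OF f_cont f_lip uc _ yc Yc[OF t] unif_t[OF t]]) auto
    moreover have "integral {0..t} (\<lambda>s. f (y n s) (u n s)) = y n t - x" for n
      using traj_increment(1)[OF uc, of 0 t x n] traj_solution(1)[OF uc] t by (simp add: y_def)
    ultimately have "(\<lambda>n. integral {0..t} (\<lambda>s. f (Y s) (u n s)) - (y n t - x)) \<longlonglongrightarrow> 0" by simp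
    from tendsto_add[OF this tendsto_diff[OF lim[OF t] tendsto_const[of x]]] show ?thesis by simp
  qed
  have rlim: "(\<lambda>n. integral {0..T} (\<lambda>s. r (Y s) (u n s))) \<longlonglongrightarrow> v - g (Y T)"
  proof -
    have 1: "(\<lambda>n. integral {0..T} (\<lambda>s. r (Y s) (u n s)) - integral {0..T} (\<lambda>s. r (y n s) (u n s))) \<longlonglongrightarrow> 0"
      using T r_lipschitz by (intro integral_along_limit[OF r_cont _ uc _ yc Yc[OF T] unif_t[OF T]]) auto
    have "compact ((\<lambda>(x, \<omega>). r x \<omega>) ` (cball x (N * Tm) \<times> U))"
      using U by (intro compact_continuous_image continuous_on_subset[OF r_cont] compact_Times) auto
    then obtain B where B: "\<And>p. p \<in> cball x (N * Tm) \<times> U \<Longrightarrow> norm (case p of (x, \<omega>) \<Rightarrow> r x \<omega>) \<le> B"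
      by (meson bounded_iff compact_imp_bounded imageI)
    have rB: "\<bar>r (y n s) (u n s)\<bar> \<le> B" if "s \<in> {0..Tm}" for n s
    proof -
      have "norm (y n s - x) \<le> N * \<bar>s - 0\<bar>"
        using ylip[of 0 s n] traj_solution(1)[OF uc] that by (simp add: y_def)
      also have "\<dots> \<le> N * Tm" using that N_pos by (intro mult_left_mono) auto
      finally have "(y n s, u n s) \<in> cball x (N * Tm) \<times> U"
        using controls_in_U[OF uc, of s n] that by (simp add: dist_norm norm_minus_commute)
      from B[OF this] show ?thesis by simp
    qed
    have 2: "(\<lambda>n. integral {0..T} (\<lambda>s. r (y n s) (u n s)) - integral {0..\<theta> n} (\<lambda>s. r (y n s) (u n s))) \<longlonglongrightarrow> 0"
    proof (rule Lim_null_comparison)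
      show "\<forall>\<^sub>F n in sequentially. norm (integral {0..T} (\<lambda>s. r (y n s) (u n s)) - integral {0..\<theta> n} (\<lambda>s. r (y n s) (u n s))) \<le> B * \<bar>T - \<theta> n\<bar>"
        unfolding real_norm_def
        by (intro always_eventually allI integral_upper_limit_lipschitz[where Tm = Tm])
          (use rB T \<theta>(2) in \<open>auto simp: y_def intro!: r_integrable[OF uc]\<close>)
      have "(\<lambda>n. B * \<bar>T - \<theta> n\<bar>) \<longlonglongrightarrow> B * \<bar>T - T\<bar>" by (intro tendsto_intros \<theta>T)
      then show "(\<lambda>n. B * \<bar>T - \<theta> n\<bar>) \<longlonglongrightarrow> 0" by simp
    qed
    have 3: "(\<lambda>n. integral {0..\<theta> n} (\<lambda>s. r (y n s) (u n s))) \<longlonglongrightarrow> v - g (Y T)"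
    proof -
      have "integral {0..\<theta> n} (\<lambda>s. r (y n s) (u n s)) = cost S f r g x (u n) - g (y n (\<theta> n))" for n
        by (simp add: cost_eq[OF \<theta>(1)] y_def)
      then show ?thesis using tendsto_diff[OF clim glim] by simp
    qed
    from tendsto_add[OF tendsto_add[OF 1 2] 3] show ?thesis by simp
  qed
  \<comment> \<open>With the state frozen at \<open>Y t\<close>, the values for all \<open>n\<close>
    lie in one closed convex set, \<open>epi (Y t)\<close>.\<close>
  define W where "W = (\<lambda>n t. (f (Y t) (u n t), r (Y t) (u n t)))"
  have T0: "0 \<le> T" using T by simp
  have fr: "continuous_on (UNIV \<times> U) (\<lambda>(x, \<omega>). (f x \<omega>, r x \<omega>))"
    using f_cont r_cont by (simp add: case_prod_beta continuous_on_Pair)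
  have Wm: "W n \<in> borel_measurable (lebesgue_on {0..T})" for n
    unfolding W_def by (rule borel_measurable_along[OF fr uc Yc[OF T]]) auto
  have Wi: "W n integrable_on {0..t}" if "t \<in> {0..Tm}" for n t
    unfolding W_def by (rule integrable_along[OF fr uc Yc[OF that]]) simp
  obtain B where B: "\<And>n t. t \<in> {0..T} \<Longrightarrow> norm (W n t) \<le> B"
  proof -
    have "compact ((\<lambda>(x, \<omega>). (f x \<omega>, r x \<omega>)) ` (Y ` {0..T} \<times> U))"
      using U by (intro compact_continuous_image continuous_on_subset[OF fr] compact_Times
          compact_continuous_image[OF Yc[OF T]]) auto
    then obtain B where B: "\<And>p. p \<in> Y ` {0..T} \<times> U \<Longrightarrow> norm (case p of (x, \<omega>) \<Rightarrow> (f x \<omega>, r x \<omega>)) \<le> B"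
      by (meson bounded_iff compact_imp_bounded imageI)
    have "norm (W n t) \<le> B" if "t \<in> {0..T}" for n t
      using B[of "(Y t, u n t)"] controls_in_U[OF uc, of t n] that by (simp add: W_def)
    then show ?thesis using that by blast
  qed
  obtain D where D: "D \<in> borel_measurable (lebesgue_on {0..T})" "\<And>t. t \<in> {0..T} \<Longrightarrow> norm (D t) \<le> B"
    and Dmem: "AE t in lebesgue_on {0..T}. \<forall>C. closed C \<longrightarrow> convex C \<longrightarrow> (\<forall>n. W n t \<in> C) \<longrightarrow> D t \<in> C"
    and Dlim: "\<And>t b l. \<lbrakk>t \<in> {0..T}; (\<lambda>n. integral {0..t} (W n) \<bullet> b) \<longlonglongrightarrow> l\<rbrakk> \<Longrightarrow> integral {0..t} D \<bullet> b = l"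
    using convex_weak_limit[of W T B, OF Wm B] by blast
  have "D absolutely_integrable_on {0..T}"
    using D by (rule bounded_measurable_absolutely_integrable)
  then have D0: "D integrable_on {0..T}" using set_lebesgue_integral_eq_integral(1) by blast
  have Di: "D integrable_on {0..t}" if "t \<in> {0..T}" for t
    using that by (auto intro: integrable_subinterval_real[OF D0])
  \<comment> \<open>Testing the weak limit with \<open>(b, 0)\<close> isolates the velocity; testing
    with \<open>(0, 1)\<close>, further below, isolates the running cost.\<close>
  have fD: "integral {0..t} (\<lambda>s. fst (D s)) = Y t - x" if t: "t \<in> {0..T}" for t
  proof (rule euclidean_eqI)
    fix b :: "real ^ 'd" assume "b \<in> Basis"
    have tm: "t \<in> {0..Tm}" using t T by auto
    have fst_int: "fst (integral {0..t} h) = integral {0..t} (\<lambda>s. fst (h s))"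
      if "h integrable_on {0..t}" for h :: "real \<Rightarrow> (real ^ 'd) \<times> real"
      using integral_linear[OF that bounded_linear_fst] by (simp add: o_def)
    have "integral {0..t} (W n) \<bullet> (b, 0) = integral {0..t} (\<lambda>s. f (Y s) (u n s)) \<bullet> b" for n
      using fst_int[OF Wi[OF tm, of n]] by (simp add: inner_prod_def W_def)
    then have "(\<lambda>n. integral {0..t} (W n) \<bullet> (b, 0)) \<longlonglongrightarrow> (Y t - x) \<bullet> b"
      using tendsto_inner[OF flim[OF tm] tendsto_const[of b]] by simp
    from Dlim[OF t this] show "integral {0..t} (\<lambda>s. fst (D s)) \<bullet> b = (Y t - x) \<bullet> b"
      using fst_int[OF Di[OF t]] by (simp add: inner_prod_def)
  qed
  have rD: "integral {0..T} (\<lambda>s. snd (D s)) = v - g (Y T)"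
  proof -
    have snd_int: "snd (integral {0..T} h) = integral {0..T} (\<lambda>s. snd (h s))"
      if "h integrable_on {0..T}" for h :: "real \<Rightarrow> (real ^ 'd) \<times> real"
      using integral_linear[OF that bounded_linear_snd] by (simp add: o_def)
    have "integral {0..T} (W n) \<bullet> (0, 1) = integral {0..T} (\<lambda>s. r (Y s) (u n s))" for n
      using snd_int[OF Wi[OF T, of n]] by (simp add: inner_prod_def W_def)
    then have "(\<lambda>n. integral {0..T} (W n) \<bullet> (0, 1)) \<longlonglongrightarrow> v - g (Y T)" using rlim by simp
    from Dlim[OF _ this] show ?thesis
      using snd_int[OF D0] T0 by (simp add: inner_prod_def)
  qed
  have "AE t in lebesgue_on {0..T}. D t \<in> epi (Y t)"
    using Dmem AE_space
  proof eventually_elim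
    case (elim t)
    have "W n t \<in> epi (Y t)" for n
      using controls_in_U[OF uc, of t n] elim(2) by (auto simp: W_def epi_def)
    then show ?case using elim(1) closed_epi convex_epi by blast
  qed
  then obtain w N0 where w: "w \<in> controls U" and N0: "negligible N0"
    and sel: "\<And>t. t \<in> {0..T} - N0 \<Longrightarrow> f (Y t) (w t) = fst (D t) \<and> r (Y t) (w t) \<le> snd (D t)"
    using filippov_selection[OF T0 Yc[OF T] D(1)] by blast
  have fw: "integral {0..t} (\<lambda>s. f (Y s) (w s)) = Y t - x" if t: "t \<in> {0..T}" for t
  proof -
    have "integral {0..t} (\<lambda>s. f (Y s) (w s)) = integral {0..t} (\<lambda>s. fst (D s))"
      using t sel by (intro integral_spike[OF N0]) auto
    then show ?thesis using fD[OF t] by simp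
  qed
  have fwi: "(\<lambda>s. f (Y s) (w s)) absolutely_integrable_on {a..b}" if "0 \<le> a" "b \<le> T" for a b
  proof -
    have "continuous_on {a..b} Y" using that T by (intro continuous_on_subset[OF Y]) auto
    then show ?thesis using that by (intro absolutely_integrable_along[OF f_cont w]) auto
  qed
  have Ysol: "caratheodory_solution (\<lambda>s z. f z (w s)) {0..T} Y"
    unfolding caratheodory_solution_def
  proof (intro ballI impI conjI)
    fix a b assume ab: "a \<in> {0..T}" "b \<in> {0..T}" "a \<le> b"
    show "(\<lambda>s. f (Y s) (w s)) absolutely_integrable_on {a..b}" using fwi ab by auto
    have "(\<lambda>s. f (Y s) (w s)) integrable_on {0..b}"
      using fwi[of 0 b] ab set_lebesgue_integral_eq_integral(1) by auto
    then have "integral {0..a} (\<lambda>s. f (Y s) (w s)) + integral {a..b} (\<lambda>s. f (Y s) (w s)) = integral {0..b} (\<lambda>s. f (Y s) (w s))"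
      using ab by (intro Henstock_Kurzweil_Integration.integral_combine) auto
    then show "Y b - Y a = integral {a..b} (\<lambda>s. f (Y s) (w s))"
      using fw[OF ab(1)] fw[OF ab(2)] by (simp add: algebra_simps)
  qed
  have Yw: "Y t = traj f x w t" if "t \<in> {0..T}" for t
    by (rule traj_unique[OF w Ysol Y0 that])
  have rw: "integral {0..T} (\<lambda>s. r (traj f x w s) (w s)) \<le> v - g (Y T)"
  proof -
    have i: "(\<lambda>s. r (Y s) (w s)) integrable_on {0..T}" by (rule integrable_along[OF r_cont w Yc[OF T]]) simp
    have "integral {0..T} (\<lambda>s. r (traj f x w s) (w s)) = integral {0..T} (\<lambda>s. r (Y s) (w s))"
      using Yw by (intro integral_cong) auto
    also have "\<dots> \<le> integral {0..T} (\<lambda>s. snd (D s))"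
    proof -
      have sD: "(\<lambda>s. snd (D s)) integrable_on {0..T}"
        using integrable_linear[OF D0 bounded_linear_snd] by (simp add: o_def)
      \<comment> \<open>The selected running cost is compared with \<open>snd (D s)\<close> only off
        the null set \<open>N0\<close>; on \<open>N0\<close> the integrand is replaced.\<close>
      have "integral {0..T} (\<lambda>s. if s \<in> N0 then snd (D s) else r (Y s) (w s)) \<le> integral {0..T} (\<lambda>s. snd (D s))"
      proof (rule integral_le[OF _ sD])
        show "(\<lambda>s. if s \<in> N0 then snd (D s) else r (Y s) (w s)) integrable_on {0..T}"
          by (rule integrable_spike[OF i N0]) auto
      qed (use sel in auto)
      moreover have "integral {0..T} (\<lambda>s. if s \<in> N0 then snd (D s) else r (Y s) (w s)) = integral {0..T} (\<lambda>s. r (Y s) (w s))"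
        by (rule integral_spike[OF N0]) auto
      ultimately show ?thesis by simp
    qed
    also have "\<dots> = v - g (Y T)" by (rule rD)
    finally show ?thesis .
  qed
  have "traj f x w T \<in> S" using Yw[of T] T0 YF frontier_subset_closed[OF S(2)] by auto
  \<comment> \<open>The limit trajectory may reach \<open>S\<close> before \<open>T\<close>. Since
    \<open>\<kappa>\<close> is positive, stopping there cannot raise the cost.\<close>
  from hit_time_finite[OF w T0 this] obtain \<tau> where \<tau>: "\<tau> \<le> T" "hit_time S f x w = ereal \<tau>" "0 \<le> \<tau>"
    by blast
  have \<tau>F: "traj f x w \<tau> \<in> frontier S" by (rule frontier_if_first_hit[OF w xc \<tau>(2)])
  have "cost S f r g x w \<le> v"
  proof -
    have "integral {0..\<tau>} (\<lambda>s. r (traj f x w s) (w s)) + integral {\<tau>..T} (\<lambda>s. r (traj f x w s) (w s))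
       = integral {0..T} (\<lambda>s. r (traj f x w s) (w s))"
      using \<tau> r_integrable[OF w] by (intro Henstock_Kurzweil_Integration.integral_combine) auto
    moreover have "r0 * (T - \<tau>) \<le> integral {\<tau>..T} (\<lambda>s. r (traj f x w s) (w s))"
      using \<tau> by (intro r_integral_ge[OF w]) auto
    moreover have "g (traj f x w \<tau>) - g (Y T) \<le> G * (N * (T - \<tau>))"
    proof -
      have "norm (traj f x w \<tau> - traj f x w T) \<le> N * (T - \<tau>)"
        using traj_lipschitz[OF w T0 \<tau>(3), of x] \<tau> by simp
      then have "G * norm (traj f x w \<tau> - Y T) \<le> G * (N * (T - \<tau>))"
        using Yw[of T] T0 terminal_const by (intro mult_left_mono) auto
      then show ?thesis using frontier_lipschitz[OF \<tau>F YF] by linarith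
    qed
    moreover have "0 \<le> r0 * (T - \<tau>) - G * (N * (T - \<tau>))"
    proof -
      have "0 \<le> \<kappa> * (T - \<tau>)" using kappa_pos \<tau> by simp
      then show ?thesis by (simp add: \<kappa>_def algebra_simps)
    qed
    ultimately show ?thesis using rw by (simp add: cost_eq[OF \<tau>(2)])
  qed
  then have "ereal (cost S f r g x w) = value_fn U S f r g x"
    using value_fn_le_cost[OF w \<tau>(2)] v by simp
  then have "w \<in> optimal_controls U S f r g x"
    using w \<tau>(2) by (auto simp: optimal_controls_def admissible_iff)
  then show ?thesis by blast
qed

end

section \<open>The exterior sphere condition\<close>

context exit_time_problem
begin

text \<open>If every velocity at \<open>X\<close> had a negative component along
  \<open>\<xi>\<close>, then at time \<open>\<delta>\<close> before arrival the trajectory would be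
  at a height of order \<open>\<delta>\<close> above \<open>X\<close> in the direction
  \<open>\<xi>\<close>. Points outside \<open>S\<close> near the inner ball reach only heights of
  order \<delta>^2.\<close>

lemma inner_f_max_nonneg:
  assumes x: "x \<notin> S" and u: "u \<in> controls U" and hit: "hit_time S f x u = ereal T"
    and X: "X = traj f x u T" and xi: "norm \<xi> = 1"
    "\<And>y. y \<in> closure (- S) \<Longrightarrow> \<xi> \<bullet> (y - X) \<le> 1 / (2 * \<rho>0) * (norm (y - X))\<^sup>2"
  shows "\<exists>\<omega>\<in>U. \<xi> \<bullet> f X \<omega> \<ge> 0"
proof (rule ccontr)
  assume "\<not> (\<exists>\<omega>\<in>U. \<xi> \<bullet> f X \<omega> \<ge> 0)"
  then have neg: "\<xi> \<bullet> f X \<omega> < 0" if "\<omega> \<in> U" for \<omega> using that by force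
  obtain \<omega>1 where \<omega>1: "\<omega>1 \<in> U" "\<And>\<omega>. \<omega> \<in> U \<Longrightarrow> \<xi> \<bullet> f X \<omega> \<le> \<xi> \<bullet> f X \<omega>1"
    using continuous_attains_sup[OF U(2,1) continuous_on_inner[OF continuous_on_const continuous_on_f]] by blast
  define m where "m = - (\<xi> \<bullet> f X \<omega>1)"
  have m: "m > 0" using neg[OF \<omega>1(1)] by (simp add: m_def)
  note h = hit_time_eqD[OF u hit]
  have T: "T > 0" using h x traj_solution(1)[OF u, of x] by (cases "T = 0") auto
  \<comment> \<open>The two second order errors: \<open>L * N\<close> from the variation of
    \<open>f\<close> along the last arc, the other term from the inner ball. \<open>\<delta>\<close>
    is then taken with \<open>\<delta> * A < m\<close>.\<close>
  define A where "A = L * N + N\<^sup>2 / (2 * \<rho>0)"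
  have A: "A > 0" using L_pos N_pos constants by (simp add: A_def add_pos_pos)
  define \<delta> where "\<delta> = min T (m / (2 * A))"
  have \<delta>: "0 < \<delta>" "\<delta> \<le> T" using T m A by (auto simp: \<delta>_def)
  have "\<delta> * A \<le> m / (2 * A) * A" using A by (intro mult_right_mono) (auto simp: \<delta>_def)
  also have "\<dots> = m / 2" using A by simp
  finally have A\<delta>: "\<delta> * A < m" using m by linarith
  define t where "t = T - \<delta>"
  have t: "0 \<le> t" "t < T" using \<delta> by (auto simp: t_def)
  define y where "y = traj f x u"
  have yX: "norm (y s - X) \<le> N * \<delta>" if "s \<in> {t..T}" for s
  proof -
    have "norm (y s - X) \<le> N * \<bar>s - T\<bar>" unfolding y_def X using that t by (intro traj_lipschitz[OF u]) auto
    also have "\<dots> \<le> N * \<delta>" using that N_pos by (intro mult_left_mono) (auto simp: t_def)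
    finally show ?thesis .
  qed
  have "y t \<in> closure (- S)" unfolding y_def using h(3)[OF t] by (rule in_closure_Compl)
  then have "\<xi> \<bullet> (y t - X) \<le> 1 / (2 * \<rho>0) * (norm (y t - X))\<^sup>2" by (rule xi(2))
  also have "\<dots> \<le> 1 / (2 * \<rho>0) * (N * \<delta>)\<^sup>2"
    using yX[of t] t constants by (intro mult_left_mono power_mono) auto
  finally have up: "\<xi> \<bullet> (y t - X) \<le> \<delta> * (N\<^sup>2 / (2 * \<rho>0) * \<delta>)"
    by (simp add: power2_eq_square algebra_simps)
  have inc: "X - y t = integral {t..T} (\<lambda>s. f (y s) (u s))" "(\<lambda>s. f (y s) (u s)) integrable_on {t..T}"
    using traj_increment[OF u t(1), of T x] t by (auto simp: y_def X)
  have hi: "((\<lambda>s. \<xi> \<bullet> f (y s) (u s)) has_integral \<xi> \<bullet> (X - y t)) {t..T}"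
    unfolding inc(1)
    using has_integral_linear[OF integrable_integral[OF inc(2)] bounded_linear_inner_right[of \<xi>]]
    by (simp add: o_def)
  have "\<xi> \<bullet> (X - y t) \<le> \<delta> * (- m + L * (N * \<delta>))"
  proof (rule has_integral_le[OF hi])
    show "((\<lambda>_. - m + L * (N * \<delta>)) has_integral \<delta> * (- m + L * (N * \<delta>))) {t..T}"
      using has_integral_const_real[of "- m + L * (N * \<delta>)" t T] \<delta> by (simp add: t_def)
    fix s assume s: "s \<in> {t..T}"
    have us: "u s \<in> U" using controls_in_U[OF u] s t by auto
    have "\<xi> \<bullet> (f (y s) (u s) - f X (u s)) \<le> norm \<xi> * norm (f (y s) (u s) - f X (u s))" by (rule norm_cauchy_schwarz)
    also have "\<dots> \<le> L * norm (y s - X)" using f_lip[OF us, of "y s" X] xi(1) by simp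
    also have "\<dots> \<le> L * (N * \<delta>)" using yX[OF s] L_pos by (intro mult_left_mono) auto
    finally show "\<xi> \<bullet> f (y s) (u s) \<le> - m + L * (N * \<delta>)"
      using \<omega>1(2)[OF us] by (simp add: m_def inner_diff_right)
  qed
  moreover have "\<xi> \<bullet> (X - y t) = - (\<xi> \<bullet> (y t - X))" by (simp add: inner_diff_right)
  ultimately have "0 \<le> \<delta> * (- m + L * (N * \<delta>)) + \<delta> * (N\<^sup>2 / (2 * \<rho>0) * \<delta>)" using up by linarith
  also have "\<dots> = \<delta> * (\<delta> * A - m)" by (simp add: A_def algebra_simps)
  also have "\<dots> < 0" using \<delta> A\<delta> by (intro mult_pos_neg) auto
  finally show False by simp
qed

text \<open>At \<open>l = 0\<close> the Hamiltonian is at most \<open>- \<kappa>\<close>, because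
  the running cost outweighs q.f. At \<open>\<Lambda>\<close> the control \<open>\<omega>1\<close>
  alone makes it nonnegative. As a supremum of functions affine in \<open>l\<close> with bounded
  slopes it is Lipschitz, hence continuous. Since \<xi>.f stands in the denominator of
  \<open>\<Lambda>\<close>, no uniform bound on \<open>l\<close> results.\<close>

lemma hamiltonian_zero_exists:
  assumes q: "norm q \<le> G" and \<omega>1: "\<omega>1 \<in> U" "\<xi> \<bullet> f X \<omega>1 > 0"
  shows "\<exists>l>0. hamiltonian U f r X (q - l *\<^sub>R \<xi>) = 0"
proof -
  define \<phi> where "\<phi> = (\<lambda>l. hamiltonian U f r X (q - l *\<^sub>R \<xi>))"
  define h where "h = (\<lambda>l \<omega>. - ((q - l *\<^sub>R \<xi>) \<bullet> f X \<omega>) - r X \<omega>)"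
  have \<phi>: "\<phi> l = (SUP \<omega>\<in>U. h l \<omega>)" for l by (simp add: \<phi>_def h_def hamiltonian_def)
  have bdd: "bdd_above (h l ` U)" for l
  proof -
    have "compact (h l ` U)" unfolding h_def
      by (intro compact_continuous_image continuous_intros continuous_on_f continuous_on_r U)
    then show ?thesis by (intro bounded_imp_bdd_above compact_imp_bounded)
  qed
  have lip: "\<phi> a \<le> \<phi> b + (norm \<xi> * N) * \<bar>a - b\<bar>" for a b
    unfolding \<phi>[of a]
  proof (rule cSUP_least)
    fix \<omega> assume \<omega>: "\<omega> \<in> U"
    have "h a \<omega> = h b \<omega> + (a - b) * (\<xi> \<bullet> f X \<omega>)" by (simp add: h_def algebra_simps)
    also have "(a - b) * (\<xi> \<bullet> f X \<omega>) \<le> \<bar>a - b\<bar> * (norm \<xi> * N)"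
    proof -
      have "\<bar>\<xi> \<bullet> f X \<omega>\<bar> \<le> norm \<xi> * N"
        using Cauchy_Schwarz_ineq2[of \<xi> "f X \<omega>"] less_imp_le[OF f_bound[OF \<omega>, of X]]
        by (meson mult_left_mono norm_ge_zero order_trans)
      then have "\<bar>a - b\<bar> * \<bar>\<xi> \<bullet> f X \<omega>\<bar> \<le> \<bar>a - b\<bar> * (norm \<xi> * N)" by (intro mult_left_mono) auto
      then show ?thesis using abs_ge_self[of "(a - b) * (\<xi> \<bullet> f X \<omega>)"] by (simp add: abs_mult)
    qed
    also have "h b \<omega> \<le> \<phi> b" unfolding \<phi> using \<omega> bdd by (intro cSUP_upper)
    finally show "h a \<omega> \<le> \<phi> b + (norm \<xi> * N) * \<bar>a - b\<bar>" by (simp add: mult.commute)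
  qed (rule U)
  have "(norm \<xi> * N)-lipschitz_on UNIV \<phi>"
  proof (rule lipschitz_onI)
    fix a b
    show "dist (\<phi> a) (\<phi> b) \<le> norm \<xi> * N * dist a b"
      using lip[of a b] lip[of b a] by (simp add: dist_real_def abs_le_iff abs_minus_commute)
  qed (use N_pos in simp)
  then have cont: "continuous_on {a..b} \<phi>" for a b
    using lipschitz_on_continuous_on continuous_on_subset by blast
  have qf: "\<bar>q \<bullet> f X \<omega>\<bar> \<le> G * N" if "\<omega> \<in> U" for \<omega>
    using Cauchy_Schwarz_ineq2[of q "f X \<omega>"] q less_imp_le[OF f_bound[OF that, of X]]
    by (meson mult_mono norm_ge_zero order_trans)
  have \<phi>0: "\<phi> 0 < 0"
  proof -
    have "\<phi> 0 \<le> - \<kappa>" unfolding \<phi>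
    proof (rule cSUP_least)
      fix \<omega> assume "\<omega> \<in> U"
      then show "h 0 \<omega> \<le> - \<kappa>" using qf[of \<omega>] r_lower[of \<omega> X] by (simp add: h_def \<kappa>_def abs_le_iff)
    qed (rule U)
    then show ?thesis using kappa_pos by simp
  qed
  define \<Lambda> where "\<Lambda> = (r X \<omega>1 + q \<bullet> f X \<omega>1) / (\<xi> \<bullet> f X \<omega>1)"
  have "r X \<omega>1 + q \<bullet> f X \<omega>1 \<ge> \<kappa>" using qf[OF \<omega>1(1)] r_lower[OF \<omega>1(1), of X] by (simp add: \<kappa>_def abs_le_iff)
  then have \<Lambda>: "0 \<le> \<Lambda>" using kappa_pos \<omega>1 by (simp add: \<Lambda>_def)
  have "h \<Lambda> \<omega>1 = 0" using \<omega>1 by (simp add: h_def \<Lambda>_def inner_diff_left)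
  then have "0 \<le> \<phi> \<Lambda>" unfolding \<phi> using \<omega>1(1) bdd cSUP_upper by metis
  then obtain l where "0 \<le> l" "\<phi> l = 0"
    using IVT'[of \<phi> 0 0 \<Lambda>] \<phi>0 \<Lambda> cont by auto
  then show ?thesis using \<phi>0 by (intro exI[of _ l]) (auto simp: \<phi>_def less_le)
qed

text \<open>The first factor in the denominator bounds the costate bound plus
  \<open>\<mu> + \<sigma>\<close> by a multiple of \<open>\<mu> + l\<close>, the second bounds
  \<open>\<mu> + l\<close> by a multiple of the length of the normal. Their product with
  \<open>bound_const\<close> is a coefficient per unit length of the normal, free of
  \<open>l\<close>.\<close>

definition "sphere_radius Tm c = 1 / (2 * ((G + 1 + L * Tm) * exp (L * Tm) + 1 + 1 / (2 * \<rho>0))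
   * (1 + G + (1 + L * Tm) * exp (L * Tm)) * bound_const Tm c)"

lemma sphere_radius_pos:
  assumes "0 \<le> Tm" "0 \<le> c"
  shows "sphere_radius Tm c > 0"
proof -
  have d: "delay_const Tm \<ge> 0"
    using kappa_pos L_pos terminal_const assms by (simp add: delay_const_def add_nonneg_nonneg)
  have "growth_const Tm > 0" by (simp add: growth_const_def)
  then have "reach_const Tm \<ge> 0" "growth_const Tm \<ge> 0" using d N_pos by (auto simp: reach_const_def)
  then have "bound_const Tm c > 0"
    unfolding bound_const_def using d L_pos N_pos assms terminal_const
    by (intro add_pos_nonneg) auto
  then show ?thesis
    unfolding sphere_radius_def using assms constants L_pos terminal_const
    by (intro divide_pos_pos mult_pos_pos add_pos_nonneg add_nonneg_pos) (auto intro: add_nonneg_nonneg add_nonneg_pos)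
qed

text \<open>Both conclusions come from the same transported normal. Its radius is measured relative
  to its own length, which removes the unbounded factor \<open>l\<close> from the estimate.\<close>

lemma exterior_normal_exists:
  assumes x: "x \<notin> S" and u: "u \<in> optimal_controls U S f r g x" and hit: "hit_time S f x u = ereal T"
    and X: "X = traj f x u T" and T: "T \<le> Tm" and c: "0 \<le> c"
    "\<And>q z. \<lbrakk>q \<in> superdiff g X; z \<in> frontier S\<rbrakk> \<Longrightarrow> g z \<le> g X + q \<bullet> (z - X) + c * (norm (z - X))\<^sup>2"
  defines "a \<equiv> (x, real_of_ereal (value_fn U S f r g x))" and "H \<equiv> hypo S (value_fn U S f r g)"
  shows "N1_dagger U S f r g Df Dr x \<union> N0_dagger U S f r g Df x \<noteq> {}"
    and "\<exists>v. v \<noteq> 0 \<and> v \<in> prox_normal H a \<and> realized_by_ball H a v (sphere_radius Tm c)"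
proof -
  note o = optimalD[OF u]
  have xc: "x \<in> closure (- S)" by (rule in_closure_Compl[OF x])
  have XF: "X \<in> frontier S" unfolding X by (rule frontier_if_first_hit[OF o(1) xc hit])
  have T0: "0 \<le> T" by (rule hit_time_eqD(1)[OF o(1) hit])
  have Tm: "0 \<le> Tm" using T T0 by simp
  obtain \<xi> where \<xi>: "norm \<xi> = 1" "\<xi> \<in> prox_normal (closure (- S)) X"
    "\<And>y. y \<in> closure (- S) \<Longrightarrow> \<xi> \<bullet> (y - X) \<le> 1 / (2 * \<rho>0) * (norm (y - X))\<^sup>2"
    using inner_ball[OF XF] by blast
  obtain q where q: "q \<in> superdiff g X"
    using locally_semiconcave_superdiff_nonempty[OF g_semiconcave] by blast
  have qG: "norm q \<le> G" by (rule superdiff_frontier_norm_le[OF XF q])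
  \<comment> \<open>\<open>\<mu> = 1\<close> when some velocity points strictly into the inner ball,
    and \<open>\<xi>\<close> is then rescaled; otherwise the maximum of \<xi>.f is 0, and
    \<open>\<mu> = 0\<close>, \<open>l = 1\<close>.\<close>
  have "\<exists>\<mu> l. (\<mu> = 0 \<and> l = 1 \<and> \<xi> \<in> N0 U S f X \<or> \<mu> = 1 \<and> l > 0 \<and> l *\<^sub>R \<xi> \<in> N1 U S f X \<and> hamiltonian U f r X (q - l *\<^sub>R \<xi>) = 0) \<and>
     (\<forall>\<omega>\<in>U. 0 \<le> (\<mu> *\<^sub>R q - l *\<^sub>R \<xi>) \<bullet> f X \<omega> + \<mu> * r X \<omega>) \<and>
     (\<exists>\<omega>\<in>U. (\<mu> *\<^sub>R q - l *\<^sub>R \<xi>) \<bullet> f X \<omega> + \<mu> * r X \<omega> = 0)"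
  proof (cases "\<exists>\<omega>\<in>U. \<xi> \<bullet> f X \<omega> > 0")
    case True
    then obtain \<omega>1 where \<omega>1: "\<omega>1 \<in> U" "\<xi> \<bullet> f X \<omega>1 > 0" by blast
    then obtain l where l: "l > 0" "hamiltonian U f r X (q - l *\<^sub>R \<xi>) = 0"
      using hamiltonian_zero_exists[OF qG] by blast
    have "l *\<^sub>R \<xi> \<in> N1 U S f X"
      unfolding N1_def using l(1) \<omega>1 prox_normal_scaleR[OF \<xi>(2), of l]
      by (auto simp only: mem_Collect_eq inner_f_pos_iff less_imp_le intro!: bexI[of _ \<omega>1]) simp
    then show ?thesis
      using l hamiltonian_eq_0_iff[of X "q - l *\<^sub>R \<xi>"] by (intro exI[of _ 1] exI[of _ l]) simp
  next
    case False
    then have le: "\<xi> \<bullet> f X \<omega> \<le> 0" if "\<omega> \<in> U" for \<omega> using that by force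
    obtain \<omega>1 where \<omega>1: "\<omega>1 \<in> U" "\<xi> \<bullet> f X \<omega>1 \<ge> 0"
      using inner_f_max_nonneg[OF x o(1) hit X \<xi>(1,3)] by blast
    then have eq: "\<xi> \<bullet> f X \<omega>1 = 0" using le[OF \<omega>1(1)] by simp
    then have "(SUP \<omega>\<in>U. \<xi> \<bullet> f X \<omega>) = 0" using le \<omega>1(1) by (auto simp: inner_f_eq_0_iff)
    then have "\<xi> \<in> N0 U S f X" using \<xi> by (auto simp: N0_def)
    then show ?thesis using le \<omega>1(1) eq by (intro exI[of _ 0] exI[of _ 1]) auto
  qed
  then obtain \<mu> l where ml: "\<mu> = 0 \<and> l = 1 \<and> \<xi> \<in> N0 U S f X \<or> \<mu> = 1 \<and> l > 0 \<and> l *\<^sub>R \<xi> \<in> N1 U S f X \<and> hamiltonian U f r X (q - l *\<^sub>R \<xi>) = 0"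
    and ham: "\<And>\<omega>. \<omega> \<in> U \<Longrightarrow> 0 \<le> (\<mu> *\<^sub>R q - l *\<^sub>R \<xi>) \<bullet> f X \<omega> + \<mu> * r X \<omega>"
    "\<exists>\<omega>\<in>U. (\<mu> *\<^sub>R q - l *\<^sub>R \<xi>) \<bullet> f X \<omega> + \<mu> * r X \<omega> = 0"
    by blast
  have mu: "0 \<le> \<mu>" "0 < l" using ml by auto
  obtain p where p: "p T = \<mu> *\<^sub>R q - l *\<^sub>R \<xi>" "caratheodory_solution (adjoint x u \<mu>) {0..T} p"
    using adjoint_exists[OF o(1) T0 mu(1)] by blast
  have Th: "T = real_of_ereal (hit_time S f x u)" using hit by simp
  show "N1_dagger U S f r g Df Dr x \<union> N0_dagger U S f r g Df x \<noteq> {}"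
  proof (cases "\<mu> = 0")
    case True
    then have m0: "l = 1" "\<xi> \<in> N0 U S f X" using ml by auto
    have "p 0 \<in> N0_dagger U S f r g Df x"
      unfolding N0_dagger_def using u Th m0 p True
      by (intro CollectI exI[of _ p] exI[of _ u] exI[of _ T] exI[of _ \<xi>]) (auto simp: X adjoint_def)
    then show ?thesis by blast
  next
    case False
    then have m1: "\<mu> = 1" "l *\<^sub>R \<xi> \<in> N1 U S f X" "hamiltonian U f r X (q - l *\<^sub>R \<xi>) = 0" using ml by auto
    have "p 0 \<in> N1_dagger U S f r g Df Dr x"
      unfolding N1_dagger_def using u Th m1 p q
      by (intro CollectI exI[of _ p] exI[of _ u] exI[of _ T] exI[of _ "l *\<^sub>R \<xi>"] exI[of _ q]) (auto simp: X adjoint_def)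
    then show ?thesis by blast
  qed
  define E0 where "E0 = exp (L * Tm)"
  have E0: "E0 \<ge> 1" using L_pos Tm by (simp add: E0_def)
  define \<sigma> where "\<sigma> = l / (2 * \<rho>0)"
  have \<sigma>: "0 \<le> \<sigma>" using mu constants by (simp add: \<sigma>_def)
  have sig: "(l *\<^sub>R \<xi>) \<bullet> (z - X) \<le> \<sigma> * (norm (z - X))\<^sup>2" if "z \<in> closure (- S)" for z
  proof -
    have "l * (\<xi> \<bullet> (z - X)) \<le> l * (1 / (2 * \<rho>0) * (norm (z - X))\<^sup>2)"
      using \<xi>(3)[OF that] mu by (intro mult_left_mono) auto
    then show ?thesis by (simp add: \<sigma>_def)
  qed
  define v where "v = (- p 0, \<mu>)"
  have v\<mu>: "\<mu> \<le> norm v" and vp: "norm (p 0) \<le> norm v"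
    using norm_snd_le[of \<mu> "- p 0"] norm_fst_le[of "- p 0" \<mu>] mu by (auto simp: v_def)
  define C1 where "C1 = (G + 1 + L * Tm) * E0 + 1 + 1 / (2 * \<rho>0)"
  define C2 where "C2 = 1 + G + (1 + L * Tm) * E0"
  define B where "B = bound_const Tm c"
  \<comment> \<open>Since \<open>\<xi>\<close> has length 1, \<open>l\<close> is the norm of
    \<open>\<mu> *\<^sub>R q - p T\<close>, and \<open>p T\<close> is bounded forward in time by
    \<open>p 0\<close>. A large \<open>l\<close> thus forces a long normal.\<close>
  have norms: "\<mu> + l \<le> C2 * norm v"
  proof -
    have "l = norm (l *\<^sub>R \<xi>)" using mu \<xi>(1) by simp
    also have "l *\<^sub>R \<xi> = \<mu> *\<^sub>R q - p T" using p(1) by simp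
    also have "norm (\<mu> *\<^sub>R q - p T) \<le> \<mu> * norm q + norm (p T)"
      using norm_triangle_ineq4[of "\<mu> *\<^sub>R q" "p T"] mu by simp
    also have "\<dots> \<le> \<mu> * G + (norm (p 0) + \<mu> * L * Tm) * E0"
      using adjoint_growth(2)[OF o(1) T0 T mu(1) p(2), of T] T0 qG mu unfolding E0_def
      by (intro add_mono mult_left_mono) auto
    also have "\<dots> \<le> norm v * G + (norm v + norm v * L * Tm) * E0"
      using v\<mu> vp terminal_const L_pos Tm E0 by (intro add_mono mult_right_mono) auto
    finally show ?thesis using v\<mu> by (simp add: C2_def algebra_simps)
  qed
  \<comment> \<open>For \<open>\<mu> = 0\<close> this says that transport does not annihilate the
    normal: \<open>l > 0\<close> bounds its length from below.\<close>
  have "v \<noteq> 0" using norms mu by auto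
  have PB: "(norm (p T) + \<mu> * L * Tm) * E0 + \<mu> + \<sigma> \<le> (\<mu> + l) * C1"
  proof -
    have "norm (p T) \<le> \<mu> * G + l"
    proof -
      have "norm (p T) \<le> \<mu> * norm q + l * norm \<xi>"
        unfolding p(1) using norm_triangle_ineq4[of "\<mu> *\<^sub>R q" "l *\<^sub>R \<xi>"] mu by simp
      also have "\<dots> \<le> \<mu> * G + l" using qG \<xi>(1) mu by (simp add: mult_left_mono)
      finally show ?thesis .
    qed
    then have "(norm (p T) + \<mu> * L * Tm) * E0 \<le> (\<mu> * G + l + \<mu> * L * Tm) * E0"
      using E0 by (intro mult_right_mono) auto
    also have "\<dots> \<le> ((\<mu> + l) * (G + 1 + L * Tm)) * E0"
    proof (rule mult_right_mono)
      have "0 \<le> \<mu> + l * G + l * (L * Tm)" using mu terminal_const L_pos Tm by simp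
      then show "\<mu> * G + l + \<mu> * L * Tm \<le> (\<mu> + l) * (G + 1 + L * Tm)" by (simp add: algebra_simps)
    qed (use E0 in simp)
    finally have "(norm (p T) + \<mu> * L * Tm) * E0 \<le> ((\<mu> + l) * (G + 1 + L * Tm)) * E0" .
    moreover have "\<mu> + \<sigma> \<le> (\<mu> + l) * (1 + 1 / (2 * \<rho>0))"
    proof -
      have "l / (2 * \<rho>0) \<le> (\<mu> + l) / (2 * \<rho>0)" using mu constants by (intro divide_right_mono) auto
      moreover have "(\<mu> + l) * (1 + 1 / (2 * \<rho>0)) = \<mu> + l + (\<mu> + l) / (2 * \<rho>0)" by (simp add: distrib_left)
      ultimately show ?thesis using mu unfolding \<sigma>_def by linarith
    qed
    ultimately show ?thesis by (simp add: C1_def algebra_simps)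
  qed
  have C1: "C1 > 0" using terminal_const L_pos Tm E0 constants
    by (auto simp: C1_def intro!: add_pos_pos add_nonneg_pos mult_nonneg_nonneg add_nonneg_nonneg)
  have C2: "C2 > 0" using terminal_const L_pos Tm E0
    by (auto simp: C2_def intro!: add_pos_nonneg mult_nonneg_nonneg add_nonneg_nonneg)
  have R: "sphere_radius Tm c = 1 / (2 * C1 * C2 * B)" by (simp add: sphere_radius_def C1_def C2_def B_def E0_def)
  have Rp: "sphere_radius Tm c > 0" by (rule sphere_radius_pos[OF Tm c(1)])
  then have B: "B > 0" using mult_pos_pos[OF C1 C2] by (simp add: R zero_less_mult_iff)
  have real: "v \<bullet> (z - a) \<le> norm v / (2 * sphere_radius Tm c) * (norm (z - a))\<^sup>2" if z: "z \<in> H" for z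
  proof -
    have "v \<bullet> (z - a) \<le> ((norm (p T) + \<mu> * L * Tm) * E0 + \<mu> + \<sigma>) * B * (norm (z - a))\<^sup>2"
      unfolding v_def a_def B_def E0_def
      by (rule transported_normal_hypo[OF x u hit X T mu(1) p(2,1) \<sigma> sig q c(1) c(2)[OF q]])
        (use ham z in \<open>auto simp: p(1) H_def\<close>)
    also have "\<dots> \<le> ((C2 * norm v) * C1) * B * (norm (z - a))\<^sup>2"
    proof (intro mult_right_mono)
      have "(\<mu> + l) * C1 \<le> (C2 * norm v) * C1" using norms C1 by (intro mult_right_mono) auto
      then show "(norm (p T) + \<mu> * L * Tm) * E0 + \<mu> + \<sigma> \<le> (C2 * norm v) * C1" using PB by linarith
    qed (use B in auto)
    also have "\<dots> = norm v / (2 * sphere_radius Tm c) * (norm (z - a))\<^sup>2"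
      using C1 C2 B by (simp add: R)
    finally show ?thesis .
  qed
  have "v \<in> prox_normal H a"
    unfolding prox_normal_def using real Rp value_in_hypo[OF x u]
    by (auto simp: a_def H_def intro!: exI[of _ "norm v / (2 * sphere_radius Tm c)"])
  then show "\<exists>v. v \<noteq> 0 \<and> v \<in> prox_normal H a \<and> realized_by_ball H a v (sphere_radius Tm c)"
    using \<open>v \<noteq> 0\<close> real unfolding realized_by_ball_def by blast
qed

text \<open>Continuity bounds V by \<open>v0 + 1\<close> near \<open>x0\<close>, hence the exit
  times by \<open>Tm\<close>, and hence the exit points by a fixed ball on which the semiconcavity
  constant is uniform. The radii, constant near each point, are merged into one continuous function
  by \<open>continuous_minorant_radius\<close>.\<close>

lemma exterior_sphere:
  assumes V_cont: "continuous_on (reach_set U S f) (value_fn U S f r g)"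
    and opt: "\<And>x. \<lbrakk>x \<in> reach_set U S f; x \<notin> S\<rbrakk> \<Longrightarrow> \<exists>u. u \<in> optimal_controls U S f r g x"
  shows "exterior_sphere_on (reach_set U S f - S) S (value_fn U S f r g)"
proof -
  define V where "V = value_fn U S f r g"
  define D where "D = reach_set U S f - S"
  define P where "P = (\<lambda>x \<rho>. \<exists>v. v \<noteq> 0 \<and> v \<in> prox_normal (hypo S V) (x, real_of_ereal (V x)) \<and>
     realized_by_ball (hypo S V) (x, real_of_ereal (V x)) v \<rho>)"
  have "\<exists>\<rho>::real ^ 'd \<Rightarrow> real. continuous_on D \<rho> \<and> (\<forall>x\<in>D. \<rho> x > 0 \<and> P x (\<rho> x))"
  proof (rule continuous_minorant_radius)
    fix x and a b :: real assume "P x b" and ab: "0 < a" "a \<le> b"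
    then obtain v where v: "v \<noteq> 0" "v \<in> prox_normal (hypo S V) (x, real_of_ereal (V x))"
      "realized_by_ball (hypo S V) (x, real_of_ereal (V x)) v b" by (auto simp: P_def)
    have "norm v / (2 * b) \<le> norm v / (2 * a)" using ab by (intro divide_left_mono) auto
    then have "norm v / (2 * b) * n\<^sup>2 \<le> norm v / (2 * a) * n\<^sup>2" for n by (intro mult_right_mono) auto
    then have "realized_by_ball (hypo S V) (x, real_of_ereal (V x)) v a"
      using v(3) unfolding realized_by_ball_def by (meson order_trans)
    then show "P x a" unfolding P_def using v(1,2) by blast
  next
    fix x0 assume x0: "x0 \<in> D"
    then have xR: "x0 \<in> reach_set U S f" "x0 \<notin> S" by (auto simp: D_def)
    obtain v0 where v0: "V x0 = ereal v0" using value_fn_finite[OF xR] by (auto simp: V_def)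
    obtain z0 where z0: "z0 \<in> frontier S" by (rule reach_set_frontier_point[OF xR])
    have "(V \<longlongrightarrow> V x0) (at x0 within reach_set U S f)"
      using V_cont xR(1) by (simp add: continuous_on_def V_def)
    then have "eventually (\<lambda>x. V x < ereal (v0 + 1)) (at x0 within reach_set U S f)"
      by (rule order_tendstoD(2)) (simp add: v0)
    then obtain e where e: "e > 0" "\<And>x. \<lbrakk>x \<in> reach_set U S f; x \<noteq> x0; dist x x0 < e\<rbrakk> \<Longrightarrow> V x < ereal (v0 + 1)"
      by (auto simp: eventually_at)
    have Vle: "V x < ereal (v0 + 1)" if "x \<in> reach_set U S f" "dist x x0 < e" for x
      using e(2)[OF that(1) _ that(2)] v0 by (cases "x = x0") auto
    \<comment> \<open>From \<open>cost_lower_bound\<close>, for costs of at most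
      \<open>v0 + 1\<close> and starting points within distance 1 of \<open>x0\<close>.\<close>
    define Tm where "Tm = (v0 + 1 - g z0 + G * (norm (x0 - z0) + 1)) / \<kappa>"
    have T_le: "T \<le> Tm" "0 \<le> T"
      if x: "x \<in> reach_set U S f" "x \<notin> S" "dist x x0 < min e 1" and u: "u \<in> optimal_controls U S f r g x"
        and hit: "hit_time S f x u = ereal T" for x u T
    proof -
      note o = optimalD[OF u]
      have "cost S f r g x u \<le> v0 + 1" using Vle[of x] x o(4) by (metis V_def ereal_less_eq(3) less_imp_le min_less_iff_conj)
      then have "\<kappa> * T \<le> v0 + 1 - g z0 + G * norm (x - z0)"
        using cost_lower_bound[OF o(1) in_closure_Compl[OF x(2)] hit z0] by linarith
      moreover have "G * norm (x - z0) \<le> G * (norm (x0 - z0) + 1)"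
        using norm_triangle_ineq[of "x - x0" "x0 - z0"] x(3) terminal_const
        by (intro mult_left_mono) (auto simp: dist_norm)
      ultimately show "T \<le> Tm" using kappa_pos by (simp add: Tm_def pos_le_divide_eq mult.commute)
      show "0 \<le> T" by (rule hit_time_eqD(1)[OF o(1) hit])
    qed
    \<comment> \<open>Exit points lie within \<open>N * Tm\<close> of a start that is itself within
      distance 1 of \<open>x0\<close>.\<close>
    obtain c where c: "c \<ge> 0" "\<And>X q z. \<lbrakk>X \<in> frontier S; norm (X - x0) \<le> N * Tm + 1; q \<in> superdiff g X; z \<in> frontier S\<rbrakk> \<Longrightarrow>
       g z \<le> g X + q \<bullet> (z - X) + c * (norm (z - X))\<^sup>2"
      using semiconcave_frontier by blast
    have Tm: "0 \<le> Tm"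
    proof -
      obtain u where u: "u \<in> optimal_controls U S f r g x0" using opt[OF xR] by blast
      obtain T where "hit_time S f x0 u = ereal T" using optimalD(2)[OF u] by blast
      then show ?thesis using T_le[OF xR _ u, of T] e(1) by auto
    qed
    have "P x (sphere_radius Tm c)" if "x \<in> D" "dist x0 x < min e 1" for x
    proof -
      have x: "x \<in> reach_set U S f" "x \<notin> S" "dist x x0 < min e 1" using that by (auto simp: D_def dist_commute)
      obtain u where u: "u \<in> optimal_controls U S f r g x" using opt[OF x(1,2)] by blast
      note o = optimalD[OF u]
      obtain T where hit: "hit_time S f x u = ereal T" using o(2) by blast
      define X where "X = traj f x u T"
      have XF: "X \<in> frontier S" unfolding X_def by (rule frontier_if_first_hit[OF o(1) in_closure_Compl[OF x(2)] hit])
      have "norm (X - x) \<le> N * \<bar>T - 0\<bar>"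
        using traj_lipschitz[OF o(1), of 0 T x] T_le[OF x u hit] traj_solution(1)[OF o(1)] by (simp add: X_def)
      also have "\<dots> \<le> N * Tm" using T_le[OF x u hit] N_pos by (intro mult_left_mono) auto
      finally have "norm (X - x0) \<le> N * Tm + 1"
        using norm_triangle_ineq[of "X - x" "x - x0"] x(3) by (simp add: dist_norm)
      from c(2)[OF XF this] show ?thesis
        unfolding P_def V_def
        by (intro exterior_normal_exists(2)[OF x(2) u hit X_def T_le(1)[OF x u hit] c(1)])
    qed
    then show "\<exists>e>0. \<exists>c>0. \<forall>y\<in>D. dist x0 y < e \<longrightarrow> P y c"
      using sphere_radius_pos[OF Tm c(1)] e(1) by (intro exI[of _ "min e 1"]) auto
  qed
  then show ?thesis unfolding exterior_sphere_on_def P_def D_def V_def by blast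
qed

lemma dagger_nonempty:
  assumes x: "x \<notin> S" and u: "u \<in> optimal_controls U S f r g x"
  shows "N1_dagger U S f r g Df Dr x \<union> N0_dagger U S f r g Df x \<noteq> {}"
proof -
  note o = optimalD[OF u]
  obtain T where hit: "hit_time S f x u = ereal T" using o(2) by blast
  have XF: "traj f x u T \<in> frontier S" by (rule frontier_if_first_hit[OF o(1) in_closure_Compl[OF x] hit])
  obtain c where c: "c \<ge> 0"
    "\<And>Y q z. \<lbrakk>Y \<in> frontier S; norm (Y - traj f x u T) \<le> 0; q \<in> superdiff g Y; z \<in> frontier S\<rbrakk> \<Longrightarrow>
       g z \<le> g Y + q \<bullet> (z - Y) + c * (norm (z - Y))\<^sup>2"
    using semiconcave_frontier by blast
  show ?thesis
    using c(2)[OF XF] by (intro exterior_normal_exists(1)[OF x u hit refl order_refl c(1)]) auto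
qed

end

theorem theorem3p1:
  fixes U :: "(real ^ 'm) set"
    and S :: "(real ^ 'd) set"
    and f :: "real ^ 'd \<Rightarrow> real ^ 'm \<Rightarrow> real ^ 'd"
    and r :: "real ^ 'd \<Rightarrow> real ^ 'm \<Rightarrow> real"
    and g :: "real ^ 'd \<Rightarrow> real"
    and Df :: "real ^ 'd \<Rightarrow> real ^ 'm \<Rightarrow> real ^ 'd ^ 'd"
    and Dr :: "real ^ 'd \<Rightarrow> real ^ 'm \<Rightarrow> real ^ 'd"
    and N L r0 \<rho>0 G :: real
    and Nb :: "(real ^ 'd) set"
  assumes U: "U \<noteq> {}" "compact U"
    and S: "S \<noteq> {}" "closed S"
    and constants: "N > 0" "L > 0" "r0 > 0" "\<rho>0 > 0"
    and convexity: "\<And>x. convex {(v, l). \<exists>\<omega>\<in>U. v = f x \<omega> \<and> l \<ge> r x \<omega>}"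
    and f_cont: "continuous_on (UNIV \<times> U) (\<lambda>(x, \<omega>). f x \<omega>)"
    and f_bound: "\<And>x \<omega>. \<omega> \<in> U \<Longrightarrow> norm (f x \<omega>) < N"
    and f_deriv: "\<And>x \<omega>. \<omega> \<in> U \<Longrightarrow> ((\<lambda>y. f y \<omega>) has_derivative (\<lambda>h. Df x \<omega> *v h)) (at x)"
    and Df_cont: "continuous_on (UNIV \<times> U) (\<lambda>(x, \<omega>). Df x \<omega>)"
    and f_lip: "\<And>x y \<omega>. \<omega> \<in> U \<Longrightarrow> norm (f y \<omega> - f x \<omega>) \<le> L * norm (y - x)"
    and Df_lip: "\<And>x y \<omega>. \<omega> \<in> U \<Longrightarrow> onorm (\<lambda>h. (Df y \<omega> - Df x \<omega>) *v h) \<le> L * norm (y - x)"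
    and r_cont: "continuous_on (UNIV \<times> U) (\<lambda>(x, \<omega>). r x \<omega>)"
    and r_deriv: "\<And>x \<omega>. \<omega> \<in> U \<Longrightarrow> ((\<lambda>y. r y \<omega>) has_derivative (\<lambda>h. Dr x \<omega> \<bullet> h)) (at x)"
    and Dr_cont: "continuous_on (UNIV \<times> U) (\<lambda>(x, \<omega>). Dr x \<omega>)"
    and r_lip: "\<And>x y \<omega>. \<omega> \<in> U \<Longrightarrow>
        \<bar>r y \<omega> - r x \<omega>\<bar> + norm (Dr y \<omega> - Dr x \<omega>) \<le> L * norm (y - x)"
    and r_lower: "\<And>x \<omega>. \<omega> \<in> U \<Longrightarrow> r x \<omega> \<ge> r0"
    and terminal_nbhd: "frontier S \<subseteq> interior Nb"
    and terminal_const: "0 \<le> G" "G < r0 / N"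
    and terminal_lip: "\<And>x y. x \<in> Nb \<Longrightarrow> y \<in> Nb \<Longrightarrow> \<bar>g y - g x\<bar> \<le> G * norm (y - x)"
    and inner_ball: "\<And>x. x \<in> frontier S \<Longrightarrow>
        \<exists>\<xi>. norm \<xi> = 1 \<and> \<xi> \<in> prox_normal (closure (- S)) x \<and>
          (\<forall>y\<in>closure (- S). \<xi> \<bullet> (y - x) \<le> 1 / (2 * \<rho>0) * (norm (y - x))\<^sup>2)"
    and g_semiconcave: "locally_semiconcave g"
    and V_cont: "continuous_on (reach_set U S f) (value_fn U S f r g)"
  shows "exterior_sphere_on (reach_set U S f - S) S (value_fn U S f r g) \<and>
    (\<forall>x\<in>reach_set U S f - S.
       N1_dagger U S f r g Df Dr x \<union> N0_dagger U S f r g Df x \<noteq> {}) \<and>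
    (\<forall>x\<in>reach_set U S f - S.
       {a + b | a b. a \<in> horizon_superdiff S (value_fn U S f r g) x \<and>
                     b \<in> convex hull (N1_dagger U S f r g Df Dr x)}
         \<subseteq> prox_superdiff S (value_fn U S f r g) x \<and>
       convex hull (N0_dagger U S f r g Df x \<union> {0})
         \<subseteq> horizon_superdiff S (value_fn U S f r g) x)"
proof -
  interpret exit_time_problem U S f r g Df Dr N L r0 \<rho>0 G Nb
    by (rule exit_time_problem.intro) (fact assms)+
  have opt: "\<exists>u. u \<in> optimal_controls U S f r g x" if "x \<in> reach_set U S f" "x \<notin> S" for x
    using that by (rule optimal_control_exists)
  show ?thesis
  proof (intro conjI ballI)
    show "exterior_sphere_on (reach_set U S f - S) S (value_fn U S f r g)"
      using V_cont opt by (rule exterior_sphere)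
  next
    fix x assume "x \<in> reach_set U S f - S"
    then show "N1_dagger U S f r g Df Dr x \<union> N0_dagger U S f r g Df x \<noteq> {}"
      using opt dagger_nonempty by blast
  next
    fix x assume x: "x \<in> reach_set U S f - S"
    have "convex hull (N1_dagger U S f r g Df Dr x) \<subseteq> prox_superdiff S (value_fn U S f r g) x"
      using x N1_dagger_subset by (intro hull_minimal convex_prox_superdiff) auto
    then show "{a + b | a b. a \<in> horizon_superdiff S (value_fn U S f r g) x \<and>
        b \<in> convex hull (N1_dagger U S f r g Df Dr x)} \<subseteq> prox_superdiff S (value_fn U S f r g) x"
      using horizon_add_prox_superdiff by blast
  next
    fix x assume x: "x \<in> reach_set U S f - S"
    then obtain u where "u \<in> optimal_controls U S f r g x" using opt by blast
    \<comment> \<open>The zero vector is a proximal normal as soon as the base point lies in the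
      hypograph; existence of an optimal control gives this, as V is then finite at
      \<open>x\<close>.\<close>
    then have "0 \<in> horizon_superdiff S (value_fn U S f r g) x"
      using x value_in_hypo by (auto simp: horizon_superdiff_def prox_normal_def intro!: exI[of _ 0])
    then show "convex hull (N0_dagger U S f r g Df x \<union> {0}) \<subseteq> horizon_superdiff S (value_fn U S f r g) x"
      using x N0_dagger_subset by (intro hull_minimal convex_horizon_superdiff) auto
  qed
qed

end
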